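(* Fix $x\in\mathcal{X}$ and write $H(\theta)=H(x,\theta)$. Assume: (i) $\Theta\subset\mathbb{R}^l$ is compact; (ii) for every $n$, $\mathbb{P}^n_\theta$ has a density $p^n_\theta(\cdot)$ (with respect to a $\sigma$-finite measure on $\Xi^n$ not depending on $\theta$) that is jointly measurable in $\theta\in\Theta$ and its argument in $\Xi^n$ (write $p_\theta=p_\theta^1$); (iii) for any neighborhood $V\in\mathcal{B}_\Theta$ of $\theta^c$ there exists a sequence of uniformly consistent tests of the hypothesis $\tilde\theta=\theta^c$ against the alternative $\tilde\theta\in\Theta\setminus V$; (iv) for any $\epsilon>0$ and any neighborhood $V\in\mathcal{B}_\Theta$ of $\theta^c$, $V$ contains a subset $W$ with $\pi(W)>0$ and $D_{KL}(p_{\theta^c}\|p_\theta)<\epsilon$ for all $\theta\in W$; (v) there is a constant $\gamma>0$ such that for all $\epsilon>0$ there exists $M_\epsilon>0$ with $\mathbb{P}^{\mathbb{N}}_{\theta^c}\{\mathbb{E}_{\mathbb{P}_n}[\|\sqrt n(\theta-\theta^c)\|^{1+\gamma}]>M_\epsilon\}<\epsilon$ for all $n$; (vi) (standing assumption) the Bernstein–von Mises property and the asymptotic normality of the posterior mean described in the context hold; (vii) $H$ is differentiable at $\theta^c$; (viii) $\mathbb{P}^{\mathbb{N}}_{\theta^c}$-almost surely, for all $n$, when $\theta\sim\mathbb{P}_n$ the random variables $\sqrt n(\theta-\theta^c)$ and $\sqrt n[H(\theta)-H(\theta^c)]$ have positive densities (with respect to Lebesgue measure, positive on their respective sets of possible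 values). Then for any $\alpha\in(0,1)$, under $\mathbb{P}^{\mathbb{N}}_{\theta^c}$, as $n\to\infty$, $$\sqrt n\{\mathrm{CVaR}^\alpha_{\mathbb{P}_n}[H(\theta)]-H(\theta^c)\}\Rightarrow\mathcal{N}\Big(\frac{\sigma_x}{1-\alpha}\phi(\Phi^{-1}(\alpha)),\ \sigma_x^2\Big),$$ where $\sigma_x^2:=\nabla_\theta H(x,\theta^c)^\top[I(\theta^c)]^{-1}\nabla_\theta H(x,\theta^c)$, $\sigma_x\ge0$, and $\phi,\Phi$ are the standard normal density and distribution function.
   Context: Setting. $\Theta\subset\mathbb{R}^l$ carries its Borel $\sigma$-algebra $\mathcal{B}_\Theta$ and a prior probability measure $\pi$; $\Xi\subset\mathbb{R}^m$ carries its Borel $\sigma$-algebra and a family of probability measures $\{\mathbb{P}_\theta\}_{\theta\in\Theta}$. $\mathbb{P}^n_\theta$ and $\mathbb{P}^{\mathbb{N}}_\theta$ are the $n$-fold and countably infinite product measures; it is assumed that $\theta\mapsto\mathbb{P}^{\mathbb{N}}_\theta(B)$ is measurable for every measurable $B\subset\Xi^{\mathbb{N}}$. $\theta^c\in\Theta$ is the fixed true parameter; the data $\xi_1,\xi_2,\dots$ are the coordinates on $\Xi^{\mathbb{N}}$ (i.i.d. $\mathbb{P}_{\theta^c}$ under $\mathbb{P}^{\mathbb{N}}_{\theta^c}$). $\tilde\theta$ denotes the Bayesian parameter with prior $\pi$, and $\mathbb{P}_n$ is its posterior given $\xi_1,\dots,\xi_n$: $\mathbb{P}_n(A)=\int_A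 p^n_\theta(\xi_1,\dots,\xi_n)\pi(d\theta)/\int_\Theta p^n_\theta(\xi_1,\dots,\xi_n)\pi(d\theta)$. $\mathcal{X}\subset\mathbb{R}^d$ is closed, $h:\mathbb{R}^d\times\mathbb{R}^m\to\mathbb{R}$, and $H(x,\theta):=\mathbb{E}_{\mathbb{P}_\theta}[h(x,\xi)]$ is assumed finite for all $(x,\theta)\in\mathcal{X}\times\Theta$. $\mathrm{VaR}^\alpha(X):=\inf\{t:\mathbb{P}(X\le t)\ge\alpha\}$, $\mathrm{CVaR}^\alpha(X):=\frac1{1-\alpha}\int_\alpha^1\mathrm{VaR}^r(X)\,dr$, and $\mathrm{CVaR}^\alpha_{\mathbb{P}_n}[H(\theta)]$ is the CVaR of $H(\theta)$ with $\theta\sim\mathbb{P}_n$. $\|\cdot\|$ is the Euclidean norm; $\Rightarrow$ is convergence in distribution; $D_{KL}$ is the Kullback–Leibler divergence. Uniformly consistent tests of $\tilde\theta=\theta^c$ against $\tilde\theta\in\Theta\setminus V$: measurable $\varphi_n:\Xi^n\to[0,1]$ with $\mathbb{E}_{\mathbb{P}^n_{\theta^c}}[\varphi_n]\to0$ and $\sup_{\theta\in\Theta\setminus V}\mathbb{E}_{\mathbb{P}^n_\theta}[1-\varphi_n]\to0$. Standing assumption (vi): $I(\theta^c)$, the Fisher information matrix of one observation $\xi_i$ at $\theta^c$, exists and is invertible; with $\mathbb{P}_{Z_n}$ the law of $\sqrt n(\theta-\theta^c)$ for $\theta\sim\mathbb{P}_n$, there are random vectors $\Delta_n$ (functions of $\xi_1,\dots,\xi_n$)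 with $\Delta_n\Rightarrow\mathcal{N}(0,[I(\theta^c)]^{-1})$ and $\|\mathbb{P}_{Z_n}-\mathcal{N}(\Delta_n,[I(\theta^c)]^{-1})\|_{TV}\to0$ in $\mathbb{P}^{\mathbb{N}}_{\theta^c}$-probability, where $\|\mu-\nu\|_{TV}=\sup_A|\mu(A)-\nu(A)|$; and $\sqrt n(\mathbb{E}_{\mathbb{P}_n}[\theta]-\theta^c)\Rightarrow\mathcal{N}(0,[I(\theta^c)]^{-1})$ under $\mathbb{P}^{\mathbb{N}}_{\theta^c}$.
   Formalization: The formal theorem additionally assumes that almost surely, for every n ≥ 1, the posterior CVaR of H(θ) at level α is finite; conditions (i)–(viii) do not imply this, since H may be unbounded on compact Θ. *)

theory Defs
  imports "HOL-Probability.Probability"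
begin

(* Theta and Xi are arbitrary subsets of Euclidean spaces, so their Borel sigma-algebras are
   the traces of borel.  Observations are indexed from 0, i.e. xi_{i+1} is the coordinate i,
   and the first n of them live on the extensional functions on {..<n}. *)

abbreviation (input) borel_on :: "'a::topological_space set \<Rightarrow> 'a measure" where
  "borel_on S \<equiv> restrict_space borel S"

abbreviation (input) sample_space :: "'a::topological_space set \<Rightarrow> nat \<Rightarrow> (nat \<Rightarrow> 'a) measure" where
  "sample_space S n \<equiv> Pi\<^sub>M {..<n} (\<lambda>_. borel_on S)"

abbreviation (input) iid :: "('t \<Rightarrow> 'a measure) \<Rightarrow> nat \<Rightarrow> 't \<Rightarrow> (nat \<Rightarrow> 'a) measure" where
  "iid P n \<theta> \<equiv> Pi\<^sub>M {..<n} (\<lambda>_. P \<theta>)"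

abbreviation (input) iid_seq :: "('t \<Rightarrow> 'a measure) \<Rightarrow> 't \<Rightarrow> (nat \<Rightarrow> 'a) measure" where
  "iid_seq P \<theta> \<equiv> Pi\<^sub>M UNIV (\<lambda>_. P \<theta>)"

definition borel_nhd :: "'t::topological_space set \<Rightarrow> 't \<Rightarrow> 't set \<Rightarrow> bool" where
  "borel_nhd \<Theta> \<theta>c V \<longleftrightarrow>
     V \<in> sets (borel_on \<Theta>) \<and> (\<exists>U. open U \<and> \<theta>c \<in> U \<and> U \<inter> \<Theta> \<subseteq> V)"


(* If the normalising constant is 0 or infinite, this is the null measure. *)

definition posterior ::
  "'t measure \<Rightarrow> (nat \<Rightarrow> 't \<Rightarrow> (nat \<Rightarrow> 'a) \<Rightarrow> real) \<Rightarrow> nat \<Rightarrow> (nat \<Rightarrow> 'a) \<Rightarrow> 't measure" where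
  "posterior \<pi> p n \<xi> =
     density \<pi> (\<lambda>\<theta>. ennreal (p n \<theta> (restrict \<xi> {..<n})) /
                     (\<integral>\<^sup>+ \<theta>'. ennreal (p n \<theta>' (restrict \<xi> {..<n})) \<partial>\<pi>))"

definition expected_cost :: "('t \<Rightarrow> 'a measure) \<Rightarrow> ('x \<Rightarrow> 'a \<Rightarrow> real) \<Rightarrow> 'x \<Rightarrow> 't \<Rightarrow> real" where
  "expected_cost P h x \<theta> = (\<integral>y. h x y \<partial>P \<theta>)"

definition VaR :: "'t measure \<Rightarrow> ('t \<Rightarrow> real) \<Rightarrow> real \<Rightarrow> real" where
  "VaR M X r = Inf {t. r \<le> measure M {\<theta> \<in> space M. X \<theta> \<le> t}}"

definition CVaR :: "'t measure \<Rightarrow> ('t \<Rightarrow> real) \<Rightarrow> real \<Rightarrow> real" where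
  "CVaR M X \<alpha> = 1 / (1 - \<alpha>) * (LBINT r:{\<alpha>..1}. VaR M X r)"

(* The Bochner integral in CVaR is 0 when the integrand is not integrable,
   so finiteness of CVaR has to be expressed separately. *)

definition CVaR_finite :: "'t measure \<Rightarrow> ('t \<Rightarrow> real) \<Rightarrow> real \<Rightarrow> bool" where
  "CVaR_finite M X \<alpha> \<longleftrightarrow> set_integrable lborel {\<alpha>..1} (VaR M X)"


(* The supremum is taken in ennreal, so that it is 0 when V is all of Theta. *)

definition uniformly_consistent_tests ::
  "'a::topological_space set \<Rightarrow> ('t \<Rightarrow> 'a measure) \<Rightarrow> 't set \<Rightarrow> 't \<Rightarrow> 't set
     \<Rightarrow> (nat \<Rightarrow> (nat \<Rightarrow> 'a) \<Rightarrow> real) \<Rightarrow> bool" where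
  "uniformly_consistent_tests \<Xi> P \<Theta> \<theta>c V \<phi> \<longleftrightarrow>
     (\<forall>n. \<phi> n \<in> borel_measurable (sample_space \<Xi> n)) \<and>
     (\<forall>n. \<forall>y \<in> space (sample_space \<Xi> n). \<phi> n y \<in> {0..1}) \<and>
     (\<lambda>n. \<integral>y. \<phi> n y \<partial>iid P n \<theta>c) \<longlonglongrightarrow> 0 \<and>
     (\<lambda>n. SUP \<theta> \<in> \<Theta> - V. ennreal (\<integral>y. 1 - \<phi> n y \<partial>iid P n \<theta>)) \<longlonglongrightarrow> 0"

(* KL_divergence b M N of the library is D(N || M), and is only meaningful when N has an
   M-density and its logarithm is N-integrable.  The negative part of that logarithm is always
   N-integrable, so every other case has divergence +infinity.  KL_ext Q R is D(Q || R). *)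

definition KL_ext :: "'a measure \<Rightarrow> 'a measure \<Rightarrow> ereal" where
  "KL_ext Q R =
     (if absolutely_continuous R Q \<and> integrable Q (entropy_density (exp 1) R Q)
      then ereal (KL_divergence (exp 1) R Q) else \<infinity>)"


(* J is the Fisher information matrix E[s s^T] at \<theta>c of the family of densities q \<theta>, where the
   score s y is the gradient of ln (q \<theta> y) at \<theta>c, and Q is the law with density q \<theta>c.
   The derivative is taken along the parameter set, on which alone q is meaningful.  Positivity
   of q near \<theta>c is explicit because ln 0 = 0. *)

definition is_fisher_information ::
  "(real^'l) set \<Rightarrow> real^'l \<Rightarrow> 'b measure \<Rightarrow> (real^'l \<Rightarrow> 'b \<Rightarrow> real) \<Rightarrow> real^'l^'l \<Rightarrow> bool" where
  "is_fisher_information \<Theta> \<theta>c Q q J \<longleftrightarrow>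
     (\<exists>s. s \<in> borel_measurable Q \<and>
        (AE y in Q. 0 < q \<theta>c y \<and> (\<forall>\<^sub>F \<theta> in at \<theta>c within \<Theta>. 0 < q \<theta> y) \<and>
            ((\<lambda>\<theta>. ln (q \<theta> y)) has_derivative (\<lambda>v. s y \<bullet> v)) (at \<theta>c within \<Theta>)) \<and>
        (\<forall>i j. integrable Q (\<lambda>y. s y $ i * s y $ j) \<and>
               J $ i $ j = (\<integral>y. s y $ i * s y $ j \<partial>Q)))"

(* Multivariate normal law with an invertible covariance matrix. *)

definition mv_normal :: "real^'l \<Rightarrow> real^'l^'l \<Rightarrow> (real^'l) measure" where
  "mv_normal \<mu> S = density lborel (\<lambda>z. ennreal
     (exp (- ((z - \<mu>) \<bullet> (matrix_inv S *v (z - \<mu>))) / 2) / sqrt ((2 * pi) ^ CARD('l) * det S)))"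

(* One-dimensional normal law with variance v \<ge> 0; for v = 0 it is a point mass. *)

definition normal_law :: "real \<Rightarrow> real \<Rightarrow> real measure" where
  "normal_law \<mu> v =
     (if v = 0 then return borel \<mu> else density lborel (\<lambda>z. ennreal (normal_density \<mu> (sqrt v) z)))"

definition std_normal_cdf :: "real \<Rightarrow> real" where
  "std_normal_cdf = cdf (density lborel (\<lambda>z. ennreal (std_normal_density z)))"

definition tv_dist :: "'b measure \<Rightarrow> 'b measure \<Rightarrow> real" where
  "tv_dist M N = (SUP A \<in> sets M. \<bar>measure M A - measure N A\<bar>)"

(* Vector-valued counterpart of weak_conv_m, which is restricted to the real line. *)

definition conv_in_distr ::
  "'w measure \<Rightarrow> (nat \<Rightarrow> 'w \<Rightarrow> 'b::real_normed_vector) \<Rightarrow> 'b measure \<Rightarrow> bool" where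
  "conv_in_distr M X L \<longleftrightarrow>
     (\<forall>n. X n \<in> borel_measurable M) \<and>
     (\<forall>f :: 'b \<Rightarrow> real. continuous_on UNIV f \<longrightarrow> bounded (range f) \<longrightarrow>
        (\<lambda>n. \<integral>\<omega>. f (X n \<omega>) \<partial>M) \<longlonglongrightarrow> (\<integral>z. f z \<partial>L))"

definition conv_in_prob_zero :: "'w measure \<Rightarrow> (nat \<Rightarrow> 'w \<Rightarrow> real) \<Rightarrow> bool" where
  "conv_in_prob_zero M Y \<longleftrightarrow>
     (\<forall>\<epsilon>>0. (\<lambda>n. measure M {\<omega> \<in> space M. \<bar>Y n \<omega>\<bar> > \<epsilon>}) \<longlonglongrightarrow> 0)"

(* The possible values of X are the values it takes on the whole sample space of M. *)

definition has_positive_density :: "'t measure \<Rightarrow> ('t \<Rightarrow> 'b::euclidean_space) \<Rightarrow> bool" where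
  "has_positive_density M X \<longleftrightarrow>
     (\<exists>f. distributed M lborel X f \<and> (\<forall>y \<in> X ` space M. 0 < f y))"

end

theory Submission
  imports Defs "HOL-Real_Asymp.Real_Asymp"
begin

text \<open>
  CVaR is the minimum over \<open>c\<close> of \<open>c + E (X - c)\<^sup>+ / (1 - \<alpha>)\<close>, attained at the value at risk. For
  \<open>X = sqrt n (H \<theta> - H \<theta>c)\<close> with \<open>\<theta>\<close> drawn from the posterior, differentiability replaces \<open>X\<close> by the
  linear functional \<open>W = grad \<bullet> sqrt n (\<theta> - \<theta>c)\<close>, and the Bernstein-von Mises property replaces the law of
  \<open>W\<close> by a normal law with mean \<open>grad \<bullet> \<Delta>\<^sub>n\<close>; the moment bound (v) makes the excess of \<open>W\<close> uniformly
  integrable. Hence the scaled CVaR is \<open>grad \<bullet> \<Delta>\<^sub>n + \<kappa>\<close> up to an error tending to 0 in probability.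

  Since \<open>H\<close> may be unbounded, the contribution of parameters away from \<open>\<theta>c\<close> needs Schwartz's argument,
  with two twists. Instead of exponentially consistent tests, the posterior numerator is weighted by
  \<open>4 powr (- \<phi>)\<close> on consecutive blocks of fixed length, which costs only Markov's inequality and the
  independence of the blocks. The first observation is kept out of the blocks: finiteness of the CVaR
  for \<open>n = 1\<close> bounds the integral of \<open>H\<^sup>+\<close> against the density of that observation.
\<close>

section \<open>Value at risk and conditional value at risk\<close>

text \<open>Three obstacles shape the argument. (a) The moment bound (v) concerns \<theta>, so away
  from \<open>\<theta>c\<close> it says nothing about the size of \<open>H\<close>. CVaR looks at
  the upper tail, hence only the positive part of \<open>H \<theta> - H \<theta>c\<close> has to be
  small there; but its posterior integral must be o(1 / sqrt n) in probability, so mere posterior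
  consistency does not suffice. (b) The tests in (iii) come without a rate. A test on one block has
  small constant errors, and the weights multiply over blocks: each block contributes at most 1/3
  under a far parameter, while the inverse weight contributes at most 9/8 under the truth. The gap
  between 1/3 and 8/9 leaves room for the factor exp (n b) that is lost in bounding the normalising
  constant from below. (c) The densities \<open>p n\<close> for different n are linked only through
  the laws that they represent and need not factorise pointwise. Likelihood ratios are therefore
  compared through product laws, and blocks are separated only after the density has been absorbed
  into the law of the sample.\<close>

lemma (in prob_space) cdf_distribution_distr:
  "X \<in> borel_measurable M \<Longrightarrow> cdf_distribution (distr M borel X)"
  unfolding cdf_distribution_def by (rule real_distribution_distr)

lemma (in prob_space) VaR_eq_Inf_cdf:
  assumes [measurable]: "X \<in> borel_measurable M"
  shows "VaR M X r = Inf {t. r \<le> cdf (distr M borel X) t}"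
proof -
  have "cdf (distr M borel X) t = measure M {\<omega> \<in> space M. X \<omega> \<le> t}" for t
    by (auto simp: cdf_def measure_distr intro!: arg_cong[where f="measure M"])
  then show ?thesis by (simp add: VaR_def)
qed

text \<open>Right continuity of the distribution function makes the infimum attained, so quantile
  and distribution function form a Galois connection. For r outside (0, 1) the set may be empty or
  unbounded below, where \<open>Inf\<close> is arbitrary; this is why the endpoints are discarded in
  the integrals over r.\<close>

lemma (in prob_space) VaR_le_iff:
  assumes [measurable]: "X \<in> borel_measurable M" and "0 < r" "r < 1"
  shows "VaR M X r \<le> t \<longleftrightarrow> r \<le> measure M {\<omega> \<in> space M. X \<omega> \<le> t}"
proof -
  interpret D: cdf_distribution "distr M borel X" by (rule cdf_distribution_distr) simp
  have "cdf (distr M borel X) t = measure M {\<omega> \<in> space M. X \<omega> \<le> t}"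
    by (auto simp: cdf_def measure_distr intro!: arg_cong[where f="measure M"])
  then show ?thesis using D.pseudoinverse[of r t] assms by (simp add: VaR_eq_Inf_cdf)
qed

lemma (in prob_space) VaR_mono:
  assumes [measurable]: "X \<in> borel_measurable M" and "0 < r" "r \<le> r'" "r' < 1"
  shows "VaR M X r \<le> VaR M X r'"
proof -
  have "r' \<le> measure M {\<omega> \<in> space M. X \<omega> \<le> VaR M X r'}"
    using VaR_le_iff[of X r' "VaR M X r'"] assms by simp
  then show ?thesis using VaR_le_iff[of X r "VaR M X r'"] assms by simp
qed

lemma (in prob_space) measurable_VaR:
  assumes [measurable]: "X \<in> borel_measurable M"
  shows "VaR M X \<in> borel_measurable (restrict_space borel {0<..<1})"
proof -
  interpret D: cdf_distribution "distr M borel X" by (rule cdf_distribution_distr) simp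
  have "VaR M X = (\<lambda>r. Inf {t. r \<le> cdf (distr M borel X) t})"
    by (intro ext VaR_eq_Inf_cdf) simp
  then show ?thesis using D.measurable_CI by simp
qed

text \<open>Inverse transform sampling: a uniform level fed into the quantile function reproduces
  the law of X.\<close>

lemma (in prob_space) distr_VaR:
  assumes [measurable]: "X \<in> borel_measurable M"
  shows "distr (restrict_space lborel {0<..<1}) borel (VaR M X) = distr M borel X"
proof -
  interpret D: cdf_distribution "distr M borel X" by (rule cdf_distribution_distr) simp
  have "VaR M X = (\<lambda>r. Inf {t. r \<le> cdf (distr M borel X) t})"
    by (intro ext VaR_eq_Inf_cdf) simp
  then show ?thesis using D.distr_I_eq_M by simp
qed

lemma (in prob_space) integral_VaR:
  fixes f :: "real \<Rightarrow> real"
  assumes [measurable]: "X \<in> borel_measurable M" "f \<in> borel_measurable borel"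
  shows "integrable M (\<lambda>\<omega>. f (X \<omega>)) \<longleftrightarrow> set_integrable lborel {0<..<1} (\<lambda>r. f (VaR M X r))"
    and "(\<integral>\<omega>. f (X \<omega>) \<partial>M) = (LBINT r:{0<..<1}. f (VaR M X r))"
proof -
  have [measurable]: "VaR M X \<in> borel_measurable (restrict_space lborel {0<..<1})"
    using measurable_VaR[OF assms(1)]
    by (subst measurable_cong_sets[OF sets_restrict_space_cong[OF sets_lborel] refl])
  have "integrable M (\<lambda>\<omega>. f (X \<omega>)) \<longleftrightarrow> integrable (distr M borel X) f"
    by (subst integrable_distr_eq) auto
  also have "\<dots> \<longleftrightarrow> integrable (restrict_space lborel {0<..<1}) (\<lambda>r. f (VaR M X r))"
    unfolding distr_VaR[OF assms(1), symmetric] by (subst integrable_distr_eq) auto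
  also have "\<dots> \<longleftrightarrow> set_integrable lborel {0<..<1} (\<lambda>r. f (VaR M X r))"
    by (subst integrable_restrict_space) (auto simp: set_integrable_def)
  finally show "integrable M (\<lambda>\<omega>. f (X \<omega>)) \<longleftrightarrow> set_integrable lborel {0<..<1} (\<lambda>r. f (VaR M X r))" .
  have "(\<integral>\<omega>. f (X \<omega>) \<partial>M) = integral\<^sup>L (distr M borel X) f"
    by (subst integral_distr) auto
  also have "\<dots> = (\<integral>r. f (VaR M X r) \<partial>restrict_space lborel {0<..<1})"
    unfolding distr_VaR[OF assms(1), symmetric] by (subst integral_distr) auto
  also have "\<dots> = (LBINT r:{0<..<1}. f (VaR M X r))"
    by (subst integral_restrict_space) (auto simp: set_lebesgue_integral_def)
  finally show "(\<integral>\<omega>. f (X \<omega>) \<partial>M) = (LBINT r:{0<..<1}. f (VaR M X r))" .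
qed

lemma AE_lborel_neq2: "AE r in lborel. r \<noteq> (x::real) \<and> r \<noteq> y"
  using AE_lborel_singleton[of x] AE_lborel_singleton[of y] by eventually_elim simp

text \<open>The Rockafellar-Uryasev formula. Quantiles beyond level \<alpha> lie above
  \<open>VaR M X \<alpha>\<close> and the others below, so truncating at this value turns the
  average over [\<alpha>, 1] into an expected excess. Finiteness of CVaR says nothing about the
  lower tail, hence only excesses are claimed to be integrable.\<close>

lemma (in prob_space) CVaR_eq_VaR_plus:
  assumes X[measurable]: "X \<in> borel_measurable M" and \<alpha>: "0 < \<alpha>" "\<alpha> < 1"
    and fin: "CVaR_finite M X \<alpha>"
  shows "integrable M (\<lambda>\<omega>. max 0 (X \<omega> - c))"
    and "CVaR M X \<alpha> = VaR M X \<alpha> + (\<integral>\<omega>. max 0 (X \<omega> - VaR M X \<alpha>) \<partial>M) / (1 - \<alpha>)"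
    and "CVaR M X \<alpha> \<le> c + (\<integral>\<omega>. max 0 (X \<omega> - c) \<partial>M) / (1 - \<alpha>)"
proof -
  let ?v = "VaR M X" and ?c = "VaR M X \<alpha>"
  have cint: "set_integrable lborel {\<alpha>..1} (\<lambda>r. d)" for d :: real
  proof -
    have "integrable lborel (indicat_real {\<alpha>..1})"
      by (rule integrable_real_indicator) (use \<alpha> in auto)
    then show ?thesis unfolding set_integrable_def by simp
  qed
  have vint: "integrable lborel (\<lambda>r. indicator {\<alpha>..1} r * (?v r - d))" for d
  proof -
    have "set_integrable lborel {\<alpha>..1} (\<lambda>r. ?v r - d)"
      using fin[unfolded CVaR_finite_def] cint by (intro set_integral_diff)
    then show ?thesis by (simp add: set_integrable_def)
  qed
  have vI: "(\<integral>r. indicator {\<alpha>..1} r * (?v r - d) \<partial>lborel) = (1 - \<alpha>) * (CVaR M X \<alpha> - d)" for d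
  proof -
    have "(LBINT r:{\<alpha>..1}. ?v r - d) = (LBINT r:{\<alpha>..1}. ?v r) - (LBINT r:{\<alpha>..1}. d)"
      using fin[unfolded CVaR_finite_def] cint by (intro set_integral_diff)
    also have "(LBINT r:{\<alpha>..1}. d) = (1 - \<alpha>) * d"
      using \<alpha> by (simp add: set_lebesgue_integral_def)
    also have "(LBINT r:{\<alpha>..1}. ?v r) = (1 - \<alpha>) * CVaR M X \<alpha>"
      using \<alpha> by (simp add: CVaR_def)
    finally show ?thesis by (simp add: set_lebesgue_integral_def algebra_simps)
  qed
  have m01: "(\<lambda>r. indicator {0<..<1} r * max 0 (?v r - d)) \<in> borel_measurable lborel" for d
  proof -
    have "(\<lambda>r. max 0 (?v r - d)) \<in> borel_measurable (restrict_space borel {0<..<1})"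
      using measurable_VaR[OF X] by measurable
    then show ?thesis
      by (subst (asm) borel_measurable_restrict_space_iff) auto
  qed
  \<comment> \<open>Monotonicity of the quantile decides the sign of the difference on each side of
    \<alpha>; it is available only off the levels 0 and 1.\<close>
  have ae: "AE r in lborel. indicator {\<alpha>..1} r * (?v r - ?c) = indicator {0<..<1} r * max 0 (?v r - ?c)"
    using AE_lborel_neq2[of 0 1]
  proof eventually_elim
    case (elim r)
    consider "r \<notin> {0<..<1}" | "0 < r" "r < \<alpha>" | "\<alpha> \<le> r" "r < 1" by force
    then show ?case
    proof cases
      case 1 then show ?thesis using elim \<alpha> by (auto simp: indicator_def)
    next
      case 2 then show ?thesis using VaR_mono[OF X, of r \<alpha>] \<alpha> by (auto simp: indicator_def)
    next
      case 3 then show ?thesis using VaR_mono[OF X, of \<alpha> r] \<alpha> by (auto simp: indicator_def)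
    qed
  qed
  have i1: "integrable lborel (\<lambda>r. indicator {0<..<1} r * max 0 (?v r - ?c))"
    using integrable_cong_AE_imp[OF vint m01] ae by (auto simp: eq_commute)
  have I1: "(\<integral>r. indicator {0<..<1} r * max 0 (?v r - ?c) \<partial>lborel) = (1 - \<alpha>) * (CVaR M X \<alpha> - ?c)"
    using integral_cong_AE[OF borel_measurable_integrable[OF vint] m01 ae] vI by simp
  have int: "integrable M (\<lambda>\<omega>. max 0 (X \<omega> - ?c))"
    using integral_VaR(1)[of X "\<lambda>x. max 0 (x - ?c)"] i1 by (simp add: set_integrable_def)
  have "(\<integral>\<omega>. max 0 (X \<omega> - ?c) \<partial>M) = (1 - \<alpha>) * (CVaR M X \<alpha> - ?c)"
    using integral_VaR(2)[of X "\<lambda>x. max 0 (x - ?c)"] I1 by (simp add: set_lebesgue_integral_def)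
  then show "CVaR M X \<alpha> = VaR M X \<alpha> + (\<integral>\<omega>. max 0 (X \<omega> - VaR M X \<alpha>) \<partial>M) / (1 - \<alpha>)"
    using \<alpha> by (simp add: field_simps)
  \<comment> \<open>Moving the threshold changes the excess by at most the distance moved.\<close>
  show intc: "integrable M (\<lambda>\<omega>. max 0 (X \<omega> - c))"
    by (rule Bochner_Integration.integrable_bound[OF Bochner_Integration.integrable_add[OF int, of "\<lambda>_. \<bar>?c - c\<bar>"]]) auto
  have ic: "integrable lborel (\<lambda>r. indicator {0<..<1} r * max 0 (?v r - c))"
    using integral_VaR(1)[of X "\<lambda>x. max 0 (x - c)"] intc by (simp add: set_integrable_def)
  \<comment> \<open>For a general threshold only an inequality survives: passing to the positive
    part and enlarging the range of levels to (0, 1) can only increase the integral.\<close>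
  have "(1 - \<alpha>) * (CVaR M X \<alpha> - c) \<le> (\<integral>r. indicator {0<..<1} r * max 0 (?v r - c) \<partial>lborel)"
    unfolding vI[symmetric]
  proof (rule integral_mono_AE[OF vint ic])
    show "AE r in lborel. indicator {\<alpha>..1} r * (?v r - c) \<le> indicator {0<..<1} r * max 0 (?v r - c)"
      using AE_lborel_neq2[of 0 1] by eventually_elim (use \<alpha> in \<open>auto simp: indicator_def\<close>)
  qed
  also have "\<dots> = (\<integral>\<omega>. max 0 (X \<omega> - c) \<partial>M)"
    using integral_VaR(2)[of X "\<lambda>x. max 0 (x - c)"] by (simp add: set_lebesgue_integral_def)
  finally show "CVaR M X \<alpha> \<le> c + (\<integral>\<omega>. max 0 (X \<omega> - c) \<partial>M) / (1 - \<alpha>)"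
    using \<alpha> by (simp add: field_simps)
qed

section \<open>The variational characterisation of CVaR\<close>

text \<open>All that later arguments use of a CVaR value. The quantile itself does not occur: the
  second clause brackets it between \<open>c\<close> and \<open>c'\<close> by inequalities for the
  distribution function, which can be checked for a perturbed variable and a perturbed
  measure.\<close>

definition superquantile :: "'a measure \<Rightarrow> ('a \<Rightarrow> real) \<Rightarrow> real \<Rightarrow> real \<Rightarrow> bool" where
  "superquantile M X \<alpha> V \<longleftrightarrow>
     (\<forall>c. integrable M (\<lambda>\<omega>. max 0 (X \<omega> - c)) \<and> V \<le> c + (\<integral>\<omega>. max 0 (X \<omega> - c) \<partial>M) / (1 - \<alpha>)) \<and>
     (\<forall>c c'. measure M {\<omega> \<in> space M. X \<omega> \<le> c} < \<alpha> \<longrightarrow> \<alpha> \<le> measure M {\<omega> \<in> space M. X \<omega> \<le> c'} \<longrightarrow>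
        c + (\<integral>\<omega>. max 0 (X \<omega> - c') \<partial>M) / (1 - \<alpha>) \<le> V)"

lemma (in prob_space) superquantile_CVaR:
  assumes X[measurable]: "X \<in> borel_measurable M" and \<alpha>: "0 < \<alpha>" "\<alpha> < 1"
    and fin: "CVaR_finite M X \<alpha>"
  shows "superquantile M X \<alpha> (CVaR M X \<alpha>)"
proof -
  have "c + (\<integral>\<omega>. max 0 (X \<omega> - c') \<partial>M) / (1 - \<alpha>) \<le> CVaR M X \<alpha>"
    if "measure M {\<omega> \<in> space M. X \<omega> \<le> c} < \<alpha>" "\<alpha> \<le> measure M {\<omega> \<in> space M. X \<omega> \<le> c'}" for c c'
  proof -
    have 1: "c < VaR M X \<alpha>" "VaR M X \<alpha> \<le> c'"
      using VaR_le_iff[OF X \<alpha>, of c] VaR_le_iff[OF X \<alpha>, of c'] that by auto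
    have "(\<integral>\<omega>. max 0 (X \<omega> - c') \<partial>M) \<le> (\<integral>\<omega>. max 0 (X \<omega> - VaR M X \<alpha>) \<partial>M)"
      using 1 by (intro integral_mono CVaR_eq_VaR_plus(1)[OF assms]) auto
    then have "(\<integral>\<omega>. max 0 (X \<omega> - c') \<partial>M) / (1 - \<alpha>) \<le> (\<integral>\<omega>. max 0 (X \<omega> - VaR M X \<alpha>) \<partial>M) / (1 - \<alpha>)"
      using \<alpha> by (intro divide_right_mono) auto
    then show ?thesis using CVaR_eq_VaR_plus(2)[OF assms] 1 by linarith
  qed
  then show ?thesis
    unfolding superquantile_def using CVaR_eq_VaR_plus(1,3)[OF assms] by blast
qed

text \<open>Carries the CVaR of \<open>H\<close> to that of
  \<open>sqrt n * (H \<theta> - H \<theta>c)\<close>. Both clauses are transported by the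
  substitution of b + c / k for c.\<close>

lemma superquantile_scale:
  fixes k :: real
  assumes S: "superquantile M X \<alpha> V" and k: "0 < k" and \<alpha>: "\<alpha> < 1"
  shows "superquantile M (\<lambda>\<omega>. k * (X \<omega> - b)) \<alpha> (k * (V - b))"
proof -
  have eq: "max 0 (k * (X \<omega> - b) - c) = k * max 0 (X \<omega> - (b + c / k))" for \<omega> c
    using k by (simp add: max_def field_simps)
  have le: "k * (X \<omega> - b) \<le> c \<longleftrightarrow> X \<omega> \<le> b + c / k" for \<omega> c
    using k by (simp add: field_simps)
  have A: "integrable M (\<lambda>\<omega>. max 0 (X \<omega> - (b + c / k)))"
    "V \<le> b + c / k + (\<integral>\<omega>. max 0 (X \<omega> - (b + c / k)) \<partial>M) / (1 - \<alpha>)" for c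
    using S unfolding superquantile_def by auto
  have B: "b + c / k + (\<integral>\<omega>. max 0 (X \<omega> - (b + c' / k)) \<partial>M) / (1 - \<alpha>) \<le> V"
    if "measure M {\<omega> \<in> space M. X \<omega> \<le> b + c / k} < \<alpha>" "\<alpha> \<le> measure M {\<omega> \<in> space M. X \<omega> \<le> b + c' / k}" for c c'
    using S that unfolding superquantile_def by auto
  show ?thesis
    unfolding superquantile_def eq le
  proof (intro conjI allI impI)
    fix c show "integrable M (\<lambda>\<omega>. k * max 0 (X \<omega> - (b + c / k)))" using A(1) by simp
    have "k * V \<le> k * (b + c / k + (\<integral>\<omega>. max 0 (X \<omega> - (b + c / k)) \<partial>M) / (1 - \<alpha>))"
      using A(2)[of c] k by (intro mult_left_mono) auto
    then show "k * (V - b) \<le> c + (\<integral>\<omega>. k * max 0 (X \<omega> - (b + c / k)) \<partial>M) / (1 - \<alpha>)"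
      using k by (simp add: algebra_simps)
  next
    fix c c' assume "measure M {\<omega> \<in> space M. X \<omega> \<le> b + c / k} < \<alpha>" "\<alpha> \<le> measure M {\<omega> \<in> space M. X \<omega> \<le> b + c' / k}"
    from B[OF this] have "k * (b + c / k + (\<integral>\<omega>. max 0 (X \<omega> - (b + c' / k)) \<partial>M) / (1 - \<alpha>)) \<le> k * V"
      using k by (intro mult_left_mono) auto
    then show "c + (\<integral>\<omega>. k * max 0 (X \<omega> - (b + c' / k)) \<partial>M) / (1 - \<alpha>) \<le> k * (V - b)"
      using k by (simp add: algebra_simps)
  qed
qed

section \<open>Measurability of CVaR in the data\<close>

text \<open>By the Galois connection, VaR at level r is at most t exactly if r is at most the
  distribution function at t, a jointly measurable condition on (\<xi>, r). Integrating r out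
  preserves measurability.\<close>

lemma measurable_CVaR:
  assumes F[measurable]: "\<And>t. (\<lambda>\<xi>. measure (K \<xi>) {\<theta> \<in> space (K \<xi>). X \<theta> \<le> t}) \<in> borel_measurable M"
    and G[measurable]: "(\<lambda>\<xi>. measure (K \<xi>) (space (K \<xi>))) \<in> borel_measurable M"
    and X: "\<And>\<xi>. \<xi> \<in> space M \<Longrightarrow> X \<in> borel_measurable (K \<xi>)"
    and K: "\<And>\<xi>. \<xi> \<in> space M \<Longrightarrow> prob_space (K \<xi>) \<or> emeasure (K \<xi>) (space (K \<xi>)) = 0"
    and \<alpha>: "0 < \<alpha>" "\<alpha> < 1"
  shows "(\<lambda>\<xi>. CVaR (K \<xi>) X \<alpha>) \<in> borel_measurable M"
proof -
  \<comment> \<open>The level 1 is dropped because \<open>VaR\<close> is arbitrary there for X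
    unbounded above; a single level does not affect the integral.\<close>
  define g where "g = (\<lambda>(\<xi>, r). indicator {\<alpha>..<1} r * VaR (K \<xi>) X r)"
  have [measurable]: "g \<in> borel_measurable (M \<Otimes>\<^sub>M lborel)"
  proof (subst borel_measurable_iff_le, rule allI)
    fix t
    \<comment> \<open>Under a null measure the set defining \<open>VaR\<close> is empty at every
      positive level, so its value is the constant \<open>Inf {}\<close>. Total mass 1 or not
      separates the two cases.\<close>
    have "g (\<xi>, r) \<le> t \<longleftrightarrow> (\<alpha> \<le> r \<and> r < 1 \<and> measure (K \<xi>) (space (K \<xi>)) = 1 \<and>
        r \<le> measure (K \<xi>) {\<theta> \<in> space (K \<xi>). X \<theta> \<le> t}) \<or>
      (\<alpha> \<le> r \<and> r < 1 \<and> measure (K \<xi>) (space (K \<xi>)) \<noteq> 1 \<and> Inf ({}::real set) \<le> t) \<or>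
      (\<not> (\<alpha> \<le> r \<and> r < 1) \<and> 0 \<le> t)" if "\<xi> \<in> space M" for \<xi> r
    proof (cases "\<alpha> \<le> r \<and> r < 1")
      case True
      show ?thesis
      proof (cases "prob_space (K \<xi>)")
        case P: True
        then interpret prob_space "K \<xi>" .
        show ?thesis using True VaR_le_iff[OF X[OF that], of r t] \<alpha> by (simp add: g_def prob_space)
      next
        case False
        then have e: "emeasure (K \<xi>) (space (K \<xi>)) = 0" using K[OF that] by simp
        have "emeasure (K \<xi>) A = 0" for A
          using emeasure_space[of "K \<xi>" A] e by simp
        then have "measure (K \<xi>) A = 0" for A by (simp add: measure_def)
        then show ?thesis using True \<alpha> by (simp add: g_def VaR_def)
      qed
    qed (auto simp: g_def)
    then have "{w \<in> space (M \<Otimes>\<^sub>M lborel). g w \<le> t} = {w \<in> space (M \<Otimes>\<^sub>M lborel).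
      (\<alpha> \<le> snd w \<and> snd w < 1 \<and> measure (K (fst w)) (space (K (fst w))) = 1 \<and>
        snd w \<le> measure (K (fst w)) {\<theta> \<in> space (K (fst w)). X \<theta> \<le> t}) \<or>
      (\<alpha> \<le> snd w \<and> snd w < 1 \<and> measure (K (fst w)) (space (K (fst w))) \<noteq> 1 \<and> Inf ({}::real set) \<le> t) \<or>
      (\<not> (\<alpha> \<le> snd w \<and> snd w < 1) \<and> 0 \<le> t)}"
      by (auto simp: space_pair_measure)
    also have "\<dots> \<in> sets (M \<Otimes>\<^sub>M lborel)" by measurable
    finally show "{w \<in> space (M \<Otimes>\<^sub>M lborel). g w \<le> t} \<in> sets (M \<Otimes>\<^sub>M lborel)" .
  qed
  have g1: "(\<lambda>r. g (\<xi>, r)) \<in> borel_measurable lborel" if "\<xi> \<in> space M" for \<xi>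
    using that by measurable
  have eq: "CVaR (K \<xi>) X \<alpha> = 1 / (1 - \<alpha>) * (\<integral>r. g (\<xi>, r) \<partial>lborel)" if "\<xi> \<in> space M" for \<xi>
  proof -
    have 2: "indicator {\<alpha>..1} r * VaR (K \<xi>) X r = (if r = 1 then VaR (K \<xi>) X 1 else g (\<xi>, r))" for r
      using \<alpha> by (auto simp: g_def indicator_def)
    have m: "(\<lambda>r. if r = 1 then VaR (K \<xi>) X 1 else g (\<xi>, r)) \<in> borel_measurable lborel"
      using g1[OF that] by measurable
    have "(LBINT r:{\<alpha>..1}. VaR (K \<xi>) X r) = (\<integral>r. (if r = 1 then VaR (K \<xi>) X 1 else g (\<xi>, r)) \<partial>lborel)"
      by (simp add: set_lebesgue_integral_def 2)
    also have "\<dots> = (\<integral>r. g (\<xi>, r) \<partial>lborel)"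
      by (rule integral_cong_AE[OF m g1[OF that]])
        (rule AE_mp[OF AE_lborel_singleton[of 1]], simp)
    finally show ?thesis by (simp add: CVaR_def)
  qed
  have "(\<lambda>\<xi>. 1 / (1 - \<alpha>) * (\<integral>r. g (\<xi>, r) \<partial>lborel)) \<in> borel_measurable M"
    by measurable
  then show ?thesis by (rule measurable_cong[THEN iffD1, rotated]) (simp add: eq)
qed

section \<open>Normal laws\<close>

text \<open>Includes s = 0, so that the point mass and the proper normal law are treated together
  from here on.\<close>

lemma normal_law_eq_distr:
  assumes "0 \<le> s"
  shows "normal_law \<mu> (s\<^sup>2) = distr std_normal_distribution borel (\<lambda>u. \<mu> + s * u)"
proof (cases "s = 0")
  case True
  interpret N: prob_space "std_normal_distribution"
    using prob_space_normal_density[of 1 0] by simp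
  show ?thesis using True by (simp add: normal_law_def N.distr_const)
next
  case False
  with assms have s: "s > 0" by simp
  interpret N: prob_space "std_normal_distribution"
    using prob_space_normal_density[of 1 0] by simp
  have "distributed std_normal_distribution lborel (\<lambda>x. x) (normal_density 0 1)"
    unfolding distributed_def by (auto simp: distr_id2)
  from N.normal_density_affine[OF this, of s \<mu>] s
  have "distributed std_normal_distribution lborel (\<lambda>x. \<mu> + s * x) (normal_density \<mu> s)"
    by simp
  then have "distr std_normal_distribution lborel (\<lambda>x. \<mu> + s * x) = density lborel (normal_density \<mu> s)"
    by (simp add: distributed_def)
  then show ?thesis using s by (simp add: normal_law_def cong: distr_cong)
qed

lemma real_distribution_std_normal:
  "real_distribution std_normal_distribution"
  using prob_space_normal_density[of 1 0] by (simp add: real_distribution_def real_distribution_axioms_def)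

text \<open>The distribution function is continuous with limits 0 and 1, so \<alpha> has a preimage
  and \<open>inv\<close> selects one.\<close>

lemma std_normal_cdf_bij:
  assumes "0 < \<alpha>" "\<alpha> < 1"
  shows "std_normal_cdf (inv std_normal_cdf \<alpha>) = \<alpha>"
proof -
  interpret N: real_distribution "std_normal_distribution"
    by (rule real_distribution_std_normal)
  have "emeasure std_normal_distribution {x} = 0" for x
    by (subst emeasure_density) (auto intro!: nn_integral_null_set simp: null_sets_def)
  then have cont: "isCont std_normal_cdf x" for x
    unfolding std_normal_cdf_def by (subst N.isCont_cdf) (simp add: measure_def)
  have "eventually (\<lambda>x. \<alpha> < std_normal_cdf x) at_top"
    unfolding std_normal_cdf_def by (rule order_tendstoD(1)[OF N.cdf_lim_at_top_prob assms(2)])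
  then obtain b where b: "\<And>x. x \<ge> b \<Longrightarrow> \<alpha> < std_normal_cdf x" by (auto simp: eventually_at_top_linorder)
  have "eventually (\<lambda>x. std_normal_cdf x < \<alpha>) at_bot"
    unfolding std_normal_cdf_def by (rule order_tendstoD(2)[OF N.cdf_lim_at_bot assms(1)])
  then obtain a where a: "\<And>x. x \<le> a \<Longrightarrow> std_normal_cdf x < \<alpha>" by (auto simp: eventually_at_bot_linorder)
  have "\<exists>x\<ge>min a b. x \<le> b \<and> std_normal_cdf x = \<alpha>"
    using a[of "min a b"] b[of b] cont by (intro IVT) (auto simp: less_imp_le)
  then show ?thesis by (metis f_inv_into_f rangeI)
qed

lemma std_normal_cdf_strict_mono:
  assumes "x < y" shows "std_normal_cdf x < std_normal_cdf y"
proof -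
  interpret N: real_distribution "std_normal_distribution"
    by (rule real_distribution_std_normal)
  have "emeasure std_normal_distribution {x<..y} \<noteq> 0"
  proof
    assume "emeasure std_normal_distribution {x<..y} = 0"
    then have "AE z in lborel. z \<notin> {x<..y}"
      by (subst (asm) emeasure_density) (auto simp: nn_integral_0_iff_AE normal_density_def indicator_def split: if_splits)
    then have "emeasure lborel {x<..y} = 0"
      by (subst (asm) AE_iff_measurable[of "{x<..y}"]) auto
    then show False using assms by simp
  qed
  then have "measure std_normal_distribution {x<..y} > 0"
    by (simp add: N.emeasure_eq_measure zero_less_measure_iff)
  then show ?thesis
    using N.cdf_diff_eq[OF assms] by (simp add: std_normal_cdf_def)
qed

lemma std_normal_integrable:
  "integrable std_normal_distribution (\<lambda>u. u)"
  "integrable std_normal_distribution (\<lambda>u. u\<^sup>2)"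
  "(\<integral>u. u\<^sup>2 \<partial>std_normal_distribution) = 1"
proof -
  show "integrable std_normal_distribution (\<lambda>u. u)"
    using integrable_std_normal_moment[of 1] by (subst integrable_density) (auto simp: mult.commute)
  show "integrable std_normal_distribution (\<lambda>u. u\<^sup>2)"
    using integrable_std_normal_moment[of 2] by (subst integrable_density) (auto simp: mult.commute)
  show "(\<integral>u. u\<^sup>2 \<partial>std_normal_distribution) = 1"
    using integral_std_normal_moment_even[of 1] by (subst integral_density) (auto simp: mult.commute)
qed

text \<open>The function u times the density is the derivative of minus the density, which evaluates
  the integral over (q, \<infinity>); the rest is q times the tail probability. This is the origin
  of the density at the normal quantile in the limiting mean.\<close>

lemma std_normal_excess:
  "(\<integral>u. max 0 (u - q) \<partial>std_normal_distribution) =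
    std_normal_density q - q * (1 - std_normal_cdf q)"
proof -
  let ?N = "std_normal_distribution"
  interpret N: real_distribution ?N by (rule real_distribution_std_normal)
  have i1: "integrable lborel (\<lambda>u. std_normal_density u * u)"
    using integrable_std_normal_moment[of 1] by simp
  have i1': "set_integrable lborel (einterval (ereal q) \<infinity>) (\<lambda>u. u * std_normal_density u)"
    unfolding set_integrable_def by (rule integrable_mult_indicator) (use i1 in \<open>auto simp: mult.commute\<close>)
  have D: "((\<lambda>u. - std_normal_density u) has_vector_derivative u * std_normal_density u) (at u)" for u
    unfolding has_real_derivative_iff_has_vector_derivative[symmetric] std_normal_density_def
    by (auto intro!: derivative_eq_intros simp: field_simps power2_eq_square)
  have lim: "((\<lambda>u. - std_normal_density u) \<longlongrightarrow> 0) at_top"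
    unfolding std_normal_density_def by real_asymp
  have "(LBINT u=ereal q..\<infinity>. u * std_normal_density u) = 0 - (- std_normal_density q)"
  proof (rule interval_integral_FTC_integrable[OF _ D _ i1'])
    show "isCont (\<lambda>u. u * std_normal_density u) x" for x
      unfolding std_normal_density_def by (intro continuous_intros) auto
    have "((\<lambda>u. - std_normal_density u) \<longlongrightarrow> - std_normal_density q) (at_right q)"
      unfolding std_normal_density_def by (intro tendsto_intros) auto
    then show "((((\<lambda>u. - std_normal_density u) \<circ> real_of_ereal) \<longlongrightarrow> - std_normal_density q) (at_right (ereal q)))"
      by (subst ereal_tendsto_simps1)
    show "((((\<lambda>u. - std_normal_density u) \<circ> real_of_ereal) \<longlongrightarrow> 0) (at_left \<infinity>))"
      using lim by (subst ereal_tendsto_simps1)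
  qed auto
  then have A: "(\<integral>u. indicator {q<..} u * (u * std_normal_density u) \<partial>lborel) = std_normal_density q"
    by (simp add: interval_lebesgue_integral_def set_lebesgue_integral_def einterval_def greaterThan_def)
  have "{q<..} = UNIV - {..q}" by auto
  then have m: "measure ?N {q<..} = 1 - std_normal_cdf q"
    using N.prob_compl[of "{..q}"] by (simp add: std_normal_cdf_def cdf_def)
  have "(\<integral>u. max 0 (u - q) \<partial>?N) = (\<integral>u. indicator {q<..} u * u - q * indicator {q<..} u \<partial>?N)"
    by (intro Bochner_Integration.integral_cong) (auto simp: indicator_def)
  also have "\<dots> = (\<integral>u. indicator {q<..} u * u \<partial>?N) - (\<integral>u. q * indicator {q<..} u \<partial>?N)"
    using integrable_mult_indicator[OF _ std_normal_integrable(1), of "{q<..}"]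
    by (intro Bochner_Integration.integral_diff) (auto intro!: integrable_mult_right N.integrable_const_bound[where B=1])
  also have "(\<integral>u. q * indicator {q<..} u \<partial>?N) = q * (1 - std_normal_cdf q)"
    using m by simp
  also have "(\<integral>u. indicator {q<..} u * u \<partial>?N) = std_normal_density q"
    using A by (subst integral_density) (auto simp: mult_ac)
  finally show ?thesis .
qed

section \<open>Linear images of multivariate normal laws\<close>

lemma nn_integral_lborel_shift:
  fixes c :: "'a::euclidean_space"
  assumes [measurable]: "f \<in> borel_measurable borel"
  shows "(\<integral>\<^sup>+z. f (z + c) \<partial>lborel) = (\<integral>\<^sup>+z. f z \<partial>lborel)"
proof -
  have "(\<integral>\<^sup>+z. f z \<partial>lborel) = (\<integral>\<^sup>+z. f z \<partial>distr lborel borel ((+) c))"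
    by (simp add: lborel_distr_plus)
  also have "\<dots> = (\<integral>\<^sup>+z. f (z + c) \<partial>lborel)"
    by (subst nn_integral_distr) (auto simp: add.commute)
  finally show ?thesis by simp
qed

lemma borel_measurable_matrix_vector_mult[measurable]:
  "(\<lambda>z::real^'l. (A::real^'l^'k) *v z) \<in> borel_measurable borel"
  by (intro borel_measurable_continuous_onI linear_continuous_on matrix_vector_mul_bounded_linear)

lemma mv_normal_shift:
  fixes \<mu> :: "real^'l"
  shows "mv_normal \<mu> S = distr (mv_normal 0 S) borel (\<lambda>z. z + \<mu>)"
proof (rule measure_eqI)
  fix A assume "A \<in> sets (mv_normal \<mu> S)"
  then have [measurable]: "A \<in> sets borel" by (simp add: mv_normal_def)
  define k where "k z = ennreal (exp (- (z \<bullet> (matrix_inv S *v z)) / 2) / sqrt ((2 * pi) ^ CARD('l) * det S))" for z :: "real^'l"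
  have [measurable]: "k \<in> borel_measurable borel" unfolding k_def by measurable
  have 0: "mv_normal \<mu> S = density lborel (\<lambda>z. k (z - \<mu>))" "mv_normal 0 S = density lborel k"
    by (simp_all add: mv_normal_def k_def[abs_def])
  have "emeasure (distr (mv_normal 0 S) borel (\<lambda>z. z + \<mu>)) A = (\<integral>\<^sup>+z. k z * indicator A (z + \<mu>) \<partial>lborel)"
  proof -
    have "(\<lambda>z. z + \<mu>) -` A \<in> sets borel"
      using measurable_sets[of "\<lambda>z. z + \<mu>" borel borel A] by simp
    then show ?thesis
      unfolding 0 by (subst emeasure_distr) (auto simp: emeasure_density indicator_def intro!: nn_integral_cong)
  qed
  also have "\<dots> = (\<integral>\<^sup>+z. k (z - \<mu>) * indicator A z \<partial>lborel)"
    by (subst nn_integral_lborel_shift[of "\<lambda>z. k (z - \<mu>) * indicator A z" \<mu>, symmetric]) auto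
  finally show "emeasure (mv_normal \<mu> S) A = emeasure (distr (mv_normal 0 S) borel (\<lambda>z. z + \<mu>)) A"
    unfolding 0 by (simp add: emeasure_density)
qed (simp add: mv_normal_def)

text \<open>Completing the square splits the density of the law into a Gaussian factor in
  \<open>a \<bullet> z\<close> and a factor \<open>r\<close> that is invariant under translation along \<open>b = S a / (a \<bullet> S a)\<close>.\<close>

lemma nn_integral_mv_normal_inner:
  fixes a :: "real^'l" and g :: "real \<Rightarrow> ennreal"
  assumes g[measurable]: "g \<in> borel_measurable borel"
    and prob: "prob_space (mv_normal 0 S)"
    and inv: "\<And>w. matrix_inv S *v (S *v w) = w"
    and sym: "\<And>x y. x \<bullet> (matrix_inv S *v y) = (matrix_inv S *v x) \<bullet> y"
    and pos: "0 < a \<bullet> (S *v a)"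
  shows "(\<integral>\<^sup>+z. g (a \<bullet> z) \<partial>mv_normal 0 S) =
    (\<integral>\<^sup>+u. g u * ennreal (normal_density 0 (sqrt (a \<bullet> (S *v a))) u) \<partial>lborel)"
proof -
  define v where "v = a \<bullet> (S *v a)"
  define b where "b = (1 / v) *\<^sub>R (S *v a)"
  define M where "M = matrix_inv S"
  define q where "q z = z \<bullet> (M *v z) - (a \<bullet> z)\<^sup>2 / v" for z
  define C where "C = sqrt ((2 * pi) ^ CARD('l) * det S)"
  define e where "e u = ennreal (exp (- u\<^sup>2 / (2 * v)))" for u :: real
  define k where "k z = ennreal (exp (- (z \<bullet> (M *v z)) / 2) / C)" for z
  define r where "r z = ennreal (exp (- q z / 2) / C)" for z
  have v: "0 < v" using pos by (simp add: v_def)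
  have [measurable]: "q \<in> borel_measurable borel" unfolding q_def by measurable
  have [measurable]: "e \<in> borel_measurable borel" "k \<in> borel_measurable borel" "r \<in> borel_measurable borel"
    unfolding e_def k_def r_def by measurable
  have Mb: "M *v b = (1 / v) *\<^sub>R a"
    by (simp add: b_def M_def matrix_vector_mult_scaleR inv)
  have ab: "a \<bullet> b = 1" using v by (simp add: b_def v_def)
  have q_inv: "q (z + t *\<^sub>R b) = q z" for z t
  proof -
    have 1: "M *v (z + t *\<^sub>R b) = M *v z + (t / v) *\<^sub>R a"
      by (simp add: matrix_vector_right_distrib matrix_vector_mult_scaleR Mb)
    have 2: "b \<bullet> (M *v z) = (a \<bullet> z) / v"
      using sym[of b z] by (simp add: M_def[symmetric] Mb)
    have "q (z + t *\<^sub>R b) = z \<bullet> (M *v z) + (t / v) * (a \<bullet> z) + t * ((a \<bullet> z) / v) + t * (t / v) - (a \<bullet> z + t)\<^sup>2 / v"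
      by (simp add: q_def 1 2 ab inner_add_left inner_add_right inner_commute[of _ a] add_divide_distrib distrib_left)
    also have "\<dots> = q z"
    proof -
      have "x + t / v * w + t * (w / v) + t * (t / v) - (w + t)\<^sup>2 / v = x - w\<^sup>2 / v" for x w :: real
        using v by (simp add: field_simps power2_eq_square)
      from this[of "z \<bullet> (M *v z)" "a \<bullet> z"] show ?thesis unfolding q_def .
    qed
    finally show ?thesis .
  qed
  have r_inv: "r (z + t *\<^sub>R b) = r z" for z t by (simp add: r_def q_inv)
  have k_eq: "k z = e (a \<bullet> z) * r z" for z
  proof -
    have "exp (- (z \<bullet> (M *v z)) / 2) = exp (- (a \<bullet> z)\<^sup>2 / (2 * v)) * exp (- q z / 2)"
      using v by (simp add: q_def exp_add[symmetric] field_simps)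
    then show ?thesis by (simp add: k_def e_def r_def ennreal_mult'[symmetric])
  qed
  have N: "mv_normal 0 S = density lborel k"
    by (simp add: mv_normal_def k_def[abs_def] M_def C_def)
  define I where "I f = (\<integral>\<^sup>+z. f (a \<bullet> z) * k z \<partial>lborel)" for f :: "real \<Rightarrow> ennreal"
  \<comment> \<open>The normalising constant \<open>C\<close> is never evaluated: total mass 1 is
    read off from \<open>prob\<close>.\<close>
  have I1: "I (\<lambda>_. 1) = 1"
    using prob_space.emeasure_space_1[OF prob] unfolding N I_def by (simp add: emeasure_density)
  have nd: "normal_density 0 (sqrt v) u = exp (- u\<^sup>2 / (2 * v)) / sqrt (2 * pi * v)" for u
    using v by (simp add: normal_density_def)
  define c where "c = (\<integral>\<^sup>+t. e t \<partial>lborel)"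
  have "(\<integral>\<^sup>+t. ennreal (normal_density 0 (sqrt v) t) \<partial>lborel) = 1"
    using prob_space.emeasure_space_1[OF prob_space_normal_density[of "sqrt v" 0]] v
    by (simp add: emeasure_density)
  moreover have e_nd: "e t = ennreal (sqrt (2 * pi * v)) * ennreal (normal_density 0 (sqrt v) t)" for t
    using v by (simp add: e_def nd ennreal_mult'[symmetric])
  moreover have "c = (\<integral>\<^sup>+t. ennreal (sqrt (2 * pi * v)) * ennreal (normal_density 0 (sqrt v) t) \<partial>lborel)"
    unfolding c_def by (intro nn_integral_cong e_nd)
  ultimately have c: "c = ennreal (sqrt (2 * pi * v))"
    by (simp add: nn_integral_cmult)
  have shift_t: "(\<integral>\<^sup>+t. f (t + d) \<partial>lborel) = (\<integral>\<^sup>+t. f t \<partial>lborel)" if [measurable]: "f \<in> borel_measurable borel" for f d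
    by (rule nn_integral_lborel_shift) simp
  \<comment> \<open>The factor \<open>c\<close> brings in an auxiliary Gaussian variable t.
    Translating z by t b turns \<open>a \<bullet> z\<close> into \<open>a \<bullet> z + t\<close>
    and leaves \<open>r\<close> alone. With u for this sum as the new variable, translating z by u b
    turns the remaining integral over z into the total mass of \<open>k\<close>, because
    \<open>e\<close> is even.\<close>
  have "I g * c = (\<integral>\<^sup>+z. (\<integral>\<^sup>+t. g (a \<bullet> z) * k z * e t \<partial>lborel) \<partial>lborel)"
    unfolding I_def c_def by (simp add: nn_integral_cmult nn_integral_multc)
  also have "\<dots> = (\<integral>\<^sup>+t. (\<integral>\<^sup>+z. g (a \<bullet> z) * k z * e t \<partial>lborel) \<partial>lborel)"
    by (rule lborel_pair.Fubini') simp
  also have "\<dots> = (\<integral>\<^sup>+t. (\<integral>\<^sup>+z. g (a \<bullet> z + t) * (e (a \<bullet> z + t) * r z) * e t \<partial>lborel) \<partial>lborel)"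
  proof (rule nn_integral_cong)
    fix t :: real
    have "(\<integral>\<^sup>+z. g (a \<bullet> z) * k z * e t \<partial>lborel) = (\<integral>\<^sup>+z. g (a \<bullet> (z + t *\<^sub>R b)) * k (z + t *\<^sub>R b) * e t \<partial>lborel)"
      by (rule nn_integral_lborel_shift[symmetric]) simp
    then show "(\<integral>\<^sup>+z. g (a \<bullet> z) * k z * e t \<partial>lborel) = (\<integral>\<^sup>+z. g (a \<bullet> z + t) * (e (a \<bullet> z + t) * r z) * e t \<partial>lborel)"
      by (simp add: k_eq r_inv inner_add_right ab)
  qed
  also have "\<dots> = (\<integral>\<^sup>+z. (\<integral>\<^sup>+t. g (a \<bullet> z + t) * (e (a \<bullet> z + t) * r z) * e t \<partial>lborel) \<partial>lborel)"
    by (rule lborel_pair.Fubini') simp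
  also have "\<dots> = (\<integral>\<^sup>+z. (\<integral>\<^sup>+u. g u * (e u * r z) * e (u - a \<bullet> z) \<partial>lborel) \<partial>lborel)"
  proof (rule nn_integral_cong)
    fix z
    show "(\<integral>\<^sup>+t. g (a \<bullet> z + t) * (e (a \<bullet> z + t) * r z) * e t \<partial>lborel) = (\<integral>\<^sup>+u. g u * (e u * r z) * e (u - a \<bullet> z) \<partial>lborel)"
      by (subst shift_t[of "\<lambda>u. g u * (e u * r z) * e (u - a \<bullet> z)" "a \<bullet> z", symmetric]) (simp_all add: add.commute)
  qed
  also have "\<dots> = (\<integral>\<^sup>+u. (\<integral>\<^sup>+z. g u * (e u * r z) * e (u - a \<bullet> z) \<partial>lborel) \<partial>lborel)"
    by (rule lborel_pair.Fubini') simp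
  also have "\<dots> = (\<integral>\<^sup>+u. g u * e u \<partial>lborel)"
  proof (rule nn_integral_cong)
    fix u
    have "(\<integral>\<^sup>+z. g u * (e u * r z) * e (u - a \<bullet> z) \<partial>lborel) = (\<integral>\<^sup>+z. (g u * e u) * (r z * e (u - a \<bullet> z)) \<partial>lborel)"
      by (simp add: mult_ac)
    also have "\<dots> = g u * e u * (\<integral>\<^sup>+z. r z * e (u - a \<bullet> z) \<partial>lborel)"
      by (simp add: nn_integral_cmult)
    also have "(\<integral>\<^sup>+z. r z * e (u - a \<bullet> z) \<partial>lborel) = (\<integral>\<^sup>+z. r (z + u *\<^sub>R b) * e (u - a \<bullet> (z + u *\<^sub>R b)) \<partial>lborel)"
      by (rule nn_integral_lborel_shift[symmetric]) simp
    also have "\<dots> = (\<integral>\<^sup>+z. 1 * k z \<partial>lborel)"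
      by (intro nn_integral_cong) (simp add: r_inv inner_add_right ab k_eq, simp add: e_def mult.commute)
    also have "\<dots> = 1" using I1 by (simp add: I_def)
    finally show "(\<integral>\<^sup>+z. g u * (e u * r z) * e (u - a \<bullet> z) \<partial>lborel) = g u * e u" by simp
  qed
  also have "\<dots> = (\<integral>\<^sup>+u. g u * ennreal (normal_density 0 (sqrt v) u) \<partial>lborel) * c"
    by (subst nn_integral_multc[symmetric]) (auto simp: e_nd c mult_ac)
  finally have eq: "I g * c = (\<integral>\<^sup>+u. g u * ennreal (normal_density 0 (sqrt v) u) \<partial>lborel) * c" .
  have "c \<noteq> 0" "c \<noteq> \<infinity>" using v by (auto simp: c)
  then have "I g = (\<integral>\<^sup>+u. g u * ennreal (normal_density 0 (sqrt v) u) \<partial>lborel)"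
    using eq by (metis ennreal_mult_divide_eq infinity_ennreal_def)
  moreover have "(\<integral>\<^sup>+z. g (a \<bullet> z) \<partial>mv_normal 0 S) = I g"
    unfolding N I_def by (subst nn_integral_density) (auto simp: mult.commute)
  ultimately show ?thesis by (simp add: v_def)
qed

text \<open>For a = 0 both sides are point masses; otherwise the centred formula applies, and \<mu>
  enters as a translation.\<close>

lemma distr_mv_normal_inner:
  fixes a \<mu> :: "real^'l"
  assumes prob: "prob_space (mv_normal 0 S)"
    and inv: "\<And>w. matrix_inv S *v (S *v w) = w"
    and sym: "\<And>x y. x \<bullet> (matrix_inv S *v y) = (matrix_inv S *v x) \<bullet> y"
    and pos: "a \<noteq> 0 \<Longrightarrow> 0 < a \<bullet> (S *v a)"
  shows "distr (mv_normal \<mu> S) borel (\<lambda>z. a \<bullet> z) =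
    distr std_normal_distribution borel (\<lambda>u. a \<bullet> \<mu> + sqrt (a \<bullet> (S *v a)) * u)"
proof -
  let ?s = "sqrt (a \<bullet> (S *v a))" and ?N = "std_normal_distribution"
  interpret P: prob_space "mv_normal 0 S" by (rule prob)
  have [measurable_cong]: "sets (mv_normal \<mu> S) = sets borel" for \<mu> by (simp add: mv_normal_def)
  have s: "0 \<le> ?s" using pos by (cases "a = 0") (auto simp: less_imp_le)
  have base: "distr (mv_normal 0 S) borel (\<lambda>z. a \<bullet> z) = distr ?N borel (\<lambda>u. 0 + ?s * u)"
  proof (cases "a = 0")
    case True
    interpret N: prob_space ?N using prob_space_normal_density[of 1 0] by simp
    show ?thesis using True by (simp add: P.distr_const N.distr_const)
  next
    case False
    from pos[OF this] have p: "0 < a \<bullet> (S *v a)" .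
    have "distr ?N borel (\<lambda>u. 0 + ?s * u) = density lborel (\<lambda>z. ennreal (normal_density 0 ?s z))"
      using normal_law_eq_distr[OF s, of 0] p by (simp add: normal_law_def)
    moreover have "distr (mv_normal 0 S) borel (\<lambda>z. a \<bullet> z) = density lborel (\<lambda>z. ennreal (normal_density 0 ?s z))"
    proof (rule measure_eqI)
      fix A assume "A \<in> sets (distr (mv_normal 0 S) borel (\<lambda>z. a \<bullet> z))"
      then have [measurable]: "A \<in> sets borel" by simp
      have "emeasure (distr (mv_normal 0 S) borel (\<lambda>z. a \<bullet> z)) A = (\<integral>\<^sup>+u. indicator A u \<partial>distr (mv_normal 0 S) borel (\<lambda>z. a \<bullet> z))"
        by simp
      also have "\<dots> = (\<integral>\<^sup>+z. indicator A (a \<bullet> z) \<partial>mv_normal 0 S)"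
        by (subst nn_integral_distr) auto
      also have "\<dots> = emeasure (density lborel (\<lambda>z. ennreal (normal_density 0 ?s z))) A"
        by (subst nn_integral_mv_normal_inner[OF _ prob inv sym p]) (auto simp: emeasure_density mult.commute)
      finally show "emeasure (distr (mv_normal 0 S) borel (\<lambda>z. a \<bullet> z)) A = emeasure (density lborel (\<lambda>z. ennreal (normal_density 0 ?s z))) A" .
    qed simp
    ultimately show ?thesis by simp
  qed
  have "distr (mv_normal \<mu> S) borel (\<lambda>z. a \<bullet> z) = distr (distr (mv_normal 0 S) borel (\<lambda>z. a \<bullet> z)) borel (\<lambda>u. a \<bullet> \<mu> + u)"
    by (subst mv_normal_shift, subst (1 2) distr_distr) (auto simp: o_def inner_add_right add.commute)
  also have "\<dots> = distr ?N borel (\<lambda>u. a \<bullet> \<mu> + ?s * u)"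
    unfolding base by (subst distr_distr) (auto simp: o_def)
  finally show ?thesis .
qed

section \<open>Fisher information\<close>

text \<open>J is the Gram matrix of the score, so \<open>x \<bullet> (J *v x)\<close> is the second
  moment of \<open>s y \<bullet> x\<close>. If it vanishes, the score is almost surely orthogonal to
  x, hence every \<open>w \<bullet> (J *v x)\<close> vanishes too, and invertibility forces x =
  0.\<close>

lemma fisher_information_symmetric_pos_def:
  assumes F: "is_fisher_information \<Theta> \<theta>c Q q J" and J: "invertible J"
  shows "x \<bullet> (J *v y) = (J *v x) \<bullet> y" and "x \<noteq> 0 \<Longrightarrow> 0 < x \<bullet> (J *v x)"
proof -
  obtain s where int: "\<And>i j. integrable Q (\<lambda>y. s y $ i * s y $ j)"
    and Jij: "\<And>i j. J $ i $ j = (\<integral>y. s y $ i * s y $ j \<partial>Q)"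
    using F unfolding is_fisher_information_def by blast
  have inner: "x \<bullet> (J *v w) = (\<integral>y. (s y \<bullet> x) * (s y \<bullet> w) \<partial>Q)" and ii: "integrable Q (\<lambda>y. (s y \<bullet> x) * (s y \<bullet> w))" for x w
  proof -
    have e: "(s y \<bullet> x) * (s y \<bullet> w) = (\<Sum>i\<in>UNIV. \<Sum>j\<in>UNIV. (s y $ i * x $ i) * (s y $ j * w $ j))" for y
      by (simp only: inner_vec_def sum_product inner_real_def)
    have e: "(s y \<bullet> x) * (s y \<bullet> w) = (\<Sum>i\<in>UNIV. \<Sum>j\<in>UNIV. x $ i * w $ j * (s y $ i * s y $ j))" for y
      unfolding e by (intro sum.cong refl) (simp add: mult_ac)
    show "integrable Q (\<lambda>y. (s y \<bullet> x) * (s y \<bullet> w))" unfolding e using int by auto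
    have "x \<bullet> (J *v w) = (\<Sum>i\<in>UNIV. \<Sum>j\<in>UNIV. x $ i * w $ j * J $ i $ j)"
      by (simp add: inner_vec_def matrix_vector_mult_def sum_distrib_left mult_ac)
    then show "x \<bullet> (J *v w) = (\<integral>y. (s y \<bullet> x) * (s y \<bullet> w) \<partial>Q)"
      unfolding e using int by (simp add: Jij Bochner_Integration.integral_sum)
  qed
  show "x \<bullet> (J *v y) = (J *v x) \<bullet> y"
    by (simp add: inner inner_commute[of "J *v x"] mult.commute)
  assume "x \<noteq> 0"
  have "0 \<le> x \<bullet> (J *v x)" unfolding inner by (intro integral_nonneg_AE) auto
  moreover have "x \<bullet> (J *v x) \<noteq> 0"
  proof
    assume 0: "x \<bullet> (J *v x) = 0"
    have "AE y in Q. (s y \<bullet> x) * (s y \<bullet> x) = 0"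
      using 0 integral_nonneg_eq_0_iff_AE[OF ii[of x x]] unfolding inner by simp
    then have "AE y in Q. s y \<bullet> x = 0" by simp
    then have "w \<bullet> (J *v x) = 0" for w
      unfolding inner by (intro integral_eq_zero_AE) auto
    then have "J *v x = 0" by (metis inner_eq_zero_iff)
    then have "x = 0" using J by (metis invertible_def matrix_vector_mul_assoc matrix_vector_mul_lid matrix_vector_mult_0_right)
    with \<open>x \<noteq> 0\<close> show False by simp
  qed
  ultimately show "0 < x \<bullet> (J *v x)" by simp
qed

lemma matrix_inv_cancel:
  fixes A :: "real^'l^'l"
  assumes "invertible A" shows "A ** matrix_inv A = mat 1" "matrix_inv A ** A = mat 1"
  using someI_ex[OF assms[unfolded invertible_def]] unfolding matrix_inv_def by auto

lemma matrix_inv_matrix_inv: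
  fixes J :: "real^'l^'l"
  assumes "invertible J" shows "matrix_inv (matrix_inv J) = J"
proof -
  note inv = matrix_inv_cancel
  have "invertible (matrix_inv J)" using inv[OF assms] unfolding invertible_def by blast
  then have "matrix_inv (matrix_inv J) = (J ** matrix_inv J) ** matrix_inv (matrix_inv J)"
    using inv[OF assms] by simp
  also have "\<dots> = J" using inv[OF \<open>invertible (matrix_inv J)\<close>] by (simp add: matrix_mul_assoc[symmetric])
  finally show ?thesis .
qed

section \<open>Total variation distance\<close>

lemma finite_measure_outer_open:
  fixes M :: "'a::{second_countable_topology, complete_space} measure"
  assumes "finite_measure M" "sets M = sets borel" "A \<in> sets borel" "0 < e"
  obtains U where "open U" "A \<subseteq> U" "measure M U < measure M A + e"
proof -
  interpret finite_measure M by fact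
  have fin: "emeasure M (space M) \<noteq> \<infinity>" by simp
  have "(INF U \<in> {U. A \<subseteq> U \<and> open U}. emeasure M U) < emeasure M A + ennreal e"
    unfolding outer_regular[OF assms(2) fin assms(3), symmetric]
    using assms(4) by (simp add: emeasure_eq_measure ennreal_plus[symmetric] ennreal_less_iff del: ennreal_plus)
  then obtain U where "A \<subseteq> U" "open U" "emeasure M U < emeasure M A + ennreal e"
    by (auto simp: INF_less_iff)
  then show thesis using that[of U] assms(4)
    by (simp add: emeasure_eq_measure ennreal_plus[symmetric] ennreal_less_iff del: ennreal_plus)
qed

lemma bdd_above_measure_diff:
  assumes "finite_measure M" "finite_measure N"
  shows "bdd_above ((\<lambda>A. \<bar>measure M A - measure N A\<bar>) ` \<A>)"
proof (rule bdd_aboveI2)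
  fix A
  show "\<bar>measure M A - measure N A\<bar> \<le> measure M (space M) + measure N (space N)"
    using finite_measure.bounded_measure[OF assms(1), of A] finite_measure.bounded_measure[OF assms(2), of A]
      measure_nonneg[of M A] measure_nonneg[of N A] by linarith
qed

lemma tv_dist_le_iff:
  assumes "finite_measure M" "finite_measure N"
  shows "tv_dist M N \<le> t \<longleftrightarrow> (\<forall>A\<in>sets M. \<bar>measure M A - measure N A\<bar> \<le> t)"
  unfolding tv_dist_def by (rule cSUP_le_iff[OF _ bdd_above_measure_diff[OF assms]]) auto

text \<open>The supremum defining the total variation distance can be restricted to the countably many
  finite unions of sets of a topological basis, by outer regularity.\<close>

lemma tv_dist_le_iff_basis:
  fixes M N :: "'a::{second_countable_topology, complete_space} measure"
  assumes M: "finite_measure M" "sets M = sets borel" and N: "finite_measure N" "sets N = sets borel"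
    and B: "topological_basis B" "countable B"
  shows "tv_dist M N \<le> t \<longleftrightarrow> (\<forall>F\<in>{F. finite F \<and> F \<subseteq> B}. \<bar>measure M (\<Union>F) - measure N (\<Union>F)\<bar> \<le> t)"
  unfolding tv_dist_le_iff[OF M(1) N(1)]
proof safe
  fix F assume *: "\<forall>A\<in>sets M. \<bar>measure M A - measure N A\<bar> \<le> t" "F \<subseteq> B" "finite F"
  have "open (\<Union>F)" using B(1) *(2) by (auto intro!: open_Union simp: topological_basis_open subset_eq)
  then have "\<Union>F \<in> sets M" unfolding M(2) by (rule borel_open)
  with *(1) show "\<bar>measure M (\<Union>F) - measure N (\<Union>F)\<bar> \<le> t" by blast
next
  fix A assume *: "\<forall>F\<in>{F. finite F \<and> F \<subseteq> B}. \<bar>measure M (\<Union>F) - measure N (\<Union>F)\<bar> \<le> t" and A: "A \<in> sets M"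
  interpret M: finite_measure M by fact
  interpret N: finite_measure N by fact
  note [measurable_cong] = M(2) N(2)
  \<comment> \<open>An open set is the increasing limit of finite unions of basis sets, along an
    enumeration of the basis sets that make it up.\<close>
  have opn: "\<bar>measure M U - measure N U\<bar> \<le> t" if U: "open U" for U
  proof -
    obtain B' where B': "B' \<subseteq> B" "\<Union>B' = U"
      using B(1) U unfolding topological_basis_def by blast
    have c: "countable B'" using B' B(2) countable_subset by blast
    show ?thesis
    proof (cases "B' = {}")
      case True then show ?thesis using *[rule_format, of "{}"] B' by auto
    next
      case False
      define W where "W n = \<Union>(from_nat_into B' ` {..n})" for n :: nat
      have fB: "from_nat_into B' i \<in> B'" for i using False by (rule from_nat_into)
      have W_sets: "W n \<in> sets borel" for n unfolding W_def
        using fB B' B(1) by (intro borel_open open_Union) (auto simp: topological_basis_open subset_eq)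
      have "(\<Union>n. W n) = U"
      proof -
        have "(\<Union>n. W n) = \<Union>(range (from_nat_into B'))" unfolding W_def by blast
        then show ?thesis by (simp only: range_from_nat_into[OF False c] B'(2))
      qed
      moreover have "incseq W"
        unfolding incseq_def W_def by (intro allI impI Union_mono image_mono) simp
      ultimately have l: "(\<lambda>n. measure M (W n)) \<longlonglongrightarrow> measure M U" "(\<lambda>n. measure N (W n)) \<longlonglongrightarrow> measure N U"
      proof -
        assume W: "(\<Union>n. W n) = U" "incseq W"
        have s: "range W \<subseteq> sets M" "range W \<subseteq> sets N" using W_sets M(2) N(2) by auto
        show "(\<lambda>n. measure M (W n)) \<longlonglongrightarrow> measure M U" "(\<lambda>n. measure N (W n)) \<longlonglongrightarrow> measure N U"
          using M.finite_Lim_measure_incseq[OF s(1) W(2)] N.finite_Lim_measure_incseq[OF s(2) W(2)] W(1) by simp_all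
      qed
      have "\<bar>measure M (W n) - measure N (W n)\<bar> \<le> t" for n
        unfolding W_def using * fB B'(1) by (intro *[rule_format]) auto
      then show ?thesis
        by (intro LIMSEQ_le_const2[OF tendsto_rabs[OF tendsto_diff[OF l]]]) auto
    qed
  qed
  show "\<bar>measure M A - measure N A\<bar> \<le> t"
  proof (rule field_le_epsilon)
    fix e :: real assume e: "0 < e"
    have A': "A \<in> sets borel" using A M(2) by simp
    obtain U1 where U1: "open U1" "A \<subseteq> U1" "measure M U1 < measure M A + e"
      using finite_measure_outer_open[OF M A' e] by blast
    obtain U2 where U2: "open U2" "A \<subseteq> U2" "measure N U2 < measure N A + e"
      using finite_measure_outer_open[OF N A' e] by blast
    \<comment> \<open>\<open>U1 \<inter> U2\<close> is one open set that approximates A well for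
      both measures at once.\<close>
    have "measure M A \<le> measure M (U1 \<inter> U2)" "measure M (U1 \<inter> U2) \<le> measure M U1"
      "measure N A \<le> measure N (U1 \<inter> U2)" "measure N (U1 \<inter> U2) \<le> measure N U2"
      using U1 U2 A' M(2) N(2) by (auto intro!: M.finite_measure_mono N.finite_measure_mono)
    then show "\<bar>measure M A - measure N A\<bar> \<le> t + e"
      using opn[of "U1 \<inter> U2"] U1 U2 by (simp add: open_Int)
  qed
qed

text \<open>The reduction to finite unions of basis sets leaves countably many measurable
  conditions. The result makes the event of a large total variation distance measurable, as the
  union bound of the main proof requires.\<close>

lemma measurable_tv_dist:
  fixes K N :: "'w \<Rightarrow> 'a::{second_countable_topology, complete_space} measure"
  assumes K: "\<And>\<xi>. \<xi> \<in> space M \<Longrightarrow> finite_measure (K \<xi>)" "\<And>\<xi>. \<xi> \<in> space M \<Longrightarrow> sets (K \<xi>) = sets borel"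
    and N: "\<And>\<xi>. \<xi> \<in> space M \<Longrightarrow> finite_measure (N \<xi>)" "\<And>\<xi>. \<xi> \<in> space M \<Longrightarrow> sets (N \<xi>) = sets borel"
    and [measurable]: "\<And>U. open U \<Longrightarrow> (\<lambda>\<xi>. measure (K \<xi>) U) \<in> borel_measurable M"
      "\<And>U. open U \<Longrightarrow> (\<lambda>\<xi>. measure (N \<xi>) U) \<in> borel_measurable M"
  shows "(\<lambda>\<xi>. tv_dist (K \<xi>) (N \<xi>)) \<in> borel_measurable M"
proof (subst borel_measurable_iff_le, rule allI)
  fix t
  obtain B :: "'a set set" where B: "countable B" "topological_basis B" using ex_countable_basis by blast
  have "{\<xi> \<in> space M. tv_dist (K \<xi>) (N \<xi>) \<le> t} =
    {\<xi> \<in> space M. \<forall>F\<in>{F. finite F \<and> F \<subseteq> B}. \<bar>measure (K \<xi>) (\<Union>F) - measure (N \<xi>) (\<Union>F)\<bar> \<le> t}"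
    using tv_dist_le_iff_basis[OF K N B(2,1)] by auto
  also have "\<dots> \<in> sets M"
  proof (rule sets.sets_Collect_countable_All')
    show "countable {F. finite F \<and> F \<subseteq> B}"
      using countable_Collect_finite_subset[OF B(1)] by (simp add: conj_commute)
    fix F assume "F \<in> {F. finite F \<and> F \<subseteq> B}"
    then have [simp]: "open (\<Union>F)" using B(2) by (auto intro!: open_Union simp: topological_basis_open subset_eq)
    show "{\<xi> \<in> space M. \<bar>measure (K \<xi>) (\<Union>F) - measure (N \<xi>) (\<Union>F)\<bar> \<le> t} \<in> sets M"
      by measurable
  qed
  finally show "{\<xi> \<in> space M. tv_dist (K \<xi>) (N \<xi>) \<le> t} \<in> sets M" .
qed

section \<open>The CVaR of an approximately normal variable\<close>

text \<open>Layer cake: the integral of f is the integral over levels in [0, T] of the measures of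
  its superlevel sets, and each level loses at most t.\<close>

lemma integral_le_of_measure_le:
  assumes M: "prob_space M" and N: "prob_space N" "sets N = sets M"
    and f[measurable]: "f \<in> borel_measurable M" and f0: "\<And>x. 0 \<le> f x" and fT: "\<And>x. f x \<le> T"
    and le: "\<And>A. A \<in> sets M \<Longrightarrow> measure M A \<le> measure N A + t"
  shows "(\<integral>x. f x \<partial>M) \<le> (\<integral>x. f x \<partial>N) + T * t"
proof -
  interpret M: prob_space M by fact
  interpret N: prob_space N by fact
  interpret PM: pair_sigma_finite M lborel ..
  interpret PN: pair_sigma_finite N lborel ..
  have [measurable]: "f \<in> borel_measurable N" using f N(2) by (simp cong: measurable_cong_sets)
  have T: "0 \<le> T" using f0 fT order_trans by blast
  have t: "0 \<le> t" using le[of "{}"] by simp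
  have sp: "space N = space M" by (rule sets_eq_imp_space_eq[OF N(2)])
  \<comment> \<open>Negative levels get the empty set, so only levels in [0, T] contribute.\<close>
  define A where "A r = {x \<in> space M. 0 \<le> r \<and> r < f x}" for r :: real
  have [measurable]: "A r \<in> sets M" "A r \<in> sets N" for r
    unfolding A_def N(2) by measurable
  have layer: "(\<integral>\<^sup>+x. ennreal (f x) \<partial>L) = (\<integral>\<^sup>+r. emeasure L (A r) \<partial>lborel)"
    if "sigma_finite_measure L" "sets L = sets M" for L
  proof -
    interpret L: sigma_finite_measure L by fact
    interpret PL: pair_sigma_finite L lborel ..
    have [measurable]: "f \<in> borel_measurable L" using f that(2) by (simp cong: measurable_cong_sets)
    have sL: "space L = space M" by (rule sets_eq_imp_space_eq[OF that(2)])
    have "(\<integral>\<^sup>+x. ennreal (f x) \<partial>L) = (\<integral>\<^sup>+x. (\<integral>\<^sup>+r. indicator {0..<f x} r \<partial>lborel) \<partial>L)"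
      using f0 by (intro nn_integral_cong) simp
    also have "\<dots> = (\<integral>\<^sup>+x. (\<integral>\<^sup>+r. indicator {w \<in> space (L \<Otimes>\<^sub>M lborel). 0 \<le> snd w \<and> snd w < f (fst w)} (x, r) \<partial>lborel) \<partial>L)"
      by (intro nn_integral_cong) (auto simp: indicator_def space_pair_measure)
    also have "\<dots> = (\<integral>\<^sup>+r. (\<integral>\<^sup>+x. indicator {w \<in> space (L \<Otimes>\<^sub>M lborel). 0 \<le> snd w \<and> snd w < f (fst w)} (x, r) \<partial>L) \<partial>lborel)"
      by (rule PL.Fubini'[symmetric]) measurable
    also have "\<dots> = (\<integral>\<^sup>+r. (\<integral>\<^sup>+x. indicator (A r) x \<partial>L) \<partial>lborel)"
      by (intro nn_integral_cong) (auto simp: indicator_def space_pair_measure A_def sL)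
    also have "\<dots> = (\<integral>\<^sup>+r. emeasure L (A r) \<partial>lborel)"
      using that(2) by (intro nn_integral_cong nn_integral_indicator) auto
    finally show ?thesis .
  qed
  have bd: "emeasure M (A r) \<le> emeasure N (A r) + indicator {0..T} r * ennreal t" for r
  proof (cases "r \<in> {0..T}")
    case True
    then show ?thesis using le[of "A r"] t
      by (simp add: M.emeasure_eq_measure N.emeasure_eq_measure ennreal_plus[symmetric] del: ennreal_plus)
  next
    case False
    have "\<not> (0 \<le> r \<and> r < f x)" for x using False fT[of x] by auto
    then have "A r = {}" by (auto simp: A_def)
    then show ?thesis by simp
  qed
  have mN: "(\<lambda>r. emeasure N (A r)) \<in> borel_measurable lborel"
  proof -
    have "(\<lambda>r. emeasure N {x \<in> space N. 0 \<le> r \<and> r < f x}) \<in> borel_measurable lborel" by measurable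
    then show ?thesis by (simp add: A_def sp)
  qed
  have "(\<integral>\<^sup>+x. ennreal (f x) \<partial>M) \<le> (\<integral>\<^sup>+r. emeasure N (A r) + indicator {0..T} r * ennreal t \<partial>lborel)"
    unfolding layer[OF M.sigma_finite_measure_axioms refl] using bd by (intro nn_integral_mono)
  also have "\<dots> = (\<integral>\<^sup>+x. ennreal (f x) \<partial>N) + ennreal (T * t)"
    using mN T t by (subst nn_integral_add) (auto simp: layer[OF N.sigma_finite_measure_axioms N(2)] nn_integral_multc ennreal_mult)
  finally have le': "(\<integral>\<^sup>+x. ennreal (f x) \<partial>M) \<le> (\<integral>\<^sup>+x. ennreal (f x) \<partial>N) + ennreal (T * t)" .
  have "integrable M f" "integrable N f"
    using f0 fT by (auto intro!: M.integrable_const_bound[where B=T] N.integrable_const_bound[where B=T])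
  then show ?thesis
    using le' T t f0 by (simp add: nn_integral_eq_integral ennreal_plus[symmetric] integral_nonneg_AE del: ennreal_plus)
qed

text \<open>Above R the ratio z / R is at least 1, so z is at most z times a positive power of it.
  This is how a moment of order above 1 gives uniform integrability.\<close>

lemma excess_le_powr:
  fixes z :: real
  assumes "0 \<le> z" "0 < R" "0 < \<gamma>"
  shows "max 0 (z - R) \<le> z powr (1 + \<gamma>) / R powr \<gamma>"
proof (cases "R < z")
  case True
  have "z * R powr \<gamma> \<le> z * z powr \<gamma>"
    using True assms by (intro mult_left_mono powr_mono2) auto
  also have "\<dots> = z powr (1 + \<gamma>)" using True assms by (simp add: powr_add)
  finally have "z \<le> z powr (1 + \<gamma>) / R powr \<gamma>" using assms by (simp add: field_simps)
  moreover have "max 0 (z - R) \<le> z" using True assms by auto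
  ultimately show ?thesis by simp
qed (use assms in auto)

lemma le_one_plus_powr:
  fixes z :: real
  assumes "0 \<le> z" "0 < \<gamma>" shows "z \<le> 1 + z powr (1 + \<gamma>)"
proof -
  have "z - 1 \<le> max 0 (z - 1)" by simp
  then show ?thesis using excess_le_powr[of z 1 \<gamma>] assms by simp
qed

lemma normal_excess:
  assumes \<alpha>: "0 < \<alpha>" "\<alpha> < 1" and s: "0 \<le> s" and N: "N = std_normal_distribution"
    and q: "q = inv std_normal_cdf \<alpha>"
  shows "(\<integral>u. max 0 (s * u - s * q) \<partial>N) = s * std_normal_density q - s * q * (1 - \<alpha>)"
proof -
  have "max 0 (s * u - s * q) = s * max 0 (u - q)" for u
    using s by (simp add: max_mult_distrib_left right_diff_distrib)
  then show ?thesis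
    using std_normal_excess[of q] std_normal_cdf_bij[OF \<alpha>] by (simp add: N q right_diff_distrib)
qed

text \<open>For s > 0 the gap comes from strict growth of the normal distribution function; for s =
  0 the two sets are the empty set and the whole line.\<close>

lemma normal_quantile_gap:
  assumes \<alpha>: "0 < \<alpha>" "\<alpha> < 1" and s: "0 \<le> s" and d: "0 < d"
    and N: "N = std_normal_distribution"
    and q: "q = inv std_normal_cdf \<alpha>"
  shows "measure N {u. s * u \<le> s * q - d} < \<alpha>" "\<alpha> < measure N {u. s * u \<le> s * q + d}"
proof -
  interpret N: real_distribution N unfolding N by (rule real_distribution_std_normal)
  have cdf: "std_normal_cdf u = measure N {..u}" for u by (simp add: std_normal_cdf_def cdf_def N)
  have "measure N {u. s * u \<le> s * q - d} < \<alpha> \<and> \<alpha> < measure N {u. s * u \<le> s * q + d}"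
  proof (cases "s = 0")
    case True
    then show ?thesis using d \<alpha> N.prob_space by simp
  next
    case False
    with s have s: "0 < s" by simp
    then have "{u. s * u \<le> s * q - d} = {..q - d / s}" "{u. s * u \<le> s * q + d} = {..q + d / s}"
      by (auto simp: field_simps)
    then show ?thesis
      using std_normal_cdf_strict_mono[of "q - d / s" q] std_normal_cdf_strict_mono[of q "q + d / s"] s d
        std_normal_cdf_bij[OF \<alpha>] by (simp add: cdf q)
  qed
  then show "measure N {u. s * u \<le> s * q - d} < \<alpha>" "\<alpha> < measure N {u. s * u \<le> s * q + d}" by auto
qed

section \<open>Error bounds for the superquantile of a nearly normal variable\<close>

text \<open>In the application Q is the posterior, X the scaled cost deviation, W its linearisation,
  \<zeta> the norm of the scaled parameter, F the set of parameters far from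
  \<open>\<theta>c\<close>, and m the centre of the normal approximation. The remaining numbers do
  not depend on the data. On F nothing relates X to W; there X is controlled only through the mean
  of its positive part.\<close>

context
  fixes Q :: "'a measure" and X W \<zeta> :: "'a \<Rightarrow> real" and F :: "'a set" and m s \<alpha> \<tau> \<eta> K B A \<gamma> R q :: real
    and N :: "real measure"
  assumes \<alpha>: "0 < \<alpha>" "\<alpha> < 1" and K: "0 \<le> K" and B: "0 \<le> B" and A: "0 \<le> A" and \<gamma>: "0 < \<gamma>" and s: "0 \<le> s"
    and \<tau>: "0 < \<tau>" and \<eta>: "0 < \<eta>" and R: "0 < R"
    and N: "N = std_normal_distribution"
    and q: "q = inv std_normal_cdf \<alpha>"
    and Q: "prob_space Q" and X[measurable]: "X \<in> borel_measurable Q" and W[measurable]: "W \<in> borel_measurable Q"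
    and \<zeta>[measurable]: "\<zeta> \<in> borel_measurable Q" and F[measurable]: "F \<in> sets Q" and m: "\<bar>m\<bar> \<le> B"
    and tv: "\<And>D. D \<in> sets borel \<Longrightarrow>
      \<bar>measure (distr Q borel W) D - measure (distr N borel (\<lambda>u. m + s * u)) D\<bar> \<le> \<tau>"
    and \<zeta>0: "\<And>\<omega>. \<omega> \<in> space Q \<Longrightarrow> 0 \<le> \<zeta> \<omega>"
    and XW: "\<And>\<omega>. \<omega> \<in> space Q \<Longrightarrow> \<omega> \<notin> F \<Longrightarrow> \<bar>X \<omega> - W \<omega>\<bar> \<le> \<eta> * \<zeta> \<omega>"
    and WA: "\<And>\<omega>. \<omega> \<in> space Q \<Longrightarrow> \<bar>W \<omega>\<bar> \<le> A * \<zeta> \<omega>"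
    and int: "integrable Q (\<lambda>\<omega>. \<zeta> \<omega> powr (1 + \<gamma>))" and intK: "(\<integral>\<omega>. \<zeta> \<omega> powr (1 + \<gamma>) \<partial>Q) \<le> K"
    and F\<tau>: "measure Q F \<le> \<tau>" and XF: "(\<integral>\<omega>. indicator F \<omega> * max 0 (X \<omega>) \<partial>Q) \<le> \<tau>"
begin

interpretation Q: prob_space Q by (rule Q)
interpretation N: real_distribution N unfolding N by (rule real_distribution_std_normal)

private definition "c = m + s * q"
private definition "C0 = B + s * \<bar>q\<bar>"
text \<open>Large enough for both tails: W - c - T is at most A (\<zeta> - R), and the excess of the
  normal variable over c + T is at most s (|u| - R). It depends on m only through the bound
  B.\<close>

private definition "T = C0 + (A + s) * R"
private definition "f w = min T (max 0 (w - c))"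
text \<open>The expected excess of the normal variable m + s u over its \<alpha>-quantile c, in
  closed form.\<close>

private definition "g0 = s * std_normal_density q - s * q * (1 - \<alpha>)"

lemma threshold_bounds: "\<bar>c\<bar> \<le> C0" "0 \<le> C0" "0 \<le> T"
  using m s B A R abs_triangle_ineq[of m "s * q"] by (auto simp: c_def C0_def T_def abs_mult)

lemma truncation_measurable[measurable]: "f \<in> borel_measurable borel"
  unfolding f_def by measurable

lemma truncation_bounds: "0 \<le> f w" "f w \<le> T" using threshold_bounds by (auto simp: f_def)

lemma integrable_indicator_Q: "D \<in> sets Q \<Longrightarrow> integrable Q (indicator D :: 'a \<Rightarrow> real)"
  by (intro integrable_real_indicator) (auto simp: less_top[symmetric])

lemma integrable_truncation_W: "integrable Q (\<lambda>\<omega>. f (W \<omega>))"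
  using truncation_bounds by (intro Q.integrable_const_bound[where B=T]) auto

lemma integrable_zeta: "integrable Q \<zeta>" and integral_zeta: "(\<integral>\<omega>. \<zeta> \<omega> \<partial>Q) \<le> 1 + K"
proof -
  have i: "integrable Q (\<lambda>\<omega>. 1 + \<zeta> \<omega> powr (1 + \<gamma>))" using int by simp
  show z: "integrable Q \<zeta>"
    by (rule Bochner_Integration.integrable_bound[OF i])
      (use le_one_plus_powr[OF \<zeta>0 \<gamma>] \<zeta>0 in \<open>auto intro!: AE_I2\<close>)
  have "(\<integral>\<omega>. \<zeta> \<omega> \<partial>Q) \<le> (\<integral>\<omega>. 1 + \<zeta> \<omega> powr (1 + \<gamma>) \<partial>Q)"
    using le_one_plus_powr[OF \<zeta>0 \<gamma>] by (intro integral_mono z i) auto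
  then show "(\<integral>\<omega>. \<zeta> \<omega> \<partial>Q) \<le> 1 + K" using int intK by (simp add: Q.prob_space)
qed

text \<open>The truncated excess lies between 0 and T, so a total variation error \<tau> costs T
  \<tau>.\<close>

lemma integral_truncation_W: "\<bar>(\<integral>\<omega>. f (W \<omega>) \<partial>Q) - (\<integral>u. f (m + s * u) \<partial>N)\<bar> \<le> T * \<tau>"
proof -
  have p: "prob_space (distr Q borel W)" "prob_space (distr N borel (\<lambda>u. m + s * u))"
    by (auto intro: Q.prob_space_distr N.prob_space_distr)
  have "(\<integral>x. f x \<partial>distr Q borel W) \<le> (\<integral>x. f x \<partial>distr N borel (\<lambda>u. m + s * u)) + T * \<tau>"
    using tv by (intro integral_le_of_measure_le p truncation_bounds) (auto simp: abs_le_iff algebra_simps)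
  moreover have "(\<integral>x. f x \<partial>distr N borel (\<lambda>u. m + s * u)) \<le> (\<integral>x. f x \<partial>distr Q borel W) + T * \<tau>"
    using tv by (intro integral_le_of_measure_le p truncation_bounds) (auto simp: abs_le_iff algebra_simps)
  ultimately show ?thesis by (simp add: integral_distr abs_le_iff)
qed

lemma integrable_excess_N: "integrable N (\<lambda>u. max 0 (s * u - s * q))"
proof (rule Bochner_Integration.integrable_bound)
  show "integrable N (\<lambda>u. s * \<bar>u\<bar> + s * \<bar>q\<bar>)"
    using std_normal_integrable(1)[folded N] by (intro Bochner_Integration.integrable_add integrable_mult_right integrable_abs N.integrable_const)
  show "AE u in N. norm (max 0 (s * u - s * q)) \<le> norm (s * \<bar>u\<bar> + s * \<bar>q\<bar>)"
  proof (intro AE_I2)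
    fix u
    have "s * u - s * q \<le> s * \<bar>u\<bar> + s * \<bar>q\<bar>" "0 \<le> s * \<bar>u\<bar> + s * \<bar>q\<bar>"
      using s by (simp_all add: distrib_left[symmetric] right_diff_distrib[symmetric] mult_left_mono)
    then show "norm (max 0 (s * u - s * q)) \<le> norm (s * \<bar>u\<bar> + s * \<bar>q\<bar>)" by auto
  qed
qed simp

lemma integral_truncation_N: "(\<integral>u. f (m + s * u) \<partial>N) \<le> g0" "g0 - s / R \<le> (\<integral>u. f (m + s * u) \<partial>N)"
proof -
  have g0: "g0 = (\<integral>u. max 0 (s * u - s * q) \<partial>N)"
    unfolding g0_def by (rule normal_excess[OF \<alpha> s N q, symmetric])
  have fi: "integrable N (\<lambda>u. f (m + s * u))"
    using truncation_bounds by (intro N.integrable_const_bound[where B=T]) auto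
  have i2: "integrable N (\<lambda>u. s / R * u\<^sup>2)" "(\<integral>u. s / R * u\<^sup>2 \<partial>N) = s / R"
    using std_normal_integrable by (simp_all add: N)
  show "(\<integral>u. f (m + s * u) \<partial>N) \<le> g0"
    unfolding g0 by (intro integral_mono fi integrable_excess_N) (auto simp: f_def c_def)
  \<comment> \<open>The truncation loses at most s (|u| - R), which the quadratic term dominates;
    its mean is s / R because the second moment is 1.\<close>
  have "g0 \<le> (\<integral>u. f (m + s * u) + s / R * u\<^sup>2 \<partial>N)"
    unfolding g0
  proof (intro integral_mono integrable_excess_N Bochner_Integration.integrable_add fi i2)
    fix u
    have "s * u - s * q - T \<le> s * \<bar>u\<bar> + s * \<bar>q\<bar> - T"
      using s by (simp add: distrib_left[symmetric] right_diff_distrib[symmetric] mult_left_mono)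
    also have "\<dots> \<le> s * (\<bar>u\<bar> - R)"
      using A R B by (simp add: T_def C0_def algebra_simps)
    also have "\<dots> \<le> s * (u\<^sup>2 / R)"
    proof (rule mult_left_mono[OF _ s])
      have "R * \<bar>u\<bar> \<le> R * R + u\<^sup>2"
      proof -
        have "2 * (R * \<bar>u\<bar>) \<le> R * R + u\<^sup>2"
          using sum_squares_bound[of R "\<bar>u\<bar>"] by (simp add: power2_eq_square mult.assoc)
        moreover have "0 \<le> R * \<bar>u\<bar>" using R by simp
        ultimately show ?thesis by linarith
      qed
      then show "\<bar>u\<bar> - R \<le> u\<^sup>2 / R" using R by (simp add: field_simps)
    qed
    finally have "s * u - s * q - T \<le> s / R * u\<^sup>2" by simp
    moreover have "0 \<le> s / R * u\<^sup>2" using s R by simp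
    ultimately show "max 0 (s * u - s * q) \<le> f (m + s * u) + s / R * u\<^sup>2"
      using threshold_bounds by (auto simp: f_def c_def)
  qed
  then show "g0 - s / R \<le> (\<integral>u. f (m + s * u) \<partial>N)"
    unfolding Bochner_Integration.integral_add[OF fi i2(1)] i2(2) by linarith
qed

text \<open>Any threshold gives an upper bound; the quantile c of the normal law is the nearly
  optimal one. Off F the excess of X is at most that of W plus \<open>\<eta> * \<zeta>\<close>, on F
  at most the positive part of X plus C0.\<close>

lemma superquantile_upper:
  assumes "superquantile Q X \<alpha> V"
  shows "V \<le> c + (g0 + T * \<tau> + A * K / R powr \<gamma> + \<eta> * (1 + K) + \<tau> + C0 * \<tau>) / (1 - \<alpha>)"
proof -
  have V: "integrable Q (\<lambda>\<omega>. max 0 (X \<omega> - d))" "V \<le> d + (\<integral>\<omega>. max 0 (X \<omega> - d) \<partial>Q) / (1 - \<alpha>)" for d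
    using assms unfolding superquantile_def by auto
  have iF: "integrable Q (\<lambda>\<omega>. indicator F \<omega> * max 0 (X \<omega>))"
    using integrable_mult_indicator[OF F V(1)[of 0]] by simp
  have iP: "integrable Q (\<lambda>\<omega>. A / R powr \<gamma> * \<zeta> \<omega> powr (1 + \<gamma>))" using int by simp
  have iE: "integrable Q (\<lambda>\<omega>. \<eta> * \<zeta> \<omega>)" using integrable_zeta by simp
  have iC: "integrable Q (\<lambda>\<omega>. C0 * indicator F \<omega>)" by (intro integrable_mult_right integrable_indicator_Q F)
  have "(\<integral>\<omega>. max 0 (X \<omega> - c) \<partial>Q) \<le> (\<integral>\<omega>. f (W \<omega>) + A / R powr \<gamma> * \<zeta> \<omega> powr (1 + \<gamma>) + \<eta> * \<zeta> \<omega>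
      + indicator F \<omega> * max 0 (X \<omega>) + C0 * indicator F \<omega> \<partial>Q)"
  proof (intro integral_mono V Bochner_Integration.integrable_add integrable_truncation_W iF iP iE iC)
    fix \<omega> assume \<omega>: "\<omega> \<in> space Q"
    have p: "0 \<le> A / R powr \<gamma> * \<zeta> \<omega> powr (1 + \<gamma>)" "0 \<le> \<eta> * \<zeta> \<omega>" using A \<eta> \<zeta>0[OF \<omega>] by auto
    have "A * (\<zeta> \<omega> - R) \<le> A * (\<zeta> \<omega> powr (1 + \<gamma>) / R powr \<gamma>)"
      using excess_le_powr[OF \<zeta>0[OF \<omega>] R \<gamma>] A by (intro mult_left_mono) auto
    moreover have "W \<omega> - c - T \<le> A * (\<zeta> \<omega> - R)"
    proof -
      have "W \<omega> \<le> A * \<zeta> \<omega>" "- c \<le> C0" "0 \<le> s * R" using WA[OF \<omega>] threshold_bounds s R by auto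
      then show ?thesis unfolding T_def by (simp add: algebra_simps)
    qed
    ultimately have "max 0 (W \<omega> - c) \<le> f (W \<omega>) + A / R powr \<gamma> * \<zeta> \<omega> powr (1 + \<gamma>)"
      using p threshold_bounds by (auto simp: f_def)
    then show "max 0 (X \<omega> - c) \<le> f (W \<omega>) + A / R powr \<gamma> * \<zeta> \<omega> powr (1 + \<gamma>) + \<eta> * \<zeta> \<omega>
      + indicator F \<omega> * max 0 (X \<omega>) + C0 * indicator F \<omega>"
      using XW[OF \<omega>] p threshold_bounds truncation_bounds[of "W \<omega>"] by (cases "\<omega> \<in> F") auto
  qed
  also have "\<dots> = (\<integral>\<omega>. f (W \<omega>) \<partial>Q) + A / R powr \<gamma> * (\<integral>\<omega>. \<zeta> \<omega> powr (1 + \<gamma>) \<partial>Q) + \<eta> * (\<integral>\<omega>. \<zeta> \<omega> \<partial>Q)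
      + (\<integral>\<omega>. indicator F \<omega> * max 0 (X \<omega>) \<partial>Q) + C0 * measure Q F"
    using integrable_truncation_W iF iP iE iC F by (simp add: Bochner_Integration.integral_add)
  also have "\<dots> \<le> (g0 + T * \<tau>) + A / R powr \<gamma> * K + \<eta> * (1 + K) + \<tau> + C0 * \<tau>"
    using integral_truncation_W integral_truncation_N(1) integral_zeta intK XF F\<tau> A \<eta> threshold_bounds
    by (intro add_mono mult_left_mono) (auto simp: abs_le_iff)
  finally have "(\<integral>\<omega>. max 0 (X \<omega> - c) \<partial>Q) / (1 - \<alpha>) \<le> (g0 + T * \<tau> + A * K / R powr \<gamma> + \<eta> * (1 + K) + \<tau> + C0 * \<tau>) / (1 - \<alpha>)"
    using \<alpha> by (intro divide_right_mono) auto
  then show ?thesis using V(2)[of c] by linarith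
qed

text \<open>Here thresholds on both sides of the \<alpha>-quantile of X are required. They are c - d
  and c + d: one half of d pays for exchanging X and W, the other half is the margin that
  \<open>lo\<close> and \<open>hi\<close> demand of the normal law.\<close>

lemma superquantile_lower:
  assumes V: "superquantile Q X \<alpha> V" and d: "0 < d"
    and lo: "measure N {u. s * u \<le> s * q - d / 2} + 2 * \<tau> + 2 * \<eta> * (1 + K) / d < \<alpha>"
    and hi: "\<alpha> \<le> measure N {u. s * u \<le> s * q + d / 2} - 2 * \<tau> - 2 * \<eta> * (1 + K) / d"
  shows "c - d + (g0 - s / R - 2 * T * \<tau> - \<eta> * (1 + K) - d) / (1 - \<alpha>) \<le> V"
proof -
  have Vi: "integrable Q (\<lambda>\<omega>. max 0 (X \<omega> - d))" for d
    using V unfolding superquantile_def by auto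
  \<comment> \<open>Off F, Y at most a and Z above a + d / 2 force \<open>\<eta> * \<zeta>\<close>
    to be at least d / 2, so Markov's inequality bounds the exchange. It is used with X and W in
    both orders.\<close>
  have loc: "measure Q {\<omega> \<in> space Q. Y \<omega> \<le> a} \<le> measure Q {\<omega> \<in> space Q. Z \<omega> \<le> a + d / 2} + \<tau> + 2 * \<eta> * (1 + K) / d"
    if [measurable]: "Y \<in> borel_measurable Q" "Z \<in> borel_measurable Q" 
      and YZ: "\<And>\<omega>. \<omega> \<in> space Q \<Longrightarrow> \<omega> \<notin> F \<Longrightarrow> \<bar>Y \<omega> - Z \<omega>\<bar> \<le> \<eta> * \<zeta> \<omega>" for Y Z a
  proof -
    have "measure Q {\<omega> \<in> space Q. Y \<omega> \<le> a} = (\<integral>\<omega>. indicator {\<omega> \<in> space Q. Y \<omega> \<le> a} \<omega> \<partial>Q)" by simp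
    also have "\<dots> \<le> (\<integral>\<omega>. indicator {\<omega> \<in> space Q. Z \<omega> \<le> a + d / 2} \<omega> + indicator F \<omega> + (2 * \<eta> / d) * \<zeta> \<omega> \<partial>Q)"
    proof (intro integral_mono Bochner_Integration.integrable_add integrable_mult_right integrable_zeta integrable_indicator_Q)
      fix \<omega> assume \<omega>: "\<omega> \<in> space Q"
      have z: "0 \<le> 2 * \<eta> / d * \<zeta> \<omega>" using \<eta> d \<zeta>0[OF \<omega>] by simp
      show "(indicator {\<omega> \<in> space Q. Y \<omega> \<le> a} \<omega> :: real) \<le> indicator {\<omega> \<in> space Q. Z \<omega> \<le> a + d / 2} \<omega> + indicator F \<omega> + (2 * \<eta> / d) * \<zeta> \<omega>"
      proof (cases "\<omega> \<notin> F \<and> Y \<omega> \<le> a \<and> \<not> Z \<omega> \<le> a + d / 2")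
        case True
        then have "d / 2 \<le> \<eta> * \<zeta> \<omega>" using YZ[OF \<omega>] by auto
        then have "1 \<le> 2 * \<eta> / d * \<zeta> \<omega>" using d by (simp add: field_simps)
        then show ?thesis using True by (simp add: indicator_def)
      next
        case False
        then show ?thesis using z \<omega> by (auto simp: indicator_def)
      qed
    qed auto
    also have "\<dots> = measure Q {\<omega> \<in> space Q. Z \<omega> \<le> a + d / 2} + measure Q F + (2 * \<eta> / d) * (\<integral>\<omega>. \<zeta> \<omega> \<partial>Q)"
      using integrable_zeta F integrable_indicator_Q by (simp add: Bochner_Integration.integral_add)
    also have "\<dots> \<le> measure Q {\<omega> \<in> space Q. Z \<omega> \<le> a + d / 2} + \<tau> + (2 * \<eta> / d) * (1 + K)"
      using integral_zeta F\<tau> \<eta> d by (intro add_mono mult_left_mono) auto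
    finally show ?thesis by simp
  qed
  have tvW: "\<bar>measure Q {\<omega> \<in> space Q. W \<omega> \<le> a} - measure N {u. m + s * u \<le> a}\<bar> \<le> \<tau>" for a
  proof -
    have "measure (distr Q borel W) {..a} = measure Q {\<omega> \<in> space Q. W \<omega> \<le> a}"
      by (subst measure_distr) (auto intro!: arg_cong[where f="measure Q"])
    moreover have "measure (distr N borel (\<lambda>u. m + s * u)) {..a} = measure N {u. m + s * u \<le> a}"
      by (subst measure_distr) (auto intro!: arg_cong[where f="measure N"])
    ultimately show ?thesis using tv[of "{..a}"] by simp
  qed
  have s1: "{u. m + s * u \<le> c - d + d / 2} = {u. s * u \<le> s * q - d / 2}" "{u. m + s * u \<le> c + d / 2} = {u. s * u \<le> s * q + d / 2}"
    by (auto simp: c_def field_simps)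
  have "measure Q {\<omega> \<in> space Q. X \<omega> \<le> c - d} < \<alpha>"
    using loc[OF X W XW, of "c - d"] tvW[of "c - d + d / 2"] lo unfolding s1 by linarith
  moreover have "\<alpha> \<le> measure Q {\<omega> \<in> space Q. X \<omega> \<le> c + d}"
  proof -
    have "\<bar>W \<omega> - X \<omega>\<bar> \<le> \<eta> * \<zeta> \<omega>" if "\<omega> \<in> space Q" "\<omega> \<notin> F" for \<omega>
      using XW[OF that] by (simp add: abs_minus_commute)
    from loc[OF W X this, of "c + d / 2"]
    have "measure Q {\<omega> \<in> space Q. W \<omega> \<le> c + d / 2} \<le> measure Q {\<omega> \<in> space Q. X \<omega> \<le> c + d} + \<tau> + 2 * \<eta> * (1 + K) / d"
      by (simp add: add.assoc)
    then show ?thesis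
      using tvW[of "c + d / 2"] hi unfolding s1 by linarith
  qed
  ultimately have 1: "c - d + (\<integral>\<omega>. max 0 (X \<omega> - (c + d)) \<partial>Q) / (1 - \<alpha>) \<le> V"
    using V unfolding superquantile_def by blast
  \<comment> \<open>On F the left integrand is not positive because f is at most T; off F the terms
    \<open>\<eta> * \<zeta>\<close> and d absorb the exchange of W for X and the raised
    threshold.\<close>
  have "(\<integral>\<omega>. f (W \<omega>) - \<eta> * \<zeta> \<omega> - T * indicator F \<omega> - d \<partial>Q) \<le> (\<integral>\<omega>. max 0 (X \<omega> - (c + d)) \<partial>Q)"
  proof (intro integral_mono Vi Bochner_Integration.integrable_diff integrable_truncation_W integrable_mult_right integrable_zeta integrable_indicator_Q)
    fix \<omega> assume \<omega>: "\<omega> \<in> space Q"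
    have "0 \<le> \<eta> * \<zeta> \<omega>" using \<eta> \<zeta>0[OF \<omega>] by simp
    then show "f (W \<omega>) - \<eta> * \<zeta> \<omega> - T * indicator F \<omega> - d \<le> max 0 (X \<omega> - (c + d))"
      using XW[OF \<omega>] d truncation_bounds[of "W \<omega>"] by (cases "\<omega> \<in> F") (auto simp: f_def)
  qed auto
  moreover have "(\<integral>\<omega>. f (W \<omega>) - \<eta> * \<zeta> \<omega> - T * indicator F \<omega> - d \<partial>Q) = (\<integral>\<omega>. f (W \<omega>) \<partial>Q) - \<eta> * (\<integral>\<omega>. \<zeta> \<omega> \<partial>Q) - T * measure Q F - d"
    using integrable_truncation_W integrable_zeta F integrable_indicator_Q by (simp add: Q.prob_space)
  moreover have "\<eta> * (\<integral>\<omega>. \<zeta> \<omega> \<partial>Q) \<le> \<eta> * (1 + K)" "T * measure Q F \<le> T * \<tau>"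
    using integral_zeta F\<tau> \<eta> threshold_bounds by (auto intro!: mult_left_mono)
  ultimately have "g0 - s / R - 2 * T * \<tau> - \<eta> * (1 + K) - d \<le> (\<integral>\<omega>. max 0 (X \<omega> - (c + d)) \<partial>Q)"
    using integral_truncation_W integral_truncation_N(2) by (simp add: abs_le_iff)
  then have "(g0 - s / R - 2 * T * \<tau> - \<eta> * (1 + K) - d) / (1 - \<alpha>) \<le> (\<integral>\<omega>. max 0 (X \<omega> - (c + d)) \<partial>Q) / (1 - \<alpha>)"
    using \<alpha> by (intro divide_right_mono) auto
  then show ?thesis using 1 by linarith
qed

text \<open>Every error is held below d. The count 5 comes from the lower bound: four errors divided
  by 1 - \<alpha>, and the shift of the threshold by d, itself at most d / (1 - \<alpha>).\<close>

lemma superquantile_close_explicit: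
  assumes V: "superquantile Q X \<alpha> V" and d: "0 < d" 
    and lo: "measure N {u. s * u \<le> s * q - d / 2} + 2 * \<tau> + 2 * \<eta> * (1 + K) / d < \<alpha>"
    and hi: "\<alpha> \<le> measure N {u. s * u \<le> s * q + d / 2} - 2 * \<tau> - 2 * \<eta> * (1 + K) / d"
    and e1: "A * K / R powr \<gamma> \<le> d" "s / R \<le> d"
    and e2: "(2 * (B + s * \<bar>q\<bar> + (A + s) * R) + 1 + (B + s * \<bar>q\<bar>)) * \<tau> \<le> d" and e3: "\<eta> * (1 + K) \<le> d"
  shows "\<bar>V - (m + s / (1 - \<alpha>) * std_normal_density q)\<bar> \<le> 5 * d / (1 - \<alpha>)"
proof -
  have e2': "(2 * T + 1 + C0) * \<tau> \<le> d" using e2 by (simp add: T_def C0_def)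
  have pos: "0 \<le> T * \<tau>" "0 \<le> C0 * \<tau>" using threshold_bounds \<tau> by auto
  have ex: "2 * (T * \<tau>) + \<tau> + C0 * \<tau> \<le> d" using e2' by (simp add: algebra_simps)
  \<comment> \<open>The term s q of the threshold cancels against that of the expected
    excess.\<close>
  have target: "m + s / (1 - \<alpha>) * std_normal_density q = c + g0 / (1 - \<alpha>)"
    using \<alpha> by (simp add: c_def g0_def field_simps)
  have "V \<le> c + (g0 + T * \<tau> + A * K / R powr \<gamma> + \<eta> * (1 + K) + \<tau> + C0 * \<tau>) / (1 - \<alpha>)"
    by (rule superquantile_upper[OF V])
  also have "\<dots> \<le> c + (g0 + 5 * d) / (1 - \<alpha>)"
    using e1 e3 ex pos \<tau> \<alpha> d by (intro add_left_mono divide_right_mono) linarith+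
  finally have U: "V \<le> c + g0 / (1 - \<alpha>) + 5 * d / (1 - \<alpha>)" by (simp add: add_divide_distrib)
  have "d * (1 - \<alpha>) \<le> d * 1" using d \<alpha> by (intro mult_left_mono) auto
  then have dd: "d \<le> d / (1 - \<alpha>)" using \<alpha> by (simp add: pos_le_divide_eq)
  have "c - d + (g0 - 4 * d) / (1 - \<alpha>) \<le> c - d + (g0 - s / R - 2 * T * \<tau> - \<eta> * (1 + K) - d) / (1 - \<alpha>)"
    using e1 e3 ex pos \<tau> \<alpha> d by (intro add_left_mono divide_right_mono) linarith+
  also have "\<dots> \<le> V" by (rule superquantile_lower[OF V d lo hi])
  finally have "c + g0 / (1 - \<alpha>) - d - 4 * (d / (1 - \<alpha>)) \<le> V" by (simp add: diff_divide_distrib)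
  then show ?thesis using U dd unfolding target by (simp add: abs_le_iff)
qed

end

text \<open>The order of quantifiers is the point: \<tau> and \<eta> are fixed before the measure,
  the variables and m, so the same tolerances serve all sample sizes and data sequences.\<close>

lemma superquantile_close_normal:
  assumes \<alpha>: "0 < \<alpha>" "\<alpha> < 1" and K: "0 \<le> K" and B: "0 \<le> B" and A: "0 \<le> A" and \<gamma>: "0 < \<gamma>" and s: "0 \<le> s"
    and \<delta>: "0 < \<delta>"
  obtains \<tau> \<eta> :: real where "0 < \<tau>" "0 < \<eta>"
    "\<And>(Q::'a measure) X W \<zeta> F m V. prob_space Q \<Longrightarrow> X \<in> borel_measurable Q \<Longrightarrow> W \<in> borel_measurable Q \<Longrightarrow>
      \<zeta> \<in> borel_measurable Q \<Longrightarrow> F \<in> sets Q \<Longrightarrow> \<bar>m\<bar> \<le> B \<Longrightarrow>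
      (\<And>D. D \<in> sets borel \<Longrightarrow> \<bar>measure (distr Q borel W) D -
        measure (distr std_normal_distribution borel (\<lambda>u. m + s * u)) D\<bar> \<le> \<tau>) \<Longrightarrow>
      (\<And>\<omega>. \<omega> \<in> space Q \<Longrightarrow> 0 \<le> \<zeta> \<omega>) \<Longrightarrow>
      (\<And>\<omega>. \<omega> \<in> space Q \<Longrightarrow> \<omega> \<notin> F \<Longrightarrow> \<bar>X \<omega> - W \<omega>\<bar> \<le> \<eta> * \<zeta> \<omega>) \<Longrightarrow>
      (\<And>\<omega>. \<omega> \<in> space Q \<Longrightarrow> \<bar>W \<omega>\<bar> \<le> A * \<zeta> \<omega>) \<Longrightarrow>
      integrable Q (\<lambda>\<omega>. \<zeta> \<omega> powr (1 + \<gamma>)) \<Longrightarrow> (\<integral>\<omega>. \<zeta> \<omega> powr (1 + \<gamma>) \<partial>Q) \<le> K \<Longrightarrow>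
      measure Q F \<le> \<tau> \<Longrightarrow> (\<integral>\<omega>. indicator F \<omega> * max 0 (X \<omega>) \<partial>Q) \<le> \<tau> \<Longrightarrow>
      superquantile Q X \<alpha> V \<Longrightarrow>
      \<bar>V - (m + s / (1 - \<alpha>) * std_normal_density (inv std_normal_cdf \<alpha>))\<bar> \<le> \<delta>"
proof -
  define N where "N = std_normal_distribution"
  define q where "q = inv std_normal_cdf \<alpha>"
  define d where "d = \<delta> * (1 - \<alpha>) / 5"
  have d: "0 < d" using \<delta> \<alpha> by (simp add: d_def)
  define p1 where "p1 = measure N {u. s * u \<le> s * q - d / 2}"
  define p2 where "p2 = measure N {u. s * u \<le> s * q + d / 2}"
  have p: "p1 < \<alpha>" "\<alpha> < p2"
    using normal_quantile_gap[OF \<alpha> s _ N_def q_def, of "d / 2"] d by (auto simp: p1_def p2_def)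
  define e where "e = min (\<alpha> - p1) (p2 - \<alpha>)"
  have e: "0 < e" "e \<le> \<alpha> - p1" "e \<le> p2 - \<alpha>" using p by (auto simp: e_def)
  \<comment> \<open>R is fixed before \<tau>, because the truncation level grows with R and
    multiplies \<tau>.\<close>
  have "((\<lambda>R. A * K / R powr \<gamma>) \<longlongrightarrow> 0) at_top" "((\<lambda>R. s / R) \<longlongrightarrow> 0) at_top"
    using \<gamma> by real_asymp+
  then have "eventually (\<lambda>R. A * K / R powr \<gamma> < d) at_top" "eventually (\<lambda>R. s / R < d) at_top"
    using d by (auto dest: order_tendstoD)
  then have "eventually (\<lambda>R. 0 < R \<and> A * K / R powr \<gamma> < d \<and> s / R < d) at_top"
    using eventually_gt_at_top[of "0::real"] by eventually_elim simp
  then obtain R where R: "0 < R" "A * K / R powr \<gamma> \<le> d" "s / R \<le> d"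
    by (auto dest!: eventually_happens'[OF trivial_limit_at_top_linorder] intro: less_imp_le)
  define C where "C = 2 * (B + s * \<bar>q\<bar> + (A + s) * R) + 1 + (B + s * \<bar>q\<bar>)"
  have "0 \<le> s * \<bar>q\<bar>" "0 \<le> (A + s) * R" using s A R by auto
  moreover have "0 < 2 * (B + x + y) + 1 + (B + x)" if "0 \<le> x" "0 \<le> y" for x y
    using that B by simp
  ultimately have C: "0 < C" unfolding C_def by blast
  \<comment> \<open>The second entries of the minima keep 2 \<tau> and 2 \<eta> (1 + K) / d below e
    / 4 each, half of the quantile gap e together; the first entries serve the budget d.\<close>
  define \<tau> where "\<tau> = min (d / C) (e / 8)"
  define \<eta> where "\<eta> = min (d / (1 + K)) (e * d / (8 * (1 + K)))"
  have \<tau>: "0 < \<tau>" "C * \<tau> \<le> d" "\<tau> \<le> e / 8"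
  proof -
    show "0 < \<tau>" using C d e by (simp add: \<tau>_def)
    have "C * \<tau> \<le> C * (d / C)" using C by (intro mult_left_mono) (auto simp: \<tau>_def)
    then show "C * \<tau> \<le> d" using C by simp
    show "\<tau> \<le> e / 8" unfolding \<tau>_def by (rule min.cobounded2)
  qed
  have \<eta>: "0 < \<eta>" "\<eta> * (1 + K) \<le> d" "2 * \<eta> * (1 + K) / d \<le> e / 4"
  proof -
    show "0 < \<eta>" using K d e by (simp add: \<eta>_def)
    have "\<eta> \<le> d / (1 + K)" "\<eta> \<le> e * d / (8 * (1 + K))" by (auto simp: \<eta>_def)
    then show "\<eta> * (1 + K) \<le> d" "2 * \<eta> * (1 + K) / d \<le> e / 4" using K d by (auto simp: field_simps)
  qed
  have lo: "p1 + 2 * \<tau> + 2 * \<eta> * (1 + K) / d < \<alpha>" and hi: "\<alpha> \<le> p2 - 2 * \<tau> - 2 * \<eta> * (1 + K) / d"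
    using \<tau> \<eta> e by linarith+
  have d5: "5 * d / (1 - \<alpha>) = \<delta>" using \<alpha> by (simp add: d_def)
  show thesis
  proof (rule that[OF \<tau>(1) \<eta>(1)], goal_cases)
    case (1 Q X W \<zeta> F m V)
    show ?case
      unfolding d5[symmetric] q_def[symmetric]
      by (rule superquantile_close_explicit[OF \<alpha> K B A \<gamma> s \<tau>(1) \<eta>(1) R(1) N_def q_def 1(1-6) _ _ _ _ 1(11-15)
            d lo[unfolded p1_def] hi[unfolded p2_def] R(2,3) \<tau>(2)[unfolded C_def] \<eta>(2)])
        (fact 1(7)[folded N_def] 1(8-10))+
  qed
qed

section \<open>Independent blocks of observations\<close>

lemma nn_integral_PiM_restrict:
  assumes M: "prob_space M" and [measurable]: "u \<in> borel_measurable (Pi\<^sub>M {..<n} (\<lambda>_. M))"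
  shows "(\<integral>\<^sup>+\<omega>. u (restrict \<omega> {..<n}) \<partial>Pi\<^sub>M (UNIV :: nat set) (\<lambda>_. M)) = (\<integral>\<^sup>+y. u y \<partial>Pi\<^sub>M {..<n} (\<lambda>_. M))"
proof -
  interpret sequence_space M
    using M by (simp add: sequence_space_def product_prob_spaceI)
  have "(\<integral>\<^sup>+y. u y \<partial>Pi\<^sub>M {..<n} (\<lambda>_. M)) = (\<integral>\<^sup>+y. u y \<partial>distr (Pi\<^sub>M (UNIV :: nat set) (\<lambda>_. M)) (Pi\<^sub>M {..<n} (\<lambda>_. M)) (\<lambda>x. restrict x {..<n}))"
    by (subst distr_PiM_restrict_finite) auto
  also have "\<dots> = (\<integral>\<^sup>+\<omega>. u (restrict \<omega> {..<n}) \<partial>Pi\<^sub>M (UNIV :: nat set) (\<lambda>_. M))"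
    by (rule nn_integral_distr) (auto intro!: measurable_restrict_subset)
  finally show ?thesis by simp
qed

lemma measurable_PiM_shift:
  "(\<lambda>\<omega> j. \<omega> (i + j)) \<in> measurable (Pi\<^sub>M (UNIV :: nat set) (\<lambda>_. M)) (Pi\<^sub>M (UNIV :: nat set) (\<lambda>_. M))"
proof -
  have "(\<lambda>\<omega>. \<lambda>j\<in>UNIV. \<omega> (i + j)) \<in> measurable (Pi\<^sub>M (UNIV :: nat set) (\<lambda>_. M)) (Pi\<^sub>M (UNIV :: nat set) (\<lambda>_. M))"
    by (rule measurable_restrict) measurable
  then show ?thesis by (simp add: restrict_def)
qed

text \<open>The first i observations are independent of the shifted sequence, which has the original
  law; \<open>PiM_comb_seq\<close> expresses this by gluing two independent sequences.\<close>

lemma nn_integral_PiM_split: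
  assumes M: "prob_space M" and u: "u \<in> borel_measurable (Pi\<^sub>M {..<i} (\<lambda>_. M))"
    and w: "w \<in> borel_measurable (Pi\<^sub>M (UNIV :: nat set) (\<lambda>_. M))"
  shows "(\<integral>\<^sup>+\<omega>. u (restrict \<omega> {..<i}) * w (\<lambda>j. \<omega> (i + j)) \<partial>Pi\<^sub>M (UNIV :: nat set) (\<lambda>_. M)) =
    (\<integral>\<^sup>+y. u y \<partial>Pi\<^sub>M {..<i} (\<lambda>_. M)) * (\<integral>\<^sup>+\<omega>. w \<omega> \<partial>Pi\<^sub>M (UNIV :: nat set) (\<lambda>_. M))"
proof -
  interpret sequence_space M
    using M by (simp add: sequence_space_def product_prob_spaceI)
  interpret SS: pair_sigma_finite S S ..
  note u[measurable] w[measurable] measurable_PiM_shift[measurable]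
  have r[measurable]: "(\<lambda>\<omega>. restrict \<omega> {..<i}) \<in> measurable S (Pi\<^sub>M {..<i} (\<lambda>_. M))"
    by (rule measurable_restrict_subset) simp
  have c[measurable]: "(\<lambda>(\<omega>, \<omega>'). comb_seq i \<omega> \<omega>') \<in> measurable (S \<Otimes>\<^sub>M S) S"
    by (rule measurable_comb_seq)
  have m: "(\<lambda>\<omega>. u (restrict \<omega> {..<i}) * w (\<lambda>j. \<omega> (i + j))) \<in> borel_measurable S"
    by (intro borel_measurable_times_ennreal measurable_compose[OF r u] measurable_compose[OF measurable_PiM_shift w])
  have e: "restrict (comb_seq i \<omega> \<omega>') {..<i} = restrict \<omega> {..<i}" "(\<lambda>j. comb_seq i \<omega> \<omega>' (i + j)) = \<omega>'" for \<omega> \<omega>' :: "nat \<Rightarrow> 'a"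
    by (auto simp: comb_seq_def restrict_def)
  have "(\<integral>\<^sup>+\<omega>. u (restrict \<omega> {..<i}) * w (\<lambda>j. \<omega> (i + j)) \<partial>S) =
      (\<integral>\<^sup>+\<omega>. u (restrict \<omega> {..<i}) * w (\<lambda>j. \<omega> (i + j)) \<partial>distr (S \<Otimes>\<^sub>M S) S (\<lambda>(\<omega>, \<omega>'). comb_seq i \<omega> \<omega>'))"
    by (simp only: PiM_comb_seq)
  also have "\<dots> = (\<integral>\<^sup>+x. u (restrict (fst x) {..<i}) * w (snd x) \<partial>(S \<Otimes>\<^sub>M S))"
    by (subst nn_integral_distr[OF c]) (simp_all only: measurable_distr_eq1 m e split_beta)
  also have "\<dots> = (\<integral>\<^sup>+\<omega>. (\<integral>\<^sup>+\<omega>'. u (restrict \<omega> {..<i}) * w \<omega>' \<partial>S) \<partial>S)"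
    by (subst nn_integral_fst[symmetric]) (use measurable_compose[OF r u] in measurable)
  also have "\<dots> = (\<integral>\<^sup>+\<omega>. u (restrict \<omega> {..<i}) \<partial>S) * (\<integral>\<^sup>+\<omega>. w \<omega> \<partial>S)"
    using measurable_compose[OF r u] by (simp add: nn_integral_cmult nn_integral_multc)
  finally show ?thesis by (simp add: nn_integral_PiM_restrict[OF M u])
qed

text \<open>The shift by one keeps the first observation out of all blocks.\<close>

definition block_weight :: "((nat \<Rightarrow> 'a) \<Rightarrow> ennreal) \<Rightarrow> nat \<Rightarrow> nat \<Rightarrow> (nat \<Rightarrow> 'a) \<Rightarrow> ennreal" where
  "block_weight c k m y = (\<Prod>j<m. c (\<lambda>i\<in>{..<k}. y (1 + j * k + i)))"

lemma block_index: "j < m \<Longrightarrow> i < k \<Longrightarrow> 1 + j * k + i < 1 + m * (k::nat)"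
proof -
  assume "j < m" "i < k"
  then have "j * k + i < Suc j * k" "Suc j * k \<le> m * k"
    by (simp, intro mult_le_mono1, simp)
  then show ?thesis by linarith
qed

lemma measurable_block_weight:
  assumes [measurable]: "c \<in> borel_measurable (Pi\<^sub>M {..<k} (\<lambda>_. M))" and I: "{..<1 + m * k} \<subseteq> I"
  shows "block_weight c k m \<in> borel_measurable (Pi\<^sub>M I (\<lambda>_. M))"
proof -
  have "(\<lambda>y. \<lambda>i\<in>{..<k}. y (1 + j * k + i)) \<in> measurable (Pi\<^sub>M I (\<lambda>_. M)) (Pi\<^sub>M {..<k} (\<lambda>_. M))" if "j < m" for j
    using block_index[OF that, of _ k] I by (intro measurable_restrict measurable_component_singleton) auto
  then have "(\<lambda>y. c (\<lambda>i\<in>{..<k}. y (1 + j * k + i))) \<in> borel_measurable (Pi\<^sub>M I (\<lambda>_. M))" if "j < m" for j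
    using that by (intro measurable_compose[OF _ assms(1)]) auto
  then show ?thesis unfolding block_weight_def[abs_def] by (intro borel_measurable_prod_ennreal) auto
qed

lemma block_weight_restrict: "1 + m * k \<le> n \<Longrightarrow> block_weight c k m (restrict \<omega> {..<n}) = block_weight c k m \<omega>"
  unfolding block_weight_def
  by (intro prod.cong refl arg_cong[where f=c] restrict_ext) (use block_index[of _ m _ k] in fastforce)

text \<open>Induction on the number of blocks: the last block is independent of everything before
  it.\<close>

lemma nn_integral_blocks:
  assumes M: "prob_space M" and u[measurable]: "u \<in> borel_measurable (Pi\<^sub>M {..<1} (\<lambda>_. M))"
    and c[measurable]: "c \<in> borel_measurable (Pi\<^sub>M {..<k} (\<lambda>_. M))"
  shows "(\<integral>\<^sup>+\<omega>. u (restrict \<omega> {..<1}) * block_weight c k m \<omega> \<partial>Pi\<^sub>M (UNIV :: nat set) (\<lambda>_. M)) =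
    (\<integral>\<^sup>+y. u y \<partial>Pi\<^sub>M {..<1} (\<lambda>_. M)) * (\<integral>\<^sup>+y. c y \<partial>Pi\<^sub>M {..<k} (\<lambda>_. M)) ^ m"
proof (induction m)
  case 0
  show ?case unfolding block_weight_def by (simp only: nn_integral_PiM_restrict[OF M u] lessThan_0 prod.empty mult_1_right power_0)
next
  case (Suc m)
  let ?i = "1 + m * k"
  define u' where "u' y = u (restrict y {..<1}) * block_weight c k m y" for y
  have r: "(\<lambda>\<omega>. restrict \<omega> {..<1}) \<in> measurable (Pi\<^sub>M {..<?i} (\<lambda>_. M)) (Pi\<^sub>M {..<1} (\<lambda>_. M))"
    by (rule measurable_restrict_subset) auto
  have u': "u' \<in> borel_measurable (Pi\<^sub>M {..<?i} (\<lambda>_. M))"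
    unfolding u'_def using measurable_compose[OF r u] measurable_block_weight[OF c]
    by (intro borel_measurable_times_ennreal) auto
  have rk: "(\<lambda>\<omega>. restrict \<omega> {..<k}) \<in> measurable (Pi\<^sub>M UNIV (\<lambda>_. M)) (Pi\<^sub>M {..<k} (\<lambda>_. M))"
    by (rule measurable_restrict_subset) auto
  \<comment> \<open>The earlier factors depend on the first 1 + m k observations only, which is the
    form that the splitting lemma expects.\<close>
  have u'r: "u' (restrict \<omega> {..<?i}) = u (restrict \<omega> {..<1}) * block_weight c k m \<omega>" for \<omega> :: "nat \<Rightarrow> 'a"
  proof -
    have "{..<?i} \<inter> {..<1} = {..<1}" by auto
    then show ?thesis
      unfolding u'_def by (subst block_weight_restrict) (simp_all only: restrict_restrict order.refl)
  qed
  have "(\<integral>\<^sup>+\<omega>. u (restrict \<omega> {..<1}) * block_weight c k (Suc m) \<omega> \<partial>Pi\<^sub>M (UNIV :: nat set) (\<lambda>_. M)) =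
      (\<integral>\<^sup>+\<omega>. u' (restrict \<omega> {..<?i}) * c (restrict (\<lambda>j. \<omega> (?i + j)) {..<k}) \<partial>Pi\<^sub>M (UNIV :: nat set) (\<lambda>_. M))"
    unfolding u'r by (simp add: block_weight_def mult.assoc)
  also have "\<dots> = (\<integral>\<^sup>+y. u' y \<partial>Pi\<^sub>M {..<?i} (\<lambda>_. M)) * (\<integral>\<^sup>+\<omega>. c (restrict \<omega> {..<k}) \<partial>Pi\<^sub>M (UNIV :: nat set) (\<lambda>_. M))"
    by (rule nn_integral_PiM_split[OF M u' measurable_compose[OF rk c]])
  also have "(\<integral>\<^sup>+y. u' y \<partial>Pi\<^sub>M {..<?i} (\<lambda>_. M)) = (\<integral>\<^sup>+\<omega>. u (restrict \<omega> {..<1}) * block_weight c k m \<omega> \<partial>Pi\<^sub>M (UNIV :: nat set) (\<lambda>_. M))"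
    unfolding u'r[symmetric] by (rule nn_integral_PiM_restrict[OF M u', symmetric])
  also have "(\<integral>\<^sup>+\<omega>. c (restrict \<omega> {..<k}) \<partial>Pi\<^sub>M (UNIV :: nat set) (\<lambda>_. M)) = (\<integral>\<^sup>+y. c y \<partial>Pi\<^sub>M {..<k} (\<lambda>_. M))"
    by (rule nn_integral_PiM_restrict[OF M c])
  finally show ?case unfolding Suc.IH by (simp only: mult.assoc power_Suc2)
qed

text \<open>Passes from the likelihood ratio of one observation to that of a sample, for which
  \<open>p n\<close> offers no factorisation.\<close>

lemma PiM_density:
  assumes M: "prob_space M" and D[measurable]: "D \<in> borel_measurable M" and MD: "prob_space (density M D)" and I: "finite I"
  shows "Pi\<^sub>M I (\<lambda>_. density M D) = density (Pi\<^sub>M I (\<lambda>_. M)) (\<lambda>y. \<Prod>i\<in>I. D (y i))"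
proof -
  interpret A: product_sigma_finite "\<lambda>_. density M D"
    by (simp add: product_sigma_finite_def MD prob_space_imp_sigma_finite)
  interpret B: product_sigma_finite "\<lambda>_. M"
    by (simp add: product_sigma_finite_def M prob_space_imp_sigma_finite)
  show ?thesis
  proof (rule A.PiM_eqI[OF I, symmetric])
    show "sets (density (Pi\<^sub>M I (\<lambda>_. M)) (\<lambda>y. \<Prod>i\<in>I. D (y i))) = sets (Pi\<^sub>M I (\<lambda>_. density M D))"
      by (simp cong: sets_PiM_cong)
    fix E assume E: "\<And>i. i \<in> I \<Longrightarrow> E i \<in> sets (density M D)"
    then have E': "\<And>i. i \<in> I \<Longrightarrow> E i \<in> sets M" by simp
    have EI: "Pi\<^sub>E I E \<in> sets (Pi\<^sub>M I (\<lambda>_. M))" using I E' by (rule sets_PiM_I_finite)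
    have "emeasure (density (Pi\<^sub>M I (\<lambda>_. M)) (\<lambda>y. \<Prod>i\<in>I. D (y i))) (Pi\<^sub>E I E) =
        (\<integral>\<^sup>+y. (\<Prod>i\<in>I. D (y i)) * indicator (Pi\<^sub>E I E) y \<partial>Pi\<^sub>M I (\<lambda>_. M))"
      using EI by (intro emeasure_density borel_measurable_prod_ennreal measurable_compose[OF _ D] measurable_component_singleton) auto
    also have "\<dots> = (\<integral>\<^sup>+y. (\<Prod>i\<in>I. D (y i) * indicator (E i) (y i)) \<partial>Pi\<^sub>M I (\<lambda>_. M))"
    proof (rule nn_integral_cong)
      fix y assume "y \<in> space (Pi\<^sub>M I (\<lambda>_. M))"
      then have ext: "y \<in> extensional I" by (simp add: space_PiM PiE_def)
      have "indicator (Pi\<^sub>E I E) y = (\<Prod>i\<in>I. indicator (E i) (y i) :: ennreal)"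
        using I ext by (auto simp: indicator_def PiE_def Pi_def prod_zero_iff intro!: prod.neutral)
      then show "(\<Prod>i\<in>I. D (y i)) * indicator (Pi\<^sub>E I E) y = (\<Prod>i\<in>I. D (y i) * indicator (E i) (y i))"
        by (simp add: prod.distrib)
    qed
    also have "\<dots> = (\<Prod>i\<in>I. \<integral>\<^sup>+x. D x * indicator (E i) x \<partial>M)"
      using E' by (subst B.product_nn_integral_prod[OF I, of "\<lambda>i x. D x * indicator (E i) x"]) auto
    also have "\<dots> = (\<Prod>i\<in>I. emeasure (density M D) (E i))"
      using E' by (intro prod.cong refl) (simp add: emeasure_density)
    finally show "emeasure (density (Pi\<^sub>M I (\<lambda>_. M)) (\<lambda>y. \<Prod>i\<in>I. D (y i))) (Pi\<^sub>E I E) = (\<Prod>i\<in>I. emeasure (density M D) (E i))" .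
  qed
qed

section \<open>Posterior concentration\<close>

text \<open>On [0, 1] a convex function lies below its chord. The bounds are affine in the test, so
  means of the weights are controlled by the mean of the test.\<close>

lemma four_powr_le:
  fixes x :: real
  assumes "0 \<le> x" "x \<le> 1"
  shows "4 powr (- x) \<le> 1 / 4 + 3 / 4 * (1 - x)" "4 powr x \<le> 1 + 3 * x"
proof -
  have c: "convex_on UNIV (exp :: real \<Rightarrow> real)" using convex_on_exp[of 1] by simp
  show "4 powr (- x) \<le> 1 / 4 + 3 / 4 * (1 - x)"
    using convex_onD[OF c assms, of 0 "- ln 4"] by (simp add: powr_def exp_minus diff_divide_distrib)
  show "4 powr x \<le> 1 + 3 * x"
    using convex_onD[OF c assms, of 0 "ln 4"] by (simp add: powr_def)
qed

lemma emeasure_le_nn_integral: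
  assumes "u \<in> borel_measurable M"
  shows "emeasure M {x \<in> space M. 1 \<le> u x} \<le> (\<integral>\<^sup>+x. u x \<partial>M)"
proof -
  have m: "{x \<in> space M. 1 \<le> u x} \<in> sets M" using assms by measurable
  have "emeasure M {x \<in> space M. 1 \<le> u x} = (\<integral>\<^sup>+x. indicator {x \<in> space M. 1 \<le> u x} x \<partial>M)"
    using m by simp
  also have "\<dots> \<le> (\<integral>\<^sup>+x. u x \<partial>M)"
    by (intro nn_integral_mono) (auto simp: indicator_def)
  finally show ?thesis .
qed

section \<open>Dominated models\<close>

text \<open>Each \<open>\<nu> n\<close> is an arbitrary sigma-finite measure, not a power of
  \<open>\<nu> 1\<close>; the product structure is in the laws alone.\<close>

locale dominated_model =
  fixes \<pi> :: "'t measure" and S :: "'a measure" and P :: "'t \<Rightarrow> 'a measure"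
    and \<nu> :: "nat \<Rightarrow> (nat \<Rightarrow> 'a) measure" and p :: "nat \<Rightarrow> 't \<Rightarrow> (nat \<Rightarrow> 'a) \<Rightarrow> real" and \<theta>c :: 't
  assumes prior: "prob_space \<pi>"
    and prob_P: "\<And>\<theta>. \<theta> \<in> space \<pi> \<Longrightarrow> prob_space (P \<theta>)"
    and sets_P: "\<And>\<theta>. \<theta> \<in> space \<pi> \<Longrightarrow> sets (P \<theta>) = sets S"
    and \<nu>: "\<And>n. n \<ge> 1 \<Longrightarrow> sigma_finite_measure (\<nu> n)"
    and sets_\<nu>: "\<And>n. n \<ge> 1 \<Longrightarrow> sets (\<nu> n) = sets (Pi\<^sub>M {..<n} (\<lambda>_. S))"
    and p_measurable: "\<And>n. n \<ge> 1 \<Longrightarrow> (\<lambda>(\<theta>, y). p n \<theta> y) \<in> borel_measurable (\<pi> \<Otimes>\<^sub>M Pi\<^sub>M {..<n} (\<lambda>_. S))"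
    and p_density: "\<And>n \<theta>. n \<ge> 1 \<Longrightarrow> \<theta> \<in> space \<pi> \<Longrightarrow> Pi\<^sub>M {..<n} (\<lambda>_. P \<theta>) = density (\<nu> n) (\<lambda>y. ennreal (p n \<theta> y))"
    and \<theta>c: "\<theta>c \<in> space \<pi>"
begin

abbreviation "pe n \<theta> y \<equiv> ennreal (p n \<theta> y)"
abbreviation Q :: "nat \<Rightarrow> (nat \<Rightarrow> 'a) measure" where "Q n \<equiv> Pi\<^sub>M {..<n} (\<lambda>_. P \<theta>c)"

definition marginal :: "nat \<Rightarrow> (nat \<Rightarrow> 'a) \<Rightarrow> ennreal" where
  "marginal n y = (\<integral>\<^sup>+\<theta>. pe n \<theta> y \<partial>\<pi>)"

sublocale prior: prob_space \<pi> by (rule prior)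

lemma sets_PiM_P: "\<theta> \<in> space \<pi> \<Longrightarrow> sets (Pi\<^sub>M I (\<lambda>_. P \<theta>)) = sets (Pi\<^sub>M I (\<lambda>_. S))"
  by (intro sets_PiM_cong refl sets_P)

lemma prob_PiM_P: "\<theta> \<in> space \<pi> \<Longrightarrow> prob_space (Pi\<^sub>M I (\<lambda>_. P \<theta>))"
  by (intro prob_space_PiM prob_P)

lemma pe_measurable2:
  assumes "n \<ge> 1" "sets N = sets (Pi\<^sub>M {..<n} (\<lambda>_. S))"
  shows "(\<lambda>x. pe n (fst x) (snd x)) \<in> borel_measurable (\<pi> \<Otimes>\<^sub>M N)"
proof -
  have "(\<lambda>(\<theta>, y). p n \<theta> y) \<in> borel_measurable (\<pi> \<Otimes>\<^sub>M N)"
    using p_measurable[OF assms(1)] by (subst measurable_cong_sets[OF sets_pair_measure_cong[OF refl assms(2)] refl])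
  then show ?thesis by (simp add: split_beta')
qed

lemma pe_measurable:
  assumes "n \<ge> 1" "sets N = sets (Pi\<^sub>M {..<n} (\<lambda>_. S))"
  shows "\<theta> \<in> space \<pi> \<Longrightarrow> pe n \<theta> \<in> borel_measurable N" "y \<in> space N \<Longrightarrow> (\<lambda>\<theta>. pe n \<theta> y) \<in> borel_measurable \<pi>"
  using measurable_compose[OF measurable_Pair1' pe_measurable2[OF assms], of \<theta>]
    measurable_compose[OF measurable_Pair2' pe_measurable2[OF assms], of y] by auto

lemma integral_component:
  assumes "\<theta> \<in> space \<pi>" "i < n" and g: "integrable (P \<theta>) (g :: 'a \<Rightarrow> real)"
  shows "integrable (Pi\<^sub>M {..<n} (\<lambda>_. P \<theta>)) (\<lambda>y. g (y i))"
    "(\<integral>y. g (y i) \<partial>Pi\<^sub>M {..<n} (\<lambda>_. P \<theta>)) = (\<integral>x. g x \<partial>P \<theta>)"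
proof -
  have d: "distr (Pi\<^sub>M {..<n} (\<lambda>_. P \<theta>)) (P \<theta>) (\<lambda>\<omega>. \<omega> i) = P \<theta>"
    using distr_PiM_component[of "{..<n}" "\<lambda>_. P \<theta>" i] prob_P assms by auto
  have m: "(\<lambda>\<omega>. \<omega> i) \<in> measurable (Pi\<^sub>M {..<n} (\<lambda>_. P \<theta>)) (P \<theta>)"
    using assms by (intro measurable_component_singleton) auto
  show "integrable (Pi\<^sub>M {..<n} (\<lambda>_. P \<theta>)) (\<lambda>y. g (y i))"
    using integrable_distr[OF m, of g] g d by simp
  show "(\<integral>y. g (y i) \<partial>Pi\<^sub>M {..<n} (\<lambda>_. P \<theta>)) = (\<integral>x. g x \<partial>P \<theta>)"
    using integral_distr[OF m, of g] g d by simp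
qed

section \<open>Lower bound on the marginal likelihood\<close>

text \<open>L below is the log likelihood ratio of the truth against \<theta>, with mean n times the
  divergence, hence at most n \<epsilon>. Markov's inequality asks for a nonnegative variable; L +
  exp (- L) is one, and its mean is at most n \<epsilon> + 1. The bound is crude but uniform over
  the parameters within divergence \<epsilon>.\<close>

lemma likelihood_ratio_lower:
  assumes n: "n \<ge> 1" and \<theta>: "\<theta> \<in> space \<pi>" and KL: "KL_ext (P \<theta>c) (P \<theta>) < ereal \<epsilon>" and b: "0 < b" and \<epsilon>: "0 < \<epsilon>"
  shows "emeasure (Q n) {y \<in> space (Q n). pe n \<theta> y < ennreal (exp (- (n * b))) * pe n \<theta>c y} \<le> ennreal (\<epsilon> / b + 1 / (n * b))"
proof -
  interpret T: prob_space "P \<theta>c" by (rule prob_P[OF \<theta>c])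
  interpret R: prob_space "P \<theta>" by (rule prob_P[OF \<theta>])
  interpret Qn: prob_space "Q n" by (rule prob_PiM_P[OF \<theta>c])
  interpret \<nu>: sigma_finite_measure "\<nu> n" by (rule \<nu>[OF n])
  have ac: "absolutely_continuous (P \<theta>) (P \<theta>c)" and int: "integrable (P \<theta>c) (entropy_density (exp 1) (P \<theta>) (P \<theta>c))"
    and KL': "KL_divergence (exp 1) (P \<theta>) (P \<theta>c) < \<epsilon>"
    using KL by (auto simp: KL_ext_def split: if_splits)
  have sets_eq: "sets (P \<theta>c) = sets (P \<theta>)" by (simp add: sets_P \<theta> \<theta>c)
  \<comment> \<open>A real-valued version of the derivative, positive almost surely under the truth,
    so that logarithm and reciprocal make sense.\<close>
  obtain D where D[measurable]: "D \<in> borel_measurable (P \<theta>)" and RN: "AE x in P \<theta>. RN_deriv (P \<theta>) (P \<theta>c) x = ennreal (D x)"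
    and Dpos: "AE x in P \<theta>c. 0 < D x" and D0: "\<And>x. 0 \<le> D x"
    using R.real_RN_deriv[OF T.finite_measure_axioms ac sets_eq] by blast
  have [measurable]: "D \<in> borel_measurable (P \<theta>c)" using D sets_eq by (simp cong: measurable_cong_sets)
  have dens: "P \<theta>c = density (P \<theta>) (\<lambda>x. ennreal (D x))"
  proof -
    have "density (P \<theta>) (RN_deriv (P \<theta>) (P \<theta>c)) = P \<theta>c" by (rule R.density_RN_deriv[OF ac sets_eq])
    moreover have "density (P \<theta>) (RN_deriv (P \<theta>) (P \<theta>c)) = density (P \<theta>) (\<lambda>x. ennreal (D x))"
      using RN by (intro density_cong) auto
    ultimately show ?thesis by simp
  qed
  have "AE x in P \<theta>c. RN_deriv (P \<theta>) (P \<theta>c) x = ennreal (D x)"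
    by (subst dens, subst AE_density) (use RN in auto)
  then have ed: "AE x in P \<theta>c. entropy_density (exp 1) (P \<theta>) (P \<theta>c) x = ln (D x)"
    by eventually_elim (simp add: entropy_density_def log_def D0)
  have em: "entropy_density (exp 1) (P \<theta>) (P \<theta>c) \<in> borel_measurable (P \<theta>c)" using int by auto
  have intL: "integrable (P \<theta>c) (\<lambda>x. ln (D x))"
    using integrable_cong_AE_imp[OF int _ ed] by (auto simp: eq_commute)
  have "(\<integral>x. ln (D x) \<partial>P \<theta>c) = KL_divergence (exp 1) (P \<theta>) (P \<theta>c)"
    unfolding KL_divergence_def by (rule integral_cong_AE[OF _ em]) (use ed in \<open>auto simp: eq_commute\<close>)
  with KL' have IL: "(\<integral>x. ln (D x) \<partial>P \<theta>c) \<le> \<epsilon>" by simp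
  \<comment> \<open>The product of D and 1 / D is 1, or 0 where D vanishes; hence only an
    inequality.\<close>
  have inv1: "(\<integral>\<^sup>+x. ennreal (1 / D x) \<partial>P \<theta>c) \<le> 1"
  proof -
    have "(\<integral>\<^sup>+x. ennreal (1 / D x) \<partial>P \<theta>c) = (\<integral>\<^sup>+x. ennreal (D x) * ennreal (1 / D x) \<partial>P \<theta>)"
      by (subst dens, subst nn_integral_density) auto
    also have "\<dots> \<le> (\<integral>\<^sup>+x. 1 \<partial>P \<theta>)"
      using D0 by (intro nn_integral_mono) (auto simp: ennreal_mult'[symmetric])
    finally show ?thesis by (simp add: R.emeasure_space_1)
  qed
  interpret PS: product_sigma_finite "\<lambda>_::nat. P \<theta>c"
    by (simp add: product_sigma_finite_def T.sigma_finite_measure_axioms)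
  have comp: "(\<lambda>y. D (y i)) \<in> borel_measurable (Q n)" if "i < n" for i
    using that by (intro measurable_compose[OF measurable_component_singleton]) auto
  have inv_n: "(\<integral>\<^sup>+y. (\<Prod>i<n. ennreal (1 / D (y i))) \<partial>Q n) \<le> 1"
  proof -
    have "(\<integral>\<^sup>+y. (\<Prod>i<n. ennreal (1 / D (y i))) \<partial>Q n) = (\<Prod>i<n. \<integral>\<^sup>+x. ennreal (1 / D x) \<partial>P \<theta>c)"
      by (rule PS.product_nn_integral_prod) auto
    also have "\<dots> = (\<integral>\<^sup>+x. ennreal (1 / D x) \<partial>P \<theta>c) ^ n" by simp
    also have "\<dots> \<le> 1"
    proof (induction n)
      case (Suc n)
      then show ?case using mult_mono[OF inv1 Suc] by simp
    qed simp
    finally show ?thesis .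
  qed
  define L where "L y = (\<Sum>i<n. ln (D (y i)))" for y :: "nat \<Rightarrow> 'a"
  have Lint: "integrable (Q n) L"
    unfolding L_def using integral_component(1)[OF \<theta>c _ intL] by (intro Bochner_Integration.integrable_sum) auto
  have LI: "(\<integral>y. L y \<partial>Q n) \<le> n * \<epsilon>"
  proof -
    have "(\<integral>y. L y \<partial>Q n) = (\<Sum>i<n. \<integral>x. ln (D x) \<partial>P \<theta>c)"
    proof -
      have "(\<integral>y. L y \<partial>Q n) = (\<Sum>i<n. \<integral>y. ln (D (y i)) \<partial>Q n)"
        unfolding L_def using integral_component(1)[OF \<theta>c _ intL] by (intro Bochner_Integration.integral_sum) auto
      also have "\<dots> = (\<Sum>i<n. \<integral>x. ln (D x) \<partial>P \<theta>c)"
        using integral_component(2)[OF \<theta>c _ intL] by (intro sum.cong) auto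
      finally show ?thesis .
    qed
    then show ?thesis using IL by (simp add: mult_left_mono)
  qed
  have AEpos: "AE y in Q n. \<forall>i<n. 0 < D (y i)"
  proof -
    have "AE y in Q n. \<forall>i\<in>{..<n}. 0 < D (y i)"
      by (intro eventually_ball_finite ballI AE_PiM_component) (use Dpos prob_P[OF \<theta>c] in auto)
    then show ?thesis by (simp only: Ball_def lessThan_iff)
  qed
  have expL: "AE y in Q n. ennreal (exp (- L y)) = (\<Prod>i<n. ennreal (1 / D (y i)))"
    using AEpos
  proof eventually_elim
    case (elim y)
    have "exp (- L y) = (\<Prod>i<n. 1 / D (y i))"
      unfolding L_def sum_negf[symmetric] using elim by (subst exp_sum) (auto simp: exp_minus inverse_eq_divide)
    then show ?case using D0 by (simp add: prod_ennreal)
  qed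
  have Lm[measurable]: "L \<in> borel_measurable (Q n)" using Lint by auto
  have Enn: "(\<integral>\<^sup>+y. ennreal (exp (- L y)) \<partial>Q n) \<le> 1"
    using inv_n nn_integral_cong_AE[OF expL] by simp
  have Eint: "integrable (Q n) (\<lambda>y. exp (- L y))"
    using Enn by (intro integrableI_bounded) (auto intro: le_less_trans)
  have EI: "(\<integral>y. exp (- L y) \<partial>Q n) \<le> 1"
    using Enn nn_integral_eq_integral[OF Eint] by simp
  \<comment> \<open>The sample law of the truth is written in two ways as a density over
    \<open>\<nu> n\<close>; uniqueness of densities then ties \<open>p n \<theta>c\<close> to
    \<open>p n \<theta>\<close> almost everywhere.\<close>
  have "density (\<nu> n) (pe n \<theta>c) = Q n" by (rule p_density[OF n \<theta>c, symmetric])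
  also have "\<dots> = density (Pi\<^sub>M {..<n} (\<lambda>_. P \<theta>)) (\<lambda>y. \<Prod>i<n. ennreal (D (y i)))"
    using PiM_density[OF R.prob_space_axioms, of "\<lambda>x. ennreal (D x)" "{..<n}"] T.prob_space_axioms by (simp flip: dens)
  also have "\<dots> = density (\<nu> n) (\<lambda>y. pe n \<theta> y * (\<Prod>i<n. ennreal (D (y i))))"
    unfolding p_density[OF n \<theta>]
  proof (rule density_density_eq)
    have "(\<lambda>y. D (y i)) \<in> borel_measurable (\<nu> n)" if "i < n" for i
      using comp[OF that] sets_\<nu>[OF n] sets_PiM_P[OF \<theta>c, of "{..<n}"] by (simp cong: measurable_cong_sets)
    then show "(\<lambda>y. \<Prod>i<n. ennreal (D (y i))) \<in> borel_measurable (\<nu> n)" by measurable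
    show "pe n \<theta> \<in> borel_measurable (\<nu> n)" by (rule pe_measurable(1)[OF n sets_\<nu>[OF n] \<theta>])
  qed
  finally have deq: "density (\<nu> n) (pe n \<theta>c) = density (\<nu> n) (\<lambda>y. pe n \<theta> y * (\<Prod>i<n. ennreal (D (y i))))" .
  have mcomp: "(\<lambda>y. D (y i)) \<in> borel_measurable (\<nu> n)" if "i < n" for i
    using comp[OF that] sets_\<nu>[OF n] sets_PiM_P[OF \<theta>c, of "{..<n}"] by (simp cong: measurable_cong_sets)
  have mc: "pe n \<theta> \<in> borel_measurable (\<nu> n)" "pe n \<theta>c \<in> borel_measurable (\<nu> n)"
    using pe_measurable(1)[OF n sets_\<nu>[OF n]] \<theta> \<theta>c by auto
  have "AE y in \<nu> n. pe n \<theta>c y = pe n \<theta> y * (\<Prod>i<n. ennreal (D (y i)))"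
    by (rule \<nu>.density_unique[OF _ _ deq]) (use mcomp mc in measurable)
  then have ratio: "AE y in Q n. pe n \<theta>c y = pe n \<theta> y * (\<Prod>i<n. ennreal (D (y i)))"
    unfolding p_density[OF n \<theta>c] by (subst AE_density) (use mc in auto)
  let ?B = "{y \<in> space (Q n). pe n \<theta> y < ennreal (exp (- (n * b))) * pe n \<theta>c y}"
  have Bm: "?B \<in> sets (Q n)"
  proof -
    have "pe n \<theta> \<in> borel_measurable (Q n)" "pe n \<theta>c \<in> borel_measurable (Q n)"
      using pe_measurable(1)[OF n sets_PiM_P[OF \<theta>c]] \<theta> \<theta>c by auto
    then show ?thesis by measurable
  qed
  have nb: "0 < n * b" using n b by simp
  have "emeasure (Q n) ?B = (\<integral>\<^sup>+y. indicator ?B y \<partial>Q n)" using Bm by simp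
  \<comment> \<open>On the event L is at least n b: a smaller L would keep
    \<open>pe n \<theta> y\<close> above exp (- n b) times the true density.\<close>
  also have "\<dots> \<le> (\<integral>\<^sup>+y. ennreal ((L y + exp (- L y)) / (n * b)) \<partial>Q n)"
  proof (rule nn_integral_mono_AE, use ratio expL AEpos in eventually_elim)
    case (elim y)
    show ?case
    proof (cases "y \<in> ?B")
      case True
      have prod: "(\<Prod>i<n. ennreal (D (y i))) = ennreal (exp (L y))"
      proof -
        have "exp (L y) = (\<Prod>i<n. D (y i))" unfolding L_def using elim(3) by (subst exp_sum) auto
        then show ?thesis using D0 by (simp add: prod_ennreal)
      qed
      have "n * b \<le> L y"
      proof (rule ccontr)
        assume "\<not> n * b \<le> L y"
        then have "exp (- (n * b)) * exp (L y) \<le> 1" by (simp flip: exp_add)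
        then have "ennreal (exp (- (n * b))) * ennreal (exp (L y)) \<le> 1" by (simp flip: ennreal_mult)
        then have "pe n \<theta> y * (ennreal (exp (- (n * b))) * ennreal (exp (L y))) \<le> pe n \<theta> y * 1" by (intro mult_left_mono) auto
        then have "ennreal (exp (- (n * b))) * pe n \<theta>c y \<le> pe n \<theta> y" unfolding elim(1) prod by (simp add: mult_ac)
        with True show False by auto
      qed
      moreover have "0 < exp (- L y)" by simp
      ultimately have "n * b \<le> L y + exp (- L y)" by linarith
      then have "1 \<le> (L y + exp (- L y)) / (n * b)" using nb by simp
      then show ?thesis using True by simp
    qed simp
  qed
  also have "\<dots> = ennreal (\<integral>y. (L y + exp (- L y)) / (n * b) \<partial>Q n)"
  proof (rule nn_integral_eq_integral)
    show "integrable (Q n) (\<lambda>y. (L y + exp (- L y)) / (n * b))" using Lint Eint by simp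
    have "0 \<le> (L y + exp (- L y)) / (n * b)" for y
      using exp_ge_add_one_self[of "- L y"] nb exp_gt_zero[of "- L y"] by (cases "L y \<ge> 0") (auto intro!: divide_nonneg_pos simp: add_nonneg_pos less_imp_le intro: order_trans)
    then show "AE y in Q n. 0 \<le> (L y + exp (- L y)) / (n * b)" by simp
  qed
  also have "(\<integral>y. (L y + exp (- L y)) / (n * b) \<partial>Q n) = ((\<integral>y. L y \<partial>Q n) + (\<integral>y. exp (- L y) \<partial>Q n)) / (n * b)"
    using Lint Eint by simp
  also have "\<dots> \<le> (n * \<epsilon> + 1) / (n * b)" using LI EI nb by (intro divide_right_mono add_mono) auto
  also have "\<dots> = \<epsilon> / b + 1 / (n * b)" using n by (simp add: add_divide_distrib)
  finally show ?thesis by (simp add: ennreal_leI)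
qed

lemma marginal_measurable:
  assumes "n \<ge> 1" "sets N = sets (Pi\<^sub>M {..<n} (\<lambda>_. S))" and f[measurable]: "f \<in> borel_measurable \<pi>"
  shows "(\<lambda>y. \<integral>\<^sup>+\<theta>. f \<theta> * pe n \<theta> y \<partial>\<pi>) \<in> borel_measurable N"
proof -
  note pe_measurable2[OF assms(1,2), measurable]
  have "(\<lambda>(y, \<theta>). f \<theta> * pe n \<theta> y) \<in> borel_measurable (N \<Otimes>\<^sub>M \<pi>)"
  proof -
    have "(\<lambda>x. pe n (fst (snd x, fst x)) (snd (snd x, fst x))) \<in> borel_measurable (N \<Otimes>\<^sub>M \<pi>)"
      by (rule measurable_compose[OF _ pe_measurable2[OF assms(1,2)]]) measurable
    then show ?thesis by (simp add: split_beta')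
  qed
  then show ?thesis by measurable
qed

lemma marginal_measurable':
  assumes "n \<ge> 1" "sets N = sets (Pi\<^sub>M {..<n} (\<lambda>_. S))" shows "marginal n \<in> borel_measurable N"
  using marginal_measurable[OF assms, of "\<lambda>_. 1"] by (simp add: marginal_def[abs_def])

text \<open>Tonelli, after which the density is read back into the law of the sample; from then on
  the product structure is available.\<close>

lemma nn_integral_swap:
  assumes n: "n \<ge> 1" and f[measurable]: "f \<in> borel_measurable \<pi>"
    and h[measurable]: "h \<in> borel_measurable (Pi\<^sub>M {..<n} (\<lambda>_. S))"
  shows "(\<integral>\<^sup>+y. h y * (\<integral>\<^sup>+\<theta>. f \<theta> * pe n \<theta> y \<partial>\<pi>) \<partial>\<nu> n) =
    (\<integral>\<^sup>+\<theta>. f \<theta> * (\<integral>\<^sup>+y. h y \<partial>Pi\<^sub>M {..<n} (\<lambda>_. P \<theta>)) \<partial>\<pi>)"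
proof -
  interpret \<nu>: sigma_finite_measure "\<nu> n" by (rule \<nu>[OF n])
  interpret pair_sigma_finite \<pi> "\<nu> n" ..
  have [measurable]: "h \<in> borel_measurable (\<nu> n)" using h sets_\<nu>[OF n] by (simp cong: measurable_cong_sets)
  note pe_measurable2[OF n sets_\<nu>[OF n], measurable]
  have "(\<integral>\<^sup>+y. h y * (\<integral>\<^sup>+\<theta>. f \<theta> * pe n \<theta> y \<partial>\<pi>) \<partial>\<nu> n) = (\<integral>\<^sup>+y. (\<integral>\<^sup>+\<theta>. f \<theta> * (h y * pe n \<theta> y) \<partial>\<pi>) \<partial>\<nu> n)"
  proof (rule nn_integral_cong)
    fix y assume "y \<in> space (\<nu> n)"
    note [measurable] = pe_measurable(2)[OF n sets_\<nu>[OF n] this]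
    show "h y * (\<integral>\<^sup>+\<theta>. f \<theta> * pe n \<theta> y \<partial>\<pi>) = (\<integral>\<^sup>+\<theta>. f \<theta> * (h y * pe n \<theta> y) \<partial>\<pi>)"
      by (subst nn_integral_cmult[symmetric]) (auto simp: mult_ac)
  qed
  also have "\<dots> = (\<integral>\<^sup>+\<theta>. (\<integral>\<^sup>+y. f \<theta> * (h y * pe n \<theta> y) \<partial>\<nu> n) \<partial>\<pi>)"
    by (rule Fubini') (simp add: split_beta')
  also have "\<dots> = (\<integral>\<^sup>+\<theta>. f \<theta> * (\<integral>\<^sup>+y. h y \<partial>Pi\<^sub>M {..<n} (\<lambda>_. P \<theta>)) \<partial>\<pi>)"
  proof (rule nn_integral_cong)
    fix \<theta> assume \<theta>: "\<theta> \<in> space \<pi>"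
    note [measurable] = pe_measurable(1)[OF n sets_\<nu>[OF n] \<theta>]
    show "(\<integral>\<^sup>+y. f \<theta> * (h y * pe n \<theta> y) \<partial>\<nu> n) = f \<theta> * (\<integral>\<^sup>+y. h y \<partial>Pi\<^sub>M {..<n} (\<lambda>_. P \<theta>))"
      unfolding p_density[OF n \<theta>] by (subst nn_integral_density, simp, simp, subst nn_integral_cmult[symmetric]) (auto simp: mult_ac)
  qed
  finally show ?thesis .
qed

lemma AE_true_density_pos:
  assumes n: "n \<ge> 1" shows "AE y in Q n. 0 < pe n \<theta>c y"
  unfolding p_density[OF n \<theta>c]
  by (subst AE_density) (use pe_measurable(1)[OF n sets_\<nu>[OF n] \<theta>c] in auto)

text \<open>If the marginal is too small, parameters with a poor likelihood ratio make up at least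
  half of the prior mass of W. By Fubini the expected mass of such parameters is at most \<kappa> a,
  and Markov's inequality at a / 2 gives 2 \<kappa>.\<close>

lemma marginal_lower:
  assumes n: "n \<ge> 1" and W: "W \<in> sets \<pi>" and a: "measure \<pi> W = a" "0 < a"
    and e: "0 \<le> e" and \<kappa>: "0 \<le> \<kappa>"
    and bad: "\<And>\<theta>. \<theta> \<in> W \<Longrightarrow> emeasure (Q n) {y \<in> space (Q n). pe n \<theta> y < ennreal e * pe n \<theta>c y} \<le> ennreal \<kappa>"
  shows "emeasure (Q n) {y \<in> space (Q n). marginal n y < ennreal (e * (a / 2)) * pe n \<theta>c y} \<le> ennreal (2 * \<kappa>)"
proof -
  interpret Qn: prob_space "Q n" by (rule prob_PiM_P[OF \<theta>c])
  interpret pair_sigma_finite \<pi> "Q n" ..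
  note sQ = sets_PiM_P[OF \<theta>c, of "{..<n}"]
  note [measurable] = pe_measurable2[OF n sQ] W
  note [measurable] = pe_measurable(1)[OF n sQ \<theta>c]
  define B where "B = {x \<in> space (\<pi> \<Otimes>\<^sub>M Q n). fst x \<in> W \<and> pe n (fst x) (snd x) < ennreal e * pe n \<theta>c (snd x)}"
  have [measurable]: "B \<in> sets (\<pi> \<Otimes>\<^sub>M Q n)" unfolding B_def by measurable
  define By where "By y = {\<theta> \<in> space \<pi>. (\<theta>, y) \<in> B}" for y
  have By_sets: "By y \<in> sets \<pi>" if "y \<in> space (Q n)" for y
    unfolding By_def using that by measurable
  have By_eq: "emeasure \<pi> (By y) = (\<integral>\<^sup>+\<theta>. indicator B (\<theta>, y) \<partial>\<pi>)" if "y \<in> space (Q n)" for y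
  proof -
    have "emeasure \<pi> (By y) = (\<integral>\<^sup>+\<theta>. indicator (By y) \<theta> \<partial>\<pi>)" using By_sets[OF that] by simp
    also have "\<dots> = (\<integral>\<^sup>+\<theta>. indicator B (\<theta>, y) \<partial>\<pi>)"
      by (intro nn_integral_cong) (simp add: By_def indicator_def)
    finally show ?thesis .
  qed
  have gm: "(\<lambda>y. \<integral>\<^sup>+\<theta>. indicator B (\<theta>, y) \<partial>\<pi>) \<in> borel_measurable (Q n)" by measurable
  have "(\<integral>\<^sup>+y. (\<integral>\<^sup>+\<theta>. indicator B (\<theta>, y) \<partial>\<pi>) \<partial>Q n) = (\<integral>\<^sup>+\<theta>. (\<integral>\<^sup>+y. indicator B (\<theta>, y) \<partial>Q n) \<partial>\<pi>)"
    by (rule Fubini') (simp add: split_beta')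
  also have "\<dots> \<le> (\<integral>\<^sup>+\<theta>. ennreal \<kappa> * indicator W \<theta> \<partial>\<pi>)"
  proof (rule nn_integral_mono)
    fix \<theta> assume \<theta>: "\<theta> \<in> space \<pi>"
    show "(\<integral>\<^sup>+y. indicator B (\<theta>, y) \<partial>Q n) \<le> ennreal \<kappa> * indicator W \<theta>"
    proof (cases "\<theta> \<in> W")
      case True
      have "(\<integral>\<^sup>+y. indicator B (\<theta>, y) \<partial>Q n) = (\<integral>\<^sup>+y. indicator {y \<in> space (Q n). pe n \<theta> y < ennreal e * pe n \<theta>c y} y \<partial>Q n)"
        using True \<theta> by (intro nn_integral_cong) (auto simp: B_def indicator_def space_pair_measure)
      also have "\<dots> = emeasure (Q n) {y \<in> space (Q n). pe n \<theta> y < ennreal e * pe n \<theta>c y}"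
      proof (rule nn_integral_indicator)
        have "pe n \<theta> \<in> borel_measurable (Q n)" "pe n \<theta>c \<in> borel_measurable (Q n)"
          using pe_measurable(1)[OF n sQ] \<theta> \<theta>c by auto
        then show "{y \<in> space (Q n). pe n \<theta> y < ennreal e * pe n \<theta>c y} \<in> sets (Q n)" by measurable
      qed
      finally show ?thesis using bad[OF True] True by simp
    next
      case False
      then have "indicator B (\<theta>, y) = (0::ennreal)" for y by (simp add: B_def)
      then show ?thesis by simp
    qed
  qed
  also have "\<dots> = ennreal (\<kappa> * a)"
    using W a \<kappa> by (simp add: nn_integral_cmult prior.emeasure_eq_measure ennreal_mult)
  finally have I: "(\<integral>\<^sup>+y. (\<integral>\<^sup>+\<theta>. indicator B (\<theta>, y) \<partial>\<pi>) \<partial>Q n) \<le> ennreal (\<kappa> * a)" .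
  have "emeasure (Q n) {y \<in> space (Q n). marginal n y < ennreal (e * (a / 2)) * pe n \<theta>c y} \<le>
    emeasure (Q n) {y \<in> space (Q n). 1 \<le> ennreal (2 / a) * (\<integral>\<^sup>+\<theta>. indicator B (\<theta>, y) \<partial>\<pi>)}"
  proof (rule emeasure_mono)
    show "{y \<in> space (Q n). 1 \<le> ennreal (2 / a) * (\<integral>\<^sup>+\<theta>. indicator B (\<theta>, y) \<partial>\<pi>)} \<in> sets (Q n)"
      using gm by measurable
    show "{y \<in> space (Q n). marginal n y < ennreal (e * (a / 2)) * pe n \<theta>c y} \<subseteq> {y \<in> space (Q n). 1 \<le> ennreal (2 / a) * (\<integral>\<^sup>+\<theta>. indicator B (\<theta>, y) \<partial>\<pi>)}"
    proof safe
      fix y assume y: "y \<in> space (Q n)" and lt: "marginal n y < ennreal (e * (a / 2)) * pe n \<theta>c y"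
      note [measurable] = By_sets[OF y]
      have "By y \<subseteq> W" by (auto simp: By_def B_def)
      then have md: "measure \<pi> (W - By y) = a - measure \<pi> (By y)"
        using a by (subst prior.finite_measure_Diff) auto
      \<comment> \<open>Otherwise the good parameters, of mass at least a / 2, would already make
        the marginal large.\<close>
      have "a / 2 \<le> measure \<pi> (By y)"
      proof (rule ccontr)
        assume "\<not> a / 2 \<le> measure \<pi> (By y)"
        then have ge: "a / 2 \<le> measure \<pi> (W - By y)" using md by simp
        have "ennreal (e * (a / 2)) * pe n \<theta>c y \<le> ennreal e * pe n \<theta>c y * emeasure \<pi> (W - By y)"
        proof -
          have "ennreal (e * (a / 2)) * pe n \<theta>c y = ennreal e * pe n \<theta>c y * ennreal (a / 2)"
            using e a by (subst ennreal_mult) (auto simp: mult_ac)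
          also have "\<dots> \<le> ennreal e * pe n \<theta>c y * emeasure \<pi> (W - By y)"
            unfolding prior.emeasure_eq_measure by (intro mult_left_mono ennreal_leI ge) simp
          finally show ?thesis .
        qed
        also have "\<dots> = (\<integral>\<^sup>+\<theta>. ennreal e * pe n \<theta>c y * indicator (W - By y) \<theta> \<partial>\<pi>)"
          by (subst nn_integral_cmult) auto
        also have "\<dots> \<le> marginal n y"
          unfolding marginal_def
        proof (rule nn_integral_mono)
          fix \<theta> assume "\<theta> \<in> space \<pi>"
          then show "ennreal e * pe n \<theta>c y * indicator (W - By y) \<theta> \<le> pe n \<theta> y"
            using y by (auto simp: indicator_def By_def B_def space_pair_measure not_less)
        qed
        finally show False using lt by simp
      qed
      then have "1 \<le> 2 / a * measure \<pi> (By y)" using a by (simp add: field_simps)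
      then have "ennreal 1 \<le> ennreal (2 / a * measure \<pi> (By y))" by (rule ennreal_leI)
      also have "\<dots> = ennreal (2 / a) * (\<integral>\<^sup>+\<theta>. indicator B (\<theta>, y) \<partial>\<pi>)"
        unfolding By_eq[OF y, symmetric] prior.emeasure_eq_measure using a by (intro ennreal_mult) auto
      finally show "1 \<le> ennreal (2 / a) * (\<integral>\<^sup>+\<theta>. indicator B (\<theta>, y) \<partial>\<pi>)" by simp
    qed
  qed
  also have "\<dots> \<le> (\<integral>\<^sup>+y. ennreal (2 / a) * (\<integral>\<^sup>+\<theta>. indicator B (\<theta>, y) \<partial>\<pi>) \<partial>Q n)"
    by (rule emeasure_le_nn_integral) (use gm in measurable)
  also have "\<dots> = ennreal (2 / a) * (\<integral>\<^sup>+y. (\<integral>\<^sup>+\<theta>. indicator B (\<theta>, y) \<partial>\<pi>) \<partial>Q n)"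
    by (rule nn_integral_cmult[OF gm])
  also have "\<dots> \<le> ennreal (2 / a) * ennreal (\<kappa> * a)" by (rule mult_left_mono[OF I]) simp
  also have "\<dots> = ennreal (2 * \<kappa>)" using a \<kappa> by (simp add: ennreal_mult[symmetric])
  finally show ?thesis .
qed

section \<open>Upper bound on the posterior numerator\<close>

text \<open>Dividing by the true density turns an expectation under the truth into an integral
  against \<open>\<nu> n\<close>, and exchanging integrals gives a prior average of expectations
  under each \<theta>. There the blocks factorise and yield the power of \<rho>, while the event A
  of the first observation survives and is turned back, at sample size 1, into the numerator that
  \<open>AC\<close> bounds.\<close>

lemma numerator_upper:
  assumes F: "F \<in> sets \<pi>" and f[measurable]: "f \<in> borel_measurable \<pi>"
    and c: "c \<in> borel_measurable (Pi\<^sub>M {..<k} (\<lambda>_. S))" and n: "1 + m * k \<le> n"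
    and A: "A \<in> sets (Pi\<^sub>M {..<1} (\<lambda>_. S))"
    and AC: "\<And>y. y \<in> A \<Longrightarrow> (\<integral>\<^sup>+\<theta>. f \<theta> * pe 1 \<theta> y \<partial>\<pi>) \<le> C * pe 1 \<theta>c y"
    and \<rho>: "\<And>\<theta>. \<theta> \<in> F \<Longrightarrow> (\<integral>\<^sup>+y. c y \<partial>Pi\<^sub>M {..<k} (\<lambda>_. P \<theta>)) \<le> \<rho>"
  shows "(\<integral>\<^sup>+y. indicator A (restrict y {..<1}) * block_weight c k m y * (\<integral>\<^sup>+\<theta>. indicator F \<theta> * f \<theta> * pe n \<theta> y \<partial>\<pi>) / pe n \<theta>c y \<partial>Q n) \<le> \<rho> ^ m * C"
proof -
  have n1: "n \<ge> 1" using n by simp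
  have one: "(1::nat) \<ge> 1" by simp
  note F[measurable]
  define h where "h y = indicator A (restrict y {..<1}) * block_weight c k m y" for y
  have r1: "(\<lambda>\<omega>. restrict \<omega> {..<1}) \<in> measurable (Pi\<^sub>M {..<n} (\<lambda>_. S)) (Pi\<^sub>M {..<1} (\<lambda>_. S))"
    by (rule measurable_restrict_subset) (use n in auto)
  have iA: "(indicator A :: _ \<Rightarrow> ennreal) \<in> borel_measurable (Pi\<^sub>M {..<1} (\<lambda>_. S))" using A by measurable
  have h: "h \<in> borel_measurable (Pi\<^sub>M {..<n} (\<lambda>_. S))"
    unfolding h_def using n by (intro borel_measurable_times_ennreal measurable_compose[OF r1 iA] measurable_block_weight[OF c]) auto
  have hn: "h \<in> borel_measurable (\<nu> n)" using h sets_\<nu>[OF n1] by (simp cong: measurable_cong_sets)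
  have fF: "(\<lambda>\<theta>. indicator F \<theta> * f \<theta>) \<in> borel_measurable \<pi>" by measurable
  define N where "N y = (\<integral>\<^sup>+\<theta>. indicator F \<theta> * f \<theta> * pe n \<theta> y \<partial>\<pi>)" for y
  have Nm: "N \<in> borel_measurable (\<nu> n)" unfolding N_def by (rule marginal_measurable[OF n1 sets_\<nu>[OF n1] fF])
  have pcm: "pe n \<theta>c \<in> borel_measurable (\<nu> n)" by (rule pe_measurable(1)[OF n1 sets_\<nu>[OF n1] \<theta>c])
  have "(\<integral>\<^sup>+y. h y * N y / pe n \<theta>c y \<partial>Q n) = (\<integral>\<^sup>+y. pe n \<theta>c y * (h y * N y / pe n \<theta>c y) \<partial>\<nu> n)"
    unfolding p_density[OF n1 \<theta>c] by (rule nn_integral_density) (use hn Nm pcm in measurable)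
  \<comment> \<open>Not an equality in general: where the true density vanishes, the left integrand
    is 0.\<close>
  also have "\<dots> \<le> (\<integral>\<^sup>+y. h y * N y \<partial>\<nu> n)"
  proof (rule nn_integral_mono)
    fix y show "pe n \<theta>c y * (h y * N y / pe n \<theta>c y) \<le> h y * N y"
      by (cases "pe n \<theta>c y = 0") (auto simp: ennreal_times_divide mult.commute[of "pe n \<theta>c y"] mult_divide_eq_ennreal)
  qed
  also have "\<dots> = (\<integral>\<^sup>+\<theta>. indicator F \<theta> * f \<theta> * (\<integral>\<^sup>+y. h y \<partial>Pi\<^sub>M {..<n} (\<lambda>_. P \<theta>)) \<partial>\<pi>)"
    unfolding N_def by (rule nn_integral_swap[OF n1 fF h])
  also have "\<dots> \<le> (\<integral>\<^sup>+\<theta>. \<rho> ^ m * (f \<theta> * (\<integral>\<^sup>+y. indicator A y \<partial>Pi\<^sub>M {..<1} (\<lambda>_. P \<theta>))) \<partial>\<pi>)"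
  proof (rule nn_integral_mono)
    fix \<theta> assume \<theta>: "\<theta> \<in> space \<pi>"
    have cm: "c \<in> borel_measurable (Pi\<^sub>M {..<k} (\<lambda>_. P \<theta>))" using c by (subst measurable_cong_sets[OF sets_PiM_P[OF \<theta>] refl])
    have Am: "(indicator A :: _ \<Rightarrow> ennreal) \<in> borel_measurable (Pi\<^sub>M {..<1} (\<lambda>_. P \<theta>))"
      using iA by (subst measurable_cong_sets[OF sets_PiM_P[OF \<theta>] refl])
    have hm: "h \<in> borel_measurable (Pi\<^sub>M {..<n} (\<lambda>_. P \<theta>))" using h by (subst measurable_cong_sets[OF sets_PiM_P[OF \<theta>] refl])
    have hr: "h (restrict \<omega> {..<n}) = indicator A (restrict \<omega> {..<1}) * block_weight c k m \<omega>" for \<omega>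
    proof -
      have "{..<n} \<inter> {..<1} = {..<1}" using n by auto
      then show ?thesis unfolding h_def using block_weight_restrict[OF n, of c \<omega>] by (simp only: restrict_restrict)
    qed
    have "(\<integral>\<^sup>+y. h y \<partial>Pi\<^sub>M {..<n} (\<lambda>_. P \<theta>)) = (\<integral>\<^sup>+y. indicator A y \<partial>Pi\<^sub>M {..<1} (\<lambda>_. P \<theta>)) * (\<integral>\<^sup>+y. c y \<partial>Pi\<^sub>M {..<k} (\<lambda>_. P \<theta>)) ^ m"
      unfolding nn_integral_PiM_restrict[OF prob_P[OF \<theta>] hm, symmetric] hr
      by (rule nn_integral_blocks[OF prob_P[OF \<theta>] Am cm])
    moreover have "(\<integral>\<^sup>+y. c y \<partial>Pi\<^sub>M {..<k} (\<lambda>_. P \<theta>)) ^ m \<le> \<rho> ^ m" if "\<theta> \<in> F"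
      by (induction m) (auto intro!: mult_mono \<rho>[OF that])
    moreover have "f \<theta> * (u * v) \<le> r * (f \<theta> * u)" if "v \<le> r" for u v r :: ennreal
      using mult_left_mono[OF that, of "f \<theta> * u"] by (simp add: mult_ac)
    ultimately show "indicator F \<theta> * f \<theta> * (\<integral>\<^sup>+y. h y \<partial>Pi\<^sub>M {..<n} (\<lambda>_. P \<theta>)) \<le> \<rho> ^ m * (f \<theta> * (\<integral>\<^sup>+y. indicator A y \<partial>Pi\<^sub>M {..<1} (\<lambda>_. P \<theta>)))"
      by (cases "\<theta> \<in> F") auto
  qed
  also have "\<dots> = \<rho> ^ m * (\<integral>\<^sup>+\<theta>. f \<theta> * (\<integral>\<^sup>+y. indicator A y \<partial>Pi\<^sub>M {..<1} (\<lambda>_. P \<theta>)) \<partial>\<pi>)"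
  proof (rule nn_integral_cmult)
    interpret \<nu>1: sigma_finite_measure "\<nu> 1" by (rule \<nu>) simp
    have 1: "(\<lambda>\<theta>. \<integral>\<^sup>+y. pe 1 \<theta> y * indicator A y \<partial>\<nu> 1) \<in> borel_measurable \<pi>"
    proof -
      have "(\<lambda>y. indicator A y :: ennreal) \<in> borel_measurable (\<nu> 1)" using iA sets_\<nu>[OF one] by (simp cong: measurable_cong_sets)
      from measurable_compose[OF measurable_snd this]
      have "(\<lambda>(\<theta>, y). pe 1 \<theta> y * indicator A y) \<in> borel_measurable (\<pi> \<Otimes>\<^sub>M \<nu> 1)"
        unfolding split_beta' by (intro borel_measurable_times_ennreal pe_measurable2[OF one sets_\<nu>[OF one]])
      then show ?thesis by (rule \<nu>1.borel_measurable_nn_integral)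
    qed
    have 2: "(\<integral>\<^sup>+y. indicator A y \<partial>Pi\<^sub>M {..<1} (\<lambda>_. P \<theta>)) = (\<integral>\<^sup>+y. pe 1 \<theta> y * indicator A y \<partial>\<nu> 1)" if "\<theta> \<in> space \<pi>" for \<theta>
      unfolding p_density[OF one that]
      by (rule nn_integral_density) (use pe_measurable(1)[OF one sets_\<nu>[OF one] that] A sets_\<nu>[OF one] in auto)
    have "(\<lambda>\<theta>. f \<theta> * (\<integral>\<^sup>+y. pe 1 \<theta> y * indicator A y \<partial>\<nu> 1)) \<in> borel_measurable \<pi>" using 1 by measurable
    then show "(\<lambda>\<theta>. f \<theta> * (\<integral>\<^sup>+y. indicator A y \<partial>Pi\<^sub>M {..<1} (\<lambda>_. P \<theta>))) \<in> borel_measurable \<pi>"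
      by (rule measurable_cong[THEN iffD1, rotated]) (simp only: 2)
  qed
  \<comment> \<open>The exchange is undone at sample size 1.\<close>
  also have "(\<integral>\<^sup>+\<theta>. f \<theta> * (\<integral>\<^sup>+y. indicator A y \<partial>Pi\<^sub>M {..<1} (\<lambda>_. P \<theta>)) \<partial>\<pi>) = (\<integral>\<^sup>+y. indicator A y * (\<integral>\<^sup>+\<theta>. f \<theta> * pe 1 \<theta> y \<partial>\<pi>) \<partial>\<nu> 1)"
    by (rule nn_integral_swap[OF one f iA, symmetric])
  also have "\<dots> \<le> (\<integral>\<^sup>+y. C * pe 1 \<theta>c y \<partial>\<nu> 1)"
    using AC by (intro nn_integral_mono) (auto simp: indicator_def)
  also have "\<dots> = C * (\<integral>\<^sup>+y. pe 1 \<theta>c y \<partial>\<nu> 1)"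
    by (rule nn_integral_cmult[OF pe_measurable(1)[OF one sets_\<nu>[OF one] \<theta>c]])
  also have "(\<integral>\<^sup>+y. pe 1 \<theta>c y \<partial>\<nu> 1) = 1"
  proof -
    have "(\<integral>\<^sup>+y. pe 1 \<theta>c y \<partial>\<nu> 1) = emeasure (Q 1) (space (\<nu> 1))"
      unfolding p_density[OF one \<theta>c] using pe_measurable(1)[OF one sets_\<nu>[OF one] \<theta>c]
      by (subst emeasure_density) (auto intro!: nn_integral_cong)
    also have "space (\<nu> 1) = space (Q 1)" unfolding p_density[OF one \<theta>c] by simp
    finally show ?thesis using prob_space.emeasure_space_1[OF prob_PiM_P[OF \<theta>c]] by simp
  qed
  finally show ?thesis by (simp add: h_def N_def mult.assoc mult_left_mono)
qed

text \<open>Four bad events: the first observation outside A, a small marginal, a small weight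
  although the truth holds, and a large weighted numerator. Their probabilities are the terms of the
  bound; off them the numerator cannot exceed t times the marginal.\<close>

lemma posterior_tail_bound:
  assumes W: "W \<in> sets \<pi>" "measure \<pi> W = a" "0 < a" and b: "0 < b" and \<epsilon>: "0 < \<epsilon>"
    and KL: "\<And>\<theta>. \<theta> \<in> W \<Longrightarrow> KL_ext (P \<theta>c) (P \<theta>) < ereal \<epsilon>"
    and F: "F \<in> sets \<pi>" and f: "f \<in> borel_measurable \<pi>"
    and A: "A \<in> sets (Pi\<^sub>M {..<1} (\<lambda>_. S))" and C: "0 \<le> C"
    and AC: "\<And>y. y \<in> A \<Longrightarrow> (\<integral>\<^sup>+\<theta>. f \<theta> * pe 1 \<theta> y \<partial>\<pi>) \<le> ennreal C * pe 1 \<theta>c y"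
    and \<phi>: "\<phi> \<in> borel_measurable (Pi\<^sub>M {..<k} (\<lambda>_. S))" "\<And>y. y \<in> space (Pi\<^sub>M {..<k} (\<lambda>_. S)) \<Longrightarrow> \<phi> y \<in> {0..1::real}"
    and \<phi>_far: "\<And>\<theta>. \<theta> \<in> F \<Longrightarrow> (\<integral>y. 1 - \<phi> y \<partial>Pi\<^sub>M {..<k} (\<lambda>_. P \<theta>)) \<le> 1 / 9"
    and \<phi>_true: "(\<integral>y. \<phi> y \<partial>Pi\<^sub>M {..<k} (\<lambda>_. P \<theta>c)) \<le> 1 / 24"
    and n: "1 + m * k \<le> n" and t: "0 < t"
  shows "emeasure (Q n) {y \<in> space (Q n). ennreal t < (\<integral>\<^sup>+\<theta>. indicator F \<theta> * f \<theta> * pe n \<theta> y \<partial>\<pi>) / marginal n y} \<le>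
    emeasure (Q 1) (space (Q 1) - A) +
    ennreal (2 * (\<epsilon> / b + 1 / (n * b)) + (3 / 4) ^ m + C * (1 / 2) ^ m * exp (n * b) * (2 / (a * t)))"
proof -
  have n1: "n \<ge> 1" using n by simp
  interpret Qn: prob_space "Q n" by (rule prob_PiM_P[OF \<theta>c])
  note sQ = sets_PiM_P[OF \<theta>c, of "{..<n}"]
  \<comment> \<open>Small where the test rejects \<open>\<theta>c\<close>. The reciprocal
    \<open>c'\<close> serves to bound the weight from below under the truth.\<close>
  define c where "c y = ennreal (4 powr (- \<phi> y))" for y
  define c' where "c' y = ennreal (4 powr (\<phi> y))" for y
  have cm: "c \<in> borel_measurable (Pi\<^sub>M {..<k} (\<lambda>_. S))" "c' \<in> borel_measurable (Pi\<^sub>M {..<k} (\<lambda>_. S))"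
    unfolding c_def[abs_def] c'_def[abs_def] using \<phi>(1) by measurable
  define G where "G = block_weight c k m"
  define G' where "G' = block_weight c' k m"
  have GG': "G y * G' y = 1" for y
  proof -
    have "c z * c' z = 1" for z by (simp add: c_def c'_def ennreal_mult[symmetric] powr_add[symmetric])
    then show ?thesis by (simp add: G_def G'_def block_weight_def prod.distrib[symmetric])
  qed
  define N where "N y = (\<integral>\<^sup>+\<theta>. indicator F \<theta> * f \<theta> * pe n \<theta> y \<partial>\<pi>)" for y
  have Nm[measurable]: "N \<in> borel_measurable (Q n)"
    unfolding N_def by (intro marginal_measurable[OF n1 sQ] borel_measurable_times_ennreal borel_measurable_indicator f F)
  have Dm[measurable]: "marginal n \<in> borel_measurable (Q n)" by (rule marginal_measurable'[OF n1 sQ])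
  have pcm[measurable]: "pe n \<theta>c \<in> borel_measurable (Q n)" by (rule pe_measurable(1)[OF n1 sQ \<theta>c])
  have cmP: "c \<in> borel_measurable (Pi\<^sub>M {..<k} (\<lambda>_. P \<theta>))" "c' \<in> borel_measurable (Pi\<^sub>M {..<k} (\<lambda>_. P \<theta>))"
     "\<phi> \<in> borel_measurable (Pi\<^sub>M {..<k} (\<lambda>_. P \<theta>))" if "\<theta> \<in> space \<pi>" for \<theta>
    unfolding measurable_cong_sets[OF sets_PiM_P[OF that] refl] by (fact cm \<phi>(1))+
  have Gm[measurable]: "G \<in> borel_measurable (Q n)" "G' \<in> borel_measurable (Q n)"
    unfolding G_def G'_def using cmP[OF \<theta>c] n by (auto intro!: measurable_block_weight)
  have \<phi>01: "0 \<le> \<phi> y" "\<phi> y \<le> 1" if "\<theta> \<in> space \<pi>" "y \<in> space (Pi\<^sub>M {..<k} (\<lambda>_. P \<theta>))" for y \<theta>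
    using \<phi>(2)[of y] that(2) sets_eq_imp_space_eq[OF sets_PiM_P[OF that(1), of "{..<k}"]] by auto
  \<comment> \<open>The chord bound with error 1/9 gives 1/4 + 3/36 = 1/3.\<close>
  have ic: "(\<integral>\<^sup>+y. c y \<partial>Pi\<^sub>M {..<k} (\<lambda>_. P \<theta>)) \<le> ennreal (1 / 3)" if "\<theta> \<in> F" for \<theta>
  proof -
    have \<theta>: "\<theta> \<in> space \<pi>" using that F sets.sets_into_space by blast
    interpret K: prob_space "Pi\<^sub>M {..<k} (\<lambda>_. P \<theta>)" by (rule prob_PiM_P[OF \<theta>])
    have int: "integrable (Pi\<^sub>M {..<k} (\<lambda>_. P \<theta>)) \<phi>"
      using \<phi>01[OF \<theta>] cmP(3)[OF \<theta>] by (intro K.integrable_const_bound[where B=1]) auto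
    have "(\<integral>\<^sup>+y. c y \<partial>Pi\<^sub>M {..<k} (\<lambda>_. P \<theta>)) \<le> (\<integral>\<^sup>+y. ennreal (1 / 4 + 3 / 4 * (1 - \<phi> y)) \<partial>Pi\<^sub>M {..<k} (\<lambda>_. P \<theta>))"
      unfolding c_def using \<phi>01[OF \<theta>] by (intro nn_integral_mono ennreal_leI four_powr_le) auto
    also have "\<dots> = ennreal (\<integral>y. 1 / 4 + 3 / 4 * (1 - \<phi> y) \<partial>Pi\<^sub>M {..<k} (\<lambda>_. P \<theta>))"
      using int \<phi>01[OF \<theta>] by (intro nn_integral_eq_integral) (auto intro!: AE_I2 add_nonneg_nonneg)
    also have "(\<integral>y. 1 / 4 + 3 / 4 * (1 - \<phi> y) \<partial>Pi\<^sub>M {..<k} (\<lambda>_. P \<theta>)) = 1 / 4 + 3 / 4 * (\<integral>y. 1 - \<phi> y \<partial>Pi\<^sub>M {..<k} (\<lambda>_. P \<theta>))"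
      using int by (subst Bochner_Integration.integral_add) (auto simp: K.prob_space)
    also have "ennreal \<dots> \<le> ennreal (1 / 3)" using \<phi>_far[OF that] by (intro ennreal_leI) simp
    finally show ?thesis .
  qed
  \<comment> \<open>Likewise 1 + 3/24 = 9/8.\<close>
  have ic': "(\<integral>\<^sup>+y. c' y \<partial>Q k) \<le> ennreal (9 / 8)"
  proof -
    interpret K: prob_space "Q k" by (rule prob_PiM_P[OF \<theta>c])
    have int: "integrable (Q k) \<phi>"
      using \<phi>01[OF \<theta>c] cmP(3)[OF \<theta>c] by (intro K.integrable_const_bound[where B=1]) auto
    have "(\<integral>\<^sup>+y. c' y \<partial>Q k) \<le> (\<integral>\<^sup>+y. ennreal (1 + 3 * \<phi> y) \<partial>Q k)"
      unfolding c'_def using \<phi>01[OF \<theta>c] by (intro nn_integral_mono ennreal_leI four_powr_le) auto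
    also have "\<dots> = ennreal (\<integral>y. 1 + 3 * \<phi> y \<partial>Q k)"
      using int \<phi>01[OF \<theta>c] by (intro nn_integral_eq_integral) (auto intro!: AE_I2 add_nonneg_nonneg)
    also have "(\<integral>y. 1 + 3 * \<phi> y \<partial>Q k) = 1 + 3 * (\<integral>y. \<phi> y \<partial>Q k)"
      using int by (subst Bochner_Integration.integral_add) (auto simp: K.prob_space)
    also have "ennreal \<dots> \<le> ennreal (9 / 8)" using \<phi>_true by (intro ennreal_leI) simp
    finally show ?thesis .
  qed
  \<comment> \<open>The reciprocal of the lower bound that holds off the first three events for
    weight times numerator over true density: (2/3)^m from the weight, and t exp (- n b) a / 2 from
    the numerator by way of the marginal.\<close>
  define K where "K = (3 / 2) ^ m * exp (n * b) * (2 / (a * t))"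
  have K: "0 < K" using W t by (simp add: K_def)
  define E1 where "E1 = {y \<in> space (Q n). restrict y {..<1} \<notin> A}"
  define E2 where "E2 = {y \<in> space (Q n). marginal n y < ennreal (exp (- (n * b)) * (a / 2)) * pe n \<theta>c y}"
  \<comment> \<open>The rate 2/3 lies between 1/3 and 8/9, so that (2/3)(9/8) = 3/4 and (3/2)(1/3) =
    1/2 are both below 1.\<close>
  define E3 where "E3 = {y \<in> space (Q n). 1 \<le> ennreal ((2 / 3) ^ m) * G' y}"
  define E4 where "E4 = {y \<in> space (Q n). 1 \<le> ennreal K * (indicator A (restrict y {..<1}) * G y * N y / pe n \<theta>c y)}"
  have r1: "(\<lambda>\<omega>. restrict \<omega> {..<1}) \<in> measurable (Q n) (Q 1)"
    by (rule measurable_restrict_subset) (use n in auto)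
  have AQ: "A \<in> sets (Q 1)" using A unfolding sets_PiM_P[OF \<theta>c] .
  have E1_alt: "E1 = (\<lambda>\<omega>. restrict \<omega> {..<1}) -` (space (Q 1) - A) \<inter> space (Q n)"
    unfolding E1_def using measurable_space[OF r1] by auto
  have iAm[measurable]: "(\<lambda>y. indicator A (restrict y {..<1}) :: ennreal) \<in> borel_measurable (Q n)"
    by (rule measurable_compose[OF r1]) (use AQ in measurable)
  have Es[measurable]: "E1 \<in> sets (Q n)" "E2 \<in> sets (Q n)" "E3 \<in> sets (Q n)" "E4 \<in> sets (Q n)"
    unfolding E1_alt using measurable_sets[OF r1, of "space (Q 1) - A"] AQ apply simp
    unfolding E2_def E3_def E4_def by measurable
  have e1: "emeasure (Q n) E1 = emeasure (Q 1) (space (Q 1) - A)"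
  proof -
    have "emeasure (Q 1) (space (Q 1) - A) = (\<integral>\<^sup>+y. indicator (space (Q 1) - A) y \<partial>Q 1)"
      using AQ by simp
    also have "\<dots> = (\<integral>\<^sup>+\<omega>. indicator (space (Q 1) - A) (restrict \<omega> {..<1}) \<partial>Pi\<^sub>M UNIV (\<lambda>_. P \<theta>c))"
      using AQ by (intro nn_integral_PiM_restrict[symmetric] prob_P[OF \<theta>c]) auto
    also have "\<dots> = (\<integral>\<^sup>+\<omega>. indicator (space (Q 1) - A) (restrict (restrict \<omega> {..<n}) {..<1}) \<partial>Pi\<^sub>M UNIV (\<lambda>_. P \<theta>c))"
    proof -
      have "{..<n} \<inter> {..<1} = {..<1}" using n by auto
      then show ?thesis by (simp only: restrict_restrict)
    qed
    also have "\<dots> = (\<integral>\<^sup>+y. indicator (space (Q 1) - A) (restrict y {..<1}) \<partial>Q n)"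
      using AQ by (intro nn_integral_PiM_restrict[of _ "\<lambda>y. indicator (space (Q 1) - A) (restrict y {..<1})"] prob_P[OF \<theta>c] measurable_compose[OF r1]) auto
    also have "\<dots> = (\<integral>\<^sup>+y. indicator E1 y \<partial>Q n)"
      by (intro nn_integral_cong) (simp add: E1_alt indicator_def)
    also have "\<dots> = emeasure (Q n) E1" by (rule nn_integral_indicator) (rule Es)
    finally show ?thesis by simp
  qed
  have e2: "emeasure (Q n) E2 \<le> ennreal (2 * (\<epsilon> / b + 1 / (n * b)))"
    unfolding E2_def
  proof (rule marginal_lower[OF n1 W])
    fix \<theta> assume "\<theta> \<in> W"
    then have "\<theta> \<in> space \<pi>" using W sets.sets_into_space by blast
    then show "emeasure (Q n) {y \<in> space (Q n). pe n \<theta> y < ennreal (exp (- (n * b))) * pe n \<theta>c y} \<le> ennreal (\<epsilon> / b + 1 / (n * b))"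
      by (rule likelihood_ratio_lower[OF n1 _ KL[OF \<open>\<theta> \<in> W\<close>] b \<epsilon>])
  qed (use b \<epsilon> in auto)
  have e3: "emeasure (Q n) E3 \<le> ennreal ((3 / 4) ^ m)"
  proof -
    have "emeasure (Q n) E3 \<le> (\<integral>\<^sup>+y. ennreal ((2 / 3) ^ m) * G' y \<partial>Q n)"
      unfolding E3_def by (rule emeasure_le_nn_integral) measurable
    also have "\<dots> = ennreal ((2 / 3) ^ m) * (\<integral>\<^sup>+y. G' y \<partial>Q n)" by (rule nn_integral_cmult[OF Gm(2)])
    also have "(\<integral>\<^sup>+y. G' y \<partial>Q n) = (\<integral>\<^sup>+\<omega>. G' (restrict \<omega> {..<n}) \<partial>Pi\<^sub>M UNIV (\<lambda>_. P \<theta>c))"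
      by (rule nn_integral_PiM_restrict[OF prob_P[OF \<theta>c] Gm(2), symmetric])
    also have "\<dots> = (\<integral>\<^sup>+\<omega>. (\<lambda>_. 1) (restrict \<omega> {..<1}) * block_weight c' k m \<omega> \<partial>Pi\<^sub>M UNIV (\<lambda>_. P \<theta>c))"
      unfolding G'_def by (simp only: block_weight_restrict[OF n] mult_1)
    also have "\<dots> = (\<integral>\<^sup>+y. (\<lambda>_. 1) y \<partial>Q 1) * (\<integral>\<^sup>+y. c' y \<partial>Q k) ^ m"
      using nn_integral_blocks[where u="\<lambda>_. 1" and m=m, OF prob_P[OF \<theta>c] _ cmP(2)[OF \<theta>c]] by simp
    also have "\<dots> = (\<integral>\<^sup>+y. c' y \<partial>Q k) ^ m"
      using prob_space.emeasure_space_1[OF prob_PiM_P[OF \<theta>c, of "{..<1::nat}"]] by simp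
    also have "ennreal ((2 / 3) ^ m) * (\<integral>\<^sup>+y. c' y \<partial>Q k) ^ m \<le> ennreal ((2 / 3) ^ m) * ennreal (9 / 8) ^ m"
    proof (rule mult_left_mono)
      show "(\<integral>\<^sup>+y. c' y \<partial>Q k) ^ m \<le> ennreal (9 / 8) ^ m"
        by (induction m) (auto intro!: mult_mono ic')
    qed simp
    also have "\<dots> = ennreal ((3 / 4) ^ m)"
    proof -
      have "ennreal ((2 / 3) ^ m) * ennreal (9 / 8) ^ m = ennreal ((2 / 3) ^ m * (9 / 8) ^ m)"
        by (simp add: ennreal_power ennreal_mult)
      also have "(2 / 3) ^ m * (9 / 8) ^ m = (3 / 4 :: real) ^ m" by (simp add: power_mult_distrib[symmetric])
      finally show ?thesis .
    qed
    finally show ?thesis .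
  qed
  have e4: "emeasure (Q n) E4 \<le> ennreal (C * (1 / 2) ^ m * exp (n * b) * (2 / (a * t)))"
  proof -
    have "emeasure (Q n) E4 \<le> (\<integral>\<^sup>+y. ennreal K * (indicator A (restrict y {..<1}) * G y * N y / pe n \<theta>c y) \<partial>Q n)"
      unfolding E4_def by (rule emeasure_le_nn_integral) measurable
    also have "\<dots> = ennreal K * (\<integral>\<^sup>+y. indicator A (restrict y {..<1}) * G y * N y / pe n \<theta>c y \<partial>Q n)"
      by (rule nn_integral_cmult) measurable
    also have "\<dots> \<le> ennreal K * (ennreal (1 / 3) ^ m * ennreal C)"
      unfolding G_def N_def by (intro mult_left_mono numerator_upper[OF F f cm(1) n A AC ic]) auto
    also have "\<dots> = ennreal (K * ((1 / 3) ^ m * C))"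
      using K C by (simp add: ennreal_mult ennreal_power)
    also have "K * ((1 / 3) ^ m * C) = C * ((3 / 2) ^ m * (1 / 3) ^ m) * exp (n * b) * (2 / (a * t))"
      by (simp add: K_def)
    also have "(3 / 2) ^ m * (1 / 3) ^ m = (1 / 2 :: real) ^ m" by (simp add: power_mult_distrib[symmetric])
    finally show ?thesis .
  qed
  have "emeasure (Q n) {y \<in> space (Q n). ennreal t < N y / marginal n y} \<le> emeasure (Q n) (E1 \<union> E2 \<union> E3 \<union> E4)"
  proof (rule emeasure_mono_AE)
    show "AE y in Q n. y \<in> {y \<in> space (Q n). ennreal t < N y / marginal n y} \<longrightarrow> y \<in> E1 \<union> E2 \<union> E3 \<union> E4"
    proof (rule eventually_mono[OF AE_true_density_pos[OF n1]], rule impI, rule ccontr)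
      fix y assume pos: "0 < pe n \<theta>c y" and "y \<in> {y \<in> space (Q n). ennreal t < N y / marginal n y}"
        and "y \<notin> E1 \<union> E2 \<union> E3 \<union> E4"
      then have y: "y \<in> space (Q n)" "ennreal t < N y / marginal n y" and yA: "restrict y {..<1} \<in> A"
        and y2: "ennreal (exp (- (n * b)) * (a / 2)) * pe n \<theta>c y \<le> marginal n y"
        and y3: "ennreal ((2 / 3) ^ m) * G' y < 1"
        and y4: "ennreal K * (G y * N y / pe n \<theta>c y) < 1"
        by (auto simp: E1_def E2_def E3_def E4_def not_less not_le)
      define x where "x = exp (- (n * b)) * (a / 2)"
      have x: "0 < x" using W by (simp add: x_def)
      have "0 < ennreal x * pe n \<theta>c y" using x pos by (simp add: ennreal_zero_less_mult_iff)
      then have M0: "marginal n y \<noteq> 0" using y2 by (auto simp: x_def)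
      \<comment> \<open>An infinite marginal makes the quotient 0, which is not above t.\<close>
      have Mtop: "marginal n y \<noteq> top"
      proof
        assume "marginal n y = top" then show False using y(2) by (simp add: divide_ennreal_def)
      qed
      have "ennreal t * (ennreal x * pe n \<theta>c y) \<le> N y / marginal n y * marginal n y"
        using y(2) y2 by (intro mult_mono) (auto simp: x_def)
      also have "\<dots> = N y"
      proof -
        have "marginal n y / marginal n y = 1"
          using M0 Mtop by (intro ennreal_divide_self) (auto simp: top.not_eq_extremum)
        then show ?thesis by (simp add: ennreal_divide_times)
      qed
      finally have "ennreal (t * x) * pe n \<theta>c y \<le> N y" using t x by (simp add: ennreal_mult mult.assoc)
      then have "ennreal (t * x) * pe n \<theta>c y / pe n \<theta>c y \<le> N y / pe n \<theta>c y" by (rule divide_right_mono_ennreal)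
      then have Nl: "ennreal (t * x) \<le> N y / pe n \<theta>c y" using pos by (simp add: mult_divide_eq_ennreal)
      have "ennreal ((2 / 3) ^ m) = ennreal ((2 / 3) ^ m) * G' y * G y"
      proof -
        have "G' y * G y = 1" using GG'[of y] by (simp add: mult.commute)
        then show ?thesis by (simp add: mult.assoc)
      qed
      also have "\<dots> \<le> 1 * G y" using y3 by (intro mult_right_mono) auto
      finally have Gl: "ennreal ((2 / 3) ^ m) \<le> G y" by simp
      \<comment> \<open>K is matched to the two lower bounds, so the product would be both 1 and
        below 1.\<close>
      have "ennreal (K * ((2 / 3) ^ m * (t * x))) = ennreal K * (ennreal ((2 / 3) ^ m) * ennreal (t * x))"
        using K t x by (simp add: ennreal_mult)
      also have "\<dots> \<le> ennreal K * (G y * (N y / pe n \<theta>c y))"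
        by (intro mult_mono mult_left_mono Gl Nl) auto
      also have "\<dots> < 1" using y4 by (simp add: ennreal_times_divide)
      also have "K * ((2 / 3) ^ m * (t * x)) = ((3 / 2) ^ m * (2 / 3) ^ m) * (exp (n * b) * exp (- (n * b)))"
        using t W by (simp add: K_def x_def)
      also have "\<dots> = 1" by (simp add: power_mult_distrib[symmetric] exp_add[symmetric])
      finally show False by simp
    qed
  qed measurable
  also have "\<dots> \<le> emeasure (Q n) E1 + emeasure (Q n) E2 + emeasure (Q n) E3 + emeasure (Q n) E4"
    by (intro order_trans[OF emeasure_subadditive] add_mono order.refl sets.Un Es)
  also have "\<dots> \<le> emeasure (Q 1) (space (Q 1) - A) + ennreal (2 * (\<epsilon> / b + 1 / (n * b))) + ennreal ((3 / 4) ^ m)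
      + ennreal (C * (1 / 2) ^ m * exp (n * b) * (2 / (a * t)))"
    using e1 e2 e3 e4 by (intro add_mono) auto
  also have "\<dots> = emeasure (Q 1) (space (Q 1) - A) +
    ennreal (2 * (\<epsilon> / b + 1 / (n * b)) + (3 / 4) ^ m + C * (1 / 2) ^ m * exp (n * b) * (2 / (a * t)))"
    using b \<epsilon> C W t by (simp add: ennreal_plus add.assoc)
  finally show ?thesis by (simp add: N_def)
qed

text \<open>The threshold t / sqrt n anticipates the scaling of
  \<open>H \<theta> - H \<theta>c\<close>. The choices come in the order block length k, rate b,
  divergence bound \<epsilon>, set W, constant C; only then does n grow.\<close>

lemma posterior_tail_tendsto:
  assumes F: "F \<in> sets \<pi>" and f: "f \<in> borel_measurable \<pi>"
    and fin: "AE y in Q 1. (\<integral>\<^sup>+\<theta>. f \<theta> * pe 1 \<theta> y \<partial>\<pi>) < \<infinity>"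
    and KL: "\<And>\<epsilon>. 0 < \<epsilon> \<Longrightarrow> \<exists>W\<in>sets \<pi>. 0 < measure \<pi> W \<and> (\<forall>\<theta>\<in>W. KL_ext (P \<theta>c) (P \<theta>) < ereal \<epsilon>)"
    and \<phi>: "\<And>n. \<phi> n \<in> borel_measurable (Pi\<^sub>M {..<n} (\<lambda>_. S))"
      "\<And>n y. y \<in> space (Pi\<^sub>M {..<n} (\<lambda>_. S)) \<Longrightarrow> \<phi> n y \<in> {0..1::real}"
    and \<phi>_true: "(\<lambda>n. \<integral>y. \<phi> n y \<partial>Q n) \<longlonglongrightarrow> 0"
    and \<phi>_far: "(\<lambda>n. SUP \<theta>\<in>F. ennreal (\<integral>y. 1 - \<phi> n y \<partial>Pi\<^sub>M {..<n} (\<lambda>_. P \<theta>))) \<longlonglongrightarrow> 0"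
    and t: "0 < t" and e: "0 < e"
  shows "eventually (\<lambda>n. emeasure (Q n) {y \<in> space (Q n). ennreal (t / sqrt n) <
    (\<integral>\<^sup>+\<theta>. indicator F \<theta> * f \<theta> * pe n \<theta> y \<partial>\<pi>) / marginal n y} \<le> ennreal e) sequentially"
proof -
  have one: "(1::nat) \<ge> 1" by simp
  interpret Q1: prob_space "Q 1" by (rule prob_PiM_P[OF \<theta>c])
  \<comment> \<open>A single sample size at which both test errors are small fixes the block length
    once and for all.\<close>
  have "eventually (\<lambda>n. (\<integral>y. \<phi> n y \<partial>Q n) < 1 / 24) sequentially"
    by (rule order_tendstoD(2)[OF \<phi>_true]) simp
  moreover have "eventually (\<lambda>n. (SUP \<theta>\<in>F. ennreal (\<integral>y. 1 - \<phi> n y \<partial>Pi\<^sub>M {..<n} (\<lambda>_. P \<theta>))) < ennreal (1 / 9)) sequentially"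
    by (rule order_tendstoD(2)[OF \<phi>_far]) simp
  ultimately have "eventually (\<lambda>n. n \<ge> 1 \<and> (\<integral>y. \<phi> n y \<partial>Q n) < 1 / 24 \<and>
    (SUP \<theta>\<in>F. ennreal (\<integral>y. 1 - \<phi> n y \<partial>Pi\<^sub>M {..<n} (\<lambda>_. P \<theta>))) < ennreal (1 / 9)) sequentially"
    using eventually_ge_at_top[of "1::nat"] by eventually_elim simp
  then obtain k where k: "k \<ge> 1" "(\<integral>y. \<phi> k y \<partial>Q k) \<le> 1 / 24"
    and ksup: "(SUP \<theta>\<in>F. ennreal (\<integral>y. 1 - \<phi> k y \<partial>Pi\<^sub>M {..<k} (\<lambda>_. P \<theta>))) < ennreal (1 / 9)"
    by (auto dest!: eventually_happens'[OF sequentially_bot] intro: less_imp_le)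
  have kfar: "(\<integral>y. 1 - \<phi> k y \<partial>Pi\<^sub>M {..<k} (\<lambda>_. P \<theta>)) \<le> 1 / 9" if "\<theta> \<in> F" for \<theta>
  proof -
    have "ennreal (\<integral>y. 1 - \<phi> k y \<partial>Pi\<^sub>M {..<k} (\<lambda>_. P \<theta>)) \<le> ennreal (1 / 9)"
      using SUP_upper[OF that, of "\<lambda>\<theta>. ennreal (\<integral>y. 1 - \<phi> k y \<partial>Pi\<^sub>M {..<k} (\<lambda>_. P \<theta>))"] ksup by (rule order_trans[OF _ less_imp_le])
    then show ?thesis by (subst (asm) ennreal_le_iff) auto
  qed
  \<comment> \<open>With about n / k blocks, (1/2)^m decays like exp (- 2 n b): one half of the
    exponent absorbs the factor exp (n b), the other half beats sqrt n.\<close>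
  define b where "b = ln 2 / (2 * real k)"
  have b: "0 < b" using k by (simp add: b_def)
  \<comment> \<open>Makes the term 2 \<epsilon> / b, which does not vanish with n, equal to e /
    8.\<close>
  define \<epsilon> where "\<epsilon> = e * b / 16"
  have \<epsilon>: "0 < \<epsilon>" using b e by (simp add: \<epsilon>_def)
  obtain W where W: "W \<in> sets \<pi>" "0 < measure \<pi> W" "\<And>\<theta>. \<theta> \<in> W \<Longrightarrow> KL_ext (P \<theta>c) (P \<theta>) < ereal \<epsilon>"
    using KL[OF \<epsilon>] by blast
  define a where "a = measure \<pi> W"
  have a: "0 < a" using W by (simp add: a_def)
  define g where "g y = (\<integral>\<^sup>+\<theta>. f \<theta> * pe 1 \<theta> y \<partial>\<pi>)" for y
  have gm: "g \<in> borel_measurable (Pi\<^sub>M {..<1} (\<lambda>_. S))"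
    unfolding g_def by (rule marginal_measurable[OF one refl f])
  have pm: "pe 1 \<theta>c \<in> borel_measurable (Pi\<^sub>M {..<1} (\<lambda>_. S))"
    by (rule pe_measurable(1)[OF one refl \<theta>c])
  \<comment> \<open>First observations whose numerator is at most j times the true density. These
    sets exhaust almost everything, since the numerator is finite and the true density
    positive.\<close>
  define A where "A j = {y \<in> space (Pi\<^sub>M {..<1} (\<lambda>_. S)). g y \<le> ennreal (real j) * pe 1 \<theta>c y}" for j :: nat
  have A: "A j \<in> sets (Pi\<^sub>M {..<1} (\<lambda>_. S))" for j
    unfolding A_def using gm pm by measurable
  have AQ: "A j \<in> sets (Q 1)" for j using A unfolding sets_PiM_P[OF \<theta>c] .
  have "(\<lambda>j. emeasure (Q 1) (space (Q 1) - A j)) \<longlonglongrightarrow> emeasure (Q 1) (\<Inter>j. space (Q 1) - A j)"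
  proof (rule Lim_emeasure_decseq)
    have "ennreal (real i) * pe 1 \<theta>c y \<le> ennreal (real j) * pe 1 \<theta>c y" if "i \<le> j" for i j y
      using that by (intro mult_right_mono ennreal_leI) auto
    then have "A i \<subseteq> A j" if "i \<le> j" for i j
      unfolding A_def using that order_trans by blast
    then show "decseq (\<lambda>j. space (Q 1) - A j)"
      unfolding decseq_def by blast
  qed (use AQ Q1.emeasure_finite in \<open>auto simp del: One_nat_def\<close>)
  moreover have "emeasure (Q 1) (\<Inter>j. space (Q 1) - A j) = 0"
  proof -
    have "AE y in Q 1. y \<notin> (\<Inter>j. space (Q 1) - A j)"
      using fin AE_true_density_pos[OF one] AE_space
    proof eventually_elim
      case (elim y)
      obtain r where r: "g y = ennreal r" "0 \<le> r" using elim(1) unfolding g_def[symmetric] by (cases "g y") auto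
      have p: "0 < p 1 \<theta>c y" using elim(2) by simp
      obtain j :: nat where "r / p 1 \<theta>c y \<le> j" using real_arch_simple by blast
      then have "r \<le> j * p 1 \<theta>c y" using p by (simp add: field_simps)
      then have "g y \<le> ennreal (real j) * pe 1 \<theta>c y"
        using r p by (simp add: ennreal_mult'[symmetric] ennreal_leI)
      moreover have "y \<in> space (Pi\<^sub>M {..<1} (\<lambda>_. S))"
        using elim(3) unfolding sets_eq_imp_space_eq[OF sets_PiM_P[OF \<theta>c, of "{..<1}"]] .
      ultimately show ?case by (auto simp: A_def)
    qed
    moreover have "(\<Inter>j. space (Q 1) - A j) \<in> sets (Q 1)"
    proof -
      have "(\<Inter>j. space (Q 1) - A j) = space (Q 1) - (\<Union>j. A j)" by auto
      moreover have "(\<Union>j. A j) \<in> sets (Q 1)" using AQ by (intro sets.countable_UN) blast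
      ultimately show ?thesis by (simp only: sets.Diff[OF sets.top])
    qed
    moreover have "{y \<in> space (Q 1). \<not> y \<notin> (\<Inter>j. space (Q 1) - A j)} = (\<Inter>j. space (Q 1) - A j)" by auto
    ultimately show ?thesis by (subst (asm) AE_iff_measurable[where N="\<Inter>j. space (Q 1) - A j"]) auto
  qed
  ultimately have "eventually (\<lambda>j. emeasure (Q 1) (space (Q 1) - A j) < ennreal (e / 8)) sequentially"
    using e by (intro order_tendstoD(2)) auto
  then obtain C :: nat where C: "emeasure (Q 1) (space (Q 1) - A C) \<le> ennreal (e / 8)"
    by (auto dest!: eventually_happens'[OF sequentially_bot] intro: less_imp_le)
  \<comment> \<open>The vanishing terms of the tail bound, with n / k - 2 as a lower estimate of the
    number of blocks; the factor 4 is (1/2)^(-2).\<close>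
  define G where "G n = 2 / (n * b) + (3 / 4) powr (n / k - 2) + C * (4 * exp (- (n * b))) * (2 * sqrt n / (a * t))" for n :: nat
  have "(\<lambda>n. 2 / (n * b)) \<longlonglongrightarrow> 0" using b by real_asymp
  moreover have "(\<lambda>n. (3 / 4) powr (n / k - 2)) \<longlonglongrightarrow> 0"
  proof -
    have "0 < 1 / real k" using k by simp
    moreover have "0 < - ln (3 / 4 :: real)" by simp
    moreover have "(\<lambda>n. exp (- ((n * c - 2) * d))) \<longlonglongrightarrow> 0" if "0 < c" "0 < d" for c d :: real
      using that by real_asymp
    ultimately have "(\<lambda>n. exp (- ((n * (1 / k) - 2) * (- ln (3 / 4 :: real))))) \<longlonglongrightarrow> 0" by blast
    then show ?thesis by (simp add: powr_def)
  qed
  moreover have "(\<lambda>n. C * (4 * exp (- (n * b))) * (2 * sqrt n / (a * t))) \<longlonglongrightarrow> 0"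
  proof -
    have "(\<lambda>n. exp (- (n * b)) * sqrt n) \<longlonglongrightarrow> 0" using b by real_asymp
    from tendsto_mult_left[OF this, of "C * 8 / (a * t)"] show ?thesis by (simp add: field_simps)
  qed
  ultimately have "G \<longlonglongrightarrow> 0 + 0 + 0"
    unfolding G_def by (intro tendsto_add)
  then have "eventually (\<lambda>n. G n < e / 8) sequentially" using e by (intro order_tendstoD(2)) auto
  then show ?thesis using eventually_ge_at_top[of "1::nat"]
  proof eventually_elim
    case (elim n)
    \<comment> \<open>One observation is set aside; the others are cut into complete blocks.\<close>
    define m where "m = (n - 1) div k"
    have mk: "1 + m * k \<le> n" using elim(2) 
    proof -
      have "m * k \<le> n - 1" unfolding m_def by (rule div_times_less_eq_dividend)
      then show ?thesis using elim(2) by linarith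
    qed
    have m: "real n / real k - 2 \<le> real m"
    proof -
      have "n - 1 = m * k + (n - 1) mod k" "(n - 1) mod k < k" using k by (auto simp: m_def)
      then have "n \<le> m * k + k" using elim(2) by linarith
      then have "real n \<le> (m + 1) * real k" by (simp add: algebra_simps flip: of_nat_mult of_nat_add)
      then have "real n / real k \<le> m + 1" using k by (simp add: field_simps)
      then show ?thesis by simp
    qed
    have "(3 / 4 :: real) ^ m = (3 / 4) powr m" by (simp add: powr_realpow)
    also have "\<dots> \<le> (3 / 4) powr (n / k - 2)" using m by (intro powr_mono') auto
    finally have p1: "(3 / 4 :: real) ^ m \<le> (3 / 4) powr (n / k - 2)" .
    have "(1 / 2 :: real) ^ m = (1 / 2) powr m" by (simp add: powr_realpow)
    also have "\<dots> \<le> (1 / 2) powr (n / k - 2)" using m by (intro powr_mono') auto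
    also have "\<dots> = 4 * exp (- (2 * (n * b)))"
    proof -
      have "(1 / 2 :: real) powr (n / k - 2) = exp (2 * ln 2 + - (2 * (n * b)))"
        using k by (simp add: powr_def b_def ln_div field_simps)
      also have "\<dots> = exp (2 * ln 2) * exp (- (2 * (n * b)))" by (rule exp_add)
      also have "exp (2 * ln 2) = (4::real)" by (simp add: exp_double)
      finally show ?thesis .
    qed
    finally have "(1 / 2 :: real) ^ m * exp (n * b) \<le> 4 * exp (- (2 * (n * b))) * exp (n * b)"
      by (rule mult_right_mono) simp
    also have "\<dots> = 4 * exp (- (n * b))" by (simp add: exp_add[symmetric])
    finally have p2: "(1 / 2 :: real) ^ m * exp (n * b) \<le> 4 * exp (- (n * b))" .
    have s: "0 < sqrt n" using elim(2) by simp
    have "real C * (1 / 2) ^ m * exp (n * b) * (2 / (a * (t / sqrt n))) = C * ((1 / 2) ^ m * exp (n * b)) * (2 * sqrt n / (a * t))"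
      using s by simp
    also have "\<dots> \<le> C * (4 * exp (- (n * b))) * (2 * sqrt n / (a * t))"
      using p2 a t by (intro mult_right_mono mult_left_mono) auto
    finally have p3: "real C * (1 / 2) ^ m * exp (n * b) * (2 / (a * (t / sqrt n))) \<le> C * (4 * exp (- (n * b))) * (2 * sqrt n / (a * t))" .
    have p4: "2 * (\<epsilon> / b + 1 / (n * b)) = e / 8 + 2 / (n * b)" using b by (simp add: \<epsilon>_def)
    have "emeasure (Q n) {y \<in> space (Q n). ennreal (t / sqrt n) < (\<integral>\<^sup>+\<theta>. indicator F \<theta> * f \<theta> * pe n \<theta> y \<partial>\<pi>) / marginal n y} \<le>
      emeasure (Q 1) (space (Q 1) - A C) +
      ennreal (2 * (\<epsilon> / b + 1 / (n * b)) + (3 / 4) ^ m + C * (1 / 2) ^ m * exp (n * b) * (2 / (a * (t / sqrt n))))"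
    proof (rule posterior_tail_bound[OF W(1) _ a b \<epsilon> W(3) F f A _ _ \<phi> kfar k(2) mk])
      show "(\<integral>\<^sup>+\<theta>. f \<theta> * pe 1 \<theta> y \<partial>\<pi>) \<le> ennreal (real C) * pe 1 \<theta>c y" if "y \<in> A C" for y
        using that by (simp add: A_def g_def)
    qed (use t s in \<open>auto simp: a_def\<close>)
    also have "\<dots> \<le> ennreal (e / 8) + ennreal (e / 8 + G n)"
    proof (rule add_mono[OF C ennreal_leI])
      show "2 * (\<epsilon> / b + 1 / (n * b)) + (3 / 4) ^ m + C * (1 / 2) ^ m * exp (n * b) * (2 / (a * (t / sqrt n))) \<le> e / 8 + G n"
        unfolding G_def p4 using p1 p3 by linarith
    qed
    also have "\<dots> \<le> ennreal (e / 8) + ennreal (e / 8 + e / 8)" using elim(1) by (intro add_mono ennreal_leI) auto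
    also have "\<dots> = ennreal (3 * e / 8)" using e by (simp add: ennreal_plus[symmetric] del: ennreal_plus)
    also have "\<dots> \<le> ennreal e" using e by (intro ennreal_leI) simp
    finally show ?case .
  qed
qed

section \<open>The posterior along an infinite data sequence\<close>

abbreviation data :: "(nat \<Rightarrow> 'a) measure" where "data \<equiv> Pi\<^sub>M UNIV (\<lambda>_. P \<theta>c)"

lemma prob_data: "prob_space data"
  by (rule prob_PiM_P[OF \<theta>c])

lemma measurable_restrict_data: "(\<lambda>\<xi>. restrict \<xi> {..<n}) \<in> measurable data (Q n)"
  by (rule measurable_restrict_subset) simp

lemma restrict_in_space: "\<xi> \<in> space data \<Longrightarrow> restrict \<xi> {..<n} \<in> space (Q n)"
  using measurable_space[OF measurable_restrict_data] .

lemma distr_restrict_data: "distr data (Q n) (\<lambda>\<xi>. restrict \<xi> {..<n}) = Q n"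
proof -
  interpret product_prob_space "\<lambda>_::nat. P \<theta>c" UNIV
    using prob_P[OF \<theta>c] by (simp add: product_prob_spaceI)
  show ?thesis by (rule distr_PiM_restrict_finite) auto
qed

lemma posterior_eq:
  "posterior \<pi> p n \<xi> = density \<pi> (\<lambda>\<theta>. pe n \<theta> (restrict \<xi> {..<n}) / marginal n (restrict \<xi> {..<n}))"
  by (simp add: posterior_def marginal_def)

lemma space_posterior[simp]: "space (posterior \<pi> p n \<xi>) = space \<pi>"
  and sets_posterior[simp, measurable_cong]: "sets (posterior \<pi> p n \<xi>) = sets \<pi>"
  by (simp_all add: posterior_eq)

text \<open>Bayes' formula; the conventions of \<open>ennreal\<close> keep it valid when the
  marginal is 0 or infinite.\<close>

lemma nn_integral_posterior:
  assumes n: "n \<ge> 1" and \<xi>: "\<xi> \<in> space data" and f[measurable]: "f \<in> borel_measurable \<pi>"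
  shows "(\<integral>\<^sup>+\<theta>. f \<theta> \<partial>posterior \<pi> p n \<xi>) =
    (\<integral>\<^sup>+\<theta>. f \<theta> * pe n \<theta> (restrict \<xi> {..<n}) \<partial>\<pi>) / marginal n (restrict \<xi> {..<n})"
proof -
  note [measurable] = pe_measurable(2)[OF n sets_PiM_P[OF \<theta>c] restrict_in_space[OF \<xi>]]
  have "(\<integral>\<^sup>+\<theta>. f \<theta> \<partial>posterior \<pi> p n \<xi>) = (\<integral>\<^sup>+\<theta>. pe n \<theta> (restrict \<xi> {..<n}) / marginal n (restrict \<xi> {..<n}) * f \<theta> \<partial>\<pi>)"
    unfolding posterior_eq by (rule nn_integral_density) measurable
  also have "\<dots> = (\<integral>\<^sup>+\<theta>. f \<theta> * pe n \<theta> (restrict \<xi> {..<n}) / marginal n (restrict \<xi> {..<n}) \<partial>\<pi>)"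
    by (simp add: divide_ennreal_def mult_ac)
  also have "\<dots> = (\<integral>\<^sup>+\<theta>. f \<theta> * pe n \<theta> (restrict \<xi> {..<n}) \<partial>\<pi>) / marginal n (restrict \<xi> {..<n})"
    by (rule nn_integral_divide) measurable
  finally show ?thesis .
qed

text \<open>The total mass is the marginal divided by itself, which is 1 or, for the values 0 and
  \<infinity>, 0.\<close>

lemma posterior_prob_or_null:
  assumes n: "n \<ge> 1" and \<xi>: "\<xi> \<in> space data"
  shows "prob_space (posterior \<pi> p n \<xi>) \<or> emeasure (posterior \<pi> p n \<xi>) (space \<pi>) = 0"
    and "\<not> prob_space (posterior \<pi> p n \<xi>) \<Longrightarrow> marginal n (restrict \<xi> {..<n}) = 0 \<or> marginal n (restrict \<xi> {..<n}) = \<infinity>"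
    and "finite_measure (posterior \<pi> p n \<xi>)"
proof -
  let ?m = "marginal n (restrict \<xi> {..<n})"
  have "(\<integral>\<^sup>+\<theta>. 1 \<partial>posterior \<pi> p n \<xi>) = ?m / ?m"
    by (subst nn_integral_posterior[OF n \<xi>]) (simp_all add: marginal_def)
  then have e: "emeasure (posterior \<pi> p n \<xi>) (space \<pi>) = ?m / ?m" by simp
  have c: "?m / ?m = 1" if "?m \<noteq> 0" "?m \<noteq> \<infinity>"
    using that by (intro ennreal_divide_self) (auto simp: top.not_eq_extremum)
  have c0: "?m / ?m = 0" if "?m = 0 \<or> ?m = \<infinity>"
    using that by (auto simp: divide_ennreal_def)
  have pr: "prob_space (posterior \<pi> p n \<xi>)" if "?m \<noteq> 0" "?m \<noteq> \<infinity>"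
    using e c[OF that] by (intro prob_spaceI) simp
  show "prob_space (posterior \<pi> p n \<xi>) \<or> emeasure (posterior \<pi> p n \<xi>) (space \<pi>) = 0"
    using pr c0 e by metis
  show "?m = 0 \<or> ?m = \<infinity>" if "\<not> prob_space (posterior \<pi> p n \<xi>)"
    using pr that by blast
  have "emeasure (posterior \<pi> p n \<xi>) (space \<pi>) \<noteq> \<infinity>"
    using e c c0 by (metis ennreal_one_neq_top ennreal_zero_neq_top infinity_ennreal_def)
  then show "finite_measure (posterior \<pi> p n \<xi>)" by (intro finite_measureI) simp
qed

lemma measurable_nn_integral_posterior:
  assumes n: "n \<ge> 1" and f: "f \<in> borel_measurable \<pi>"
  shows "(\<lambda>\<xi>. \<integral>\<^sup>+\<theta>. f \<theta> \<partial>posterior \<pi> p n \<xi>) \<in> borel_measurable data"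
proof -
  note [measurable] = measurable_compose[OF measurable_restrict_data marginal_measurable[OF n sets_PiM_P[OF \<theta>c] f]]
    measurable_compose[OF measurable_restrict_data marginal_measurable'[OF n sets_PiM_P[OF \<theta>c]]]
  have "(\<lambda>\<xi>. (\<integral>\<^sup>+\<theta>. f \<theta> * pe n \<theta> (restrict \<xi> {..<n}) \<partial>\<pi>) / marginal n (restrict \<xi> {..<n})) \<in> borel_measurable data"
    by measurable
  then show ?thesis
    by (rule measurable_cong[THEN iffD1, rotated]) (simp only: nn_integral_posterior[OF n _ f])
qed

lemma measurable_measure_posterior:
  assumes n: "n \<ge> 1" and A: "A \<in> sets \<pi>"
  shows "(\<lambda>\<xi>. measure (posterior \<pi> p n \<xi>) A) \<in> borel_measurable data"
proof -
  have "(\<lambda>\<xi>. enn2real (\<integral>\<^sup>+\<theta>. indicator A \<theta> \<partial>posterior \<pi> p n \<xi>)) \<in> borel_measurable data"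
    using measurable_nn_integral_posterior[OF n, of "indicator A"] A by measurable
  then show ?thesis using A by (simp add: measure_def)
qed

text \<open>The marginal has integral 1 against \<open>\<nu> n\<close>, and the law of the sample is
  dominated by \<open>\<nu> n\<close>.\<close>

lemma AE_marginal_finite:
  assumes n: "n \<ge> 1" shows "AE y in Q n. marginal n y \<noteq> \<infinity>"
proof -
  have "(\<integral>\<^sup>+y. 1 * (\<integral>\<^sup>+\<theta>. 1 * pe n \<theta> y \<partial>\<pi>) \<partial>\<nu> n) = (\<integral>\<^sup>+\<theta>. 1 * (\<integral>\<^sup>+y. 1 \<partial>Pi\<^sub>M {..<n} (\<lambda>_. P \<theta>)) \<partial>\<pi>)"
    by (rule nn_integral_swap[OF n]) auto
  also have "\<dots> = (\<integral>\<^sup>+\<theta>. 1 \<partial>\<pi>)"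
    using prob_space.emeasure_space_1[OF prob_PiM_P] by (intro nn_integral_cong) simp
  also have "\<dots> = 1" by (simp add: prior.emeasure_space_1)
  finally have "(\<integral>\<^sup>+y. marginal n y \<partial>\<nu> n) \<noteq> \<infinity>" by (simp add: marginal_def)
  then have "AE y in \<nu> n. marginal n y \<noteq> \<infinity>"
    by (rule nn_integral_PInf_AE[OF marginal_measurable'[OF n sets_\<nu>[OF n]]])
  then show ?thesis
    unfolding p_density[OF n \<theta>c] by (subst AE_density) (use pe_measurable(1)[OF n sets_\<nu>[OF n] \<theta>c] in auto)
qed

text \<open>The posterior integral is multiplied back by the marginal. Where the marginal vanishes
  there is no posterior to speak of, but then the likelihood is zero for almost every parameter and
  so is the numerator.\<close>

lemma AE_numerator_finite:
  assumes f[measurable]: "f \<in> borel_measurable \<pi>"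
    and int: "AE \<xi> in data. prob_space (posterior \<pi> p 1 \<xi>) \<longrightarrow> (\<integral>\<^sup>+\<theta>. f \<theta> \<partial>posterior \<pi> p 1 \<xi>) < \<infinity>"
  shows "AE y in Q 1. (\<integral>\<^sup>+\<theta>. f \<theta> * pe 1 \<theta> y \<partial>\<pi>) < \<infinity>"
proof -
  have one: "(1::nat) \<ge> 1" by simp
  note [measurable] = marginal_measurable[OF one sets_PiM_P[OF \<theta>c] f] measurable_restrict_data
  have mf: "AE \<xi> in data. marginal 1 (restrict \<xi> {..<1}) \<noteq> \<infinity>"
  proof (rule AE_distrD[OF measurable_restrict_data])
    show "AE y in distr data (Q 1) (\<lambda>\<xi>. restrict \<xi> {..<1}). marginal 1 y \<noteq> \<infinity>"
      unfolding distr_restrict_data by (rule AE_marginal_finite[OF one])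
  qed
  have "AE \<xi> in data. (\<integral>\<^sup>+\<theta>. f \<theta> * pe 1 \<theta> (restrict \<xi> {..<1}) \<partial>\<pi>) < \<infinity>"
    using int mf AE_space
  proof eventually_elim
    case (elim \<xi>)
    let ?y = "restrict \<xi> {..<1}"
    note pm[measurable] = pe_measurable(2)[OF one sets_PiM_P[OF \<theta>c] restrict_in_space[OF elim(3)]]
    show ?case
    proof (cases "marginal 1 ?y = 0")
      case True
      then have "AE \<theta> in \<pi>. pe 1 \<theta> ?y = 0"
        unfolding marginal_def nn_integral_0_iff_AE[OF pm] .
      then have "AE \<theta> in \<pi>. f \<theta> * pe 1 \<theta> ?y = 0" by eventually_elim simp
      then have "(\<integral>\<^sup>+\<theta>. f \<theta> * pe 1 \<theta> ?y \<partial>\<pi>) = 0"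
        unfolding nn_integral_0_iff_AE[OF borel_measurable_times_ennreal[OF f pm]] .
      then show ?thesis by simp
    next
      case False
      then have "(\<integral>\<^sup>+\<theta>. f \<theta> \<partial>posterior \<pi> p 1 \<xi>) < \<infinity>"
        using elim posterior_prob_or_null(2)[OF one elim(3)] by blast
      then have "(\<integral>\<^sup>+\<theta>. f \<theta> * pe 1 \<theta> ?y \<partial>\<pi>) / marginal 1 ?y < \<infinity>"
        by (simp only: nn_integral_posterior[OF one elim(3) f])
      then have "(\<integral>\<^sup>+\<theta>. f \<theta> * pe 1 \<theta> ?y \<partial>\<pi>) / marginal 1 ?y * marginal 1 ?y < \<infinity>"
        using elim(2) by (simp add: ennreal_mult_less_top top.not_eq_extremum)
      moreover have "(\<integral>\<^sup>+\<theta>. f \<theta> * pe 1 \<theta> ?y \<partial>\<pi>) / marginal 1 ?y * marginal 1 ?y = (\<integral>\<^sup>+\<theta>. f \<theta> * pe 1 \<theta> ?y \<partial>\<pi>)"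
      proof -
        have "marginal 1 ?y / marginal 1 ?y = 1"
          using False elim(2) by (intro ennreal_divide_self) (auto simp: top.not_eq_extremum)
        then show ?thesis by (simp add: ennreal_divide_times)
      qed
      ultimately show ?thesis by simp
    qed
  qed
  then have "AE y in distr data (Q 1) (\<lambda>\<xi>. restrict \<xi> {..<1}). (\<integral>\<^sup>+\<theta>. f \<theta> * pe 1 \<theta> y \<partial>\<pi>) < \<infinity>"
    by (subst AE_distr_iff[OF measurable_restrict_data]) measurable
  then show ?thesis unfolding distr_restrict_data .
qed

text \<open>The event depends on the first n observations only, so its probability is the one
  computed under \<open>Q n\<close>.\<close>

lemma posterior_tail_prob:
  assumes F: "F \<in> sets \<pi>" and f: "f \<in> borel_measurable \<pi>"
    and fin: "AE \<xi> in data. prob_space (posterior \<pi> p 1 \<xi>) \<longrightarrow> (\<integral>\<^sup>+\<theta>. f \<theta> \<partial>posterior \<pi> p 1 \<xi>) < \<infinity>"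
    and KL: "\<And>\<epsilon>. 0 < \<epsilon> \<Longrightarrow> \<exists>W\<in>sets \<pi>. 0 < measure \<pi> W \<and> (\<forall>\<theta>\<in>W. KL_ext (P \<theta>c) (P \<theta>) < ereal \<epsilon>)"
    and \<phi>: "\<And>n. \<phi> n \<in> borel_measurable (Pi\<^sub>M {..<n} (\<lambda>_. S))"
      "\<And>n y. y \<in> space (Pi\<^sub>M {..<n} (\<lambda>_. S)) \<Longrightarrow> \<phi> n y \<in> {0..1::real}"
    and \<phi>_true: "(\<lambda>n. \<integral>y. \<phi> n y \<partial>Q n) \<longlonglongrightarrow> 0"
    and \<phi>_far: "(\<lambda>n. SUP \<theta>\<in>F. ennreal (\<integral>y. 1 - \<phi> n y \<partial>Pi\<^sub>M {..<n} (\<lambda>_. P \<theta>))) \<longlonglongrightarrow> 0"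
    and t: "0 < t" and e: "0 < e"
  shows "eventually (\<lambda>n. measure data {\<xi> \<in> space data. ennreal (t / sqrt n) <
    (\<integral>\<^sup>+\<theta>. indicator F \<theta> * f \<theta> \<partial>posterior \<pi> p n \<xi>)} \<le> e) sequentially"
proof -
  have "eventually (\<lambda>n. emeasure (Q n) {y \<in> space (Q n). ennreal (t / sqrt n) <
    (\<integral>\<^sup>+\<theta>. indicator F \<theta> * f \<theta> * pe n \<theta> y \<partial>\<pi>) / marginal n y} \<le> ennreal e) sequentially"
    by (rule posterior_tail_tendsto[OF F f AE_numerator_finite[OF f fin] KL \<phi> \<phi>_true \<phi>_far t e])
  then show ?thesis
  using eventually_ge_at_top[of "1::nat"]
proof eventually_elim
  case (elim n)
  interpret D: prob_space data by (rule prob_data)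
  have fF: "(\<lambda>\<theta>. indicator F \<theta> * f \<theta>) \<in> borel_measurable \<pi>"
    by (intro borel_measurable_times_ennreal borel_measurable_indicator F f)
  note [measurable] = marginal_measurable[OF elim(2) sets_PiM_P[OF \<theta>c] fF] marginal_measurable'[OF elim(2) sets_PiM_P[OF \<theta>c]]
  let ?B = "{y \<in> space (Q n). ennreal (t / sqrt n) < (\<integral>\<^sup>+\<theta>. indicator F \<theta> * f \<theta> * pe n \<theta> y \<partial>\<pi>) / marginal n y}"
  have B: "?B \<in> sets (Q n)" by measurable
  have "{\<xi> \<in> space data. ennreal (t / sqrt n) < (\<integral>\<^sup>+\<theta>. indicator F \<theta> * f \<theta> \<partial>posterior \<pi> p n \<xi>)} =
      (\<lambda>\<xi>. restrict \<xi> {..<n}) -` ?B \<inter> space data"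
    using nn_integral_posterior[OF elim(2) _ fF] restrict_in_space by auto
  then have "emeasure data {\<xi> \<in> space data. ennreal (t / sqrt n) < (\<integral>\<^sup>+\<theta>. indicator F \<theta> * f \<theta> \<partial>posterior \<pi> p n \<xi>)} =
      emeasure (distr data (Q n) (\<lambda>\<xi>. restrict \<xi> {..<n})) ?B"
    by (simp only: emeasure_distr[OF measurable_restrict_data B])
  also have "\<dots> \<le> ennreal e" unfolding distr_restrict_data by (rule elim(1))
  finally show ?case using e by (simp add: D.emeasure_eq_measure)
qed
qed

end

section \<open>Slutsky's theorem and tightness\<close>

text \<open>The ramps \<open>cts_step\<close> determine weak convergence on the line; being bounded
  and uniformly continuous, they change noticeably only on the improbable event that Y and Z are far
  apart.\<close>

lemma weak_conv_of_close:
  fixes Y Z :: "nat \<Rightarrow> 'w \<Rightarrow> real"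
  assumes M: "prob_space M" and Y[measurable]: "\<And>n. Y n \<in> borel_measurable M" and Z[measurable]: "\<And>n. Z n \<in> borel_measurable M"
    and L: "real_distribution L"
    and close: "\<And>\<delta> e. 0 < \<delta> \<Longrightarrow> 0 < e \<Longrightarrow> eventually (\<lambda>n. measure M {\<omega> \<in> space M. \<bar>Y n \<omega> - Z n \<omega>\<bar> > \<delta>} \<le> e) sequentially"
    and conv: "\<And>f :: real \<Rightarrow> real. continuous_on UNIV f \<Longrightarrow> bounded (range f) \<Longrightarrow> (\<lambda>n. \<integral>\<omega>. f (Z n \<omega>) \<partial>M) \<longlonglongrightarrow> (\<integral>z. f z \<partial>L)"
  shows "weak_conv_m (\<lambda>n. distr M borel (Y n)) L"
proof (rule integral_cts_step_conv_imp_weak_conv)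
  interpret M: prob_space M by fact
  show "real_distribution (distr M borel (Y n))" for n by (rule M.real_distribution_distr) simp
  show "real_distribution L" by fact
  fix x y :: real assume xy: "x < y"
  define g where "g = cts_step x y"
  have g01: "0 \<le> g z" "g z \<le> 1" for z using xy by (auto simp: g_def cts_step_def field_simps)
  have unif: "uniformly_continuous_on UNIV g" unfolding g_def by (rule cts_step_uniformly_continuous[OF xy])
  then have cont: "continuous_on UNIV g" by (rule uniformly_continuous_imp_continuous)
  then have [measurable]: "g \<in> borel_measurable borel" by (rule borel_measurable_continuous_onI)
  have "bounded (range g)" using g01 by (intro boundedI[of _ 1]) (auto simp: abs_of_nonneg)
  from conv[OF cont this] have cZ: "(\<lambda>n. \<integral>\<omega>. g (Z n \<omega>) \<partial>M) \<longlonglongrightarrow> (\<integral>z. g z \<partial>L)" .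
  have gi: "integrable M (\<lambda>\<omega>. g (Y n \<omega>))" "integrable M (\<lambda>\<omega>. g (Z n \<omega>))" for n
    using g01 by (auto intro!: M.integrable_const_bound[where B=1])
  have "(\<lambda>n. (\<integral>\<omega>. g (Y n \<omega>) \<partial>M) - (\<integral>\<omega>. g (Z n \<omega>) \<partial>M)) \<longlonglongrightarrow> 0"
  proof (rule LIMSEQ_I)
    fix r :: real assume r: "0 < r"
    obtain d where d: "0 < d" "\<And>u v. dist u v < d \<Longrightarrow> dist (g u) (g v) < r / 3"
      using unif r unfolding uniformly_continuous_on_def by (metis UNIV_I divide_pos_pos zero_less_numeral)
    have "eventually (\<lambda>n. measure M {\<omega> \<in> space M. \<bar>Y n \<omega> - Z n \<omega>\<bar> > d / 2} \<le> r / 3) sequentially"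
      using d r by (intro close) auto
    then obtain n0 where n0: "\<And>n. n \<ge> n0 \<Longrightarrow> measure M {\<omega> \<in> space M. \<bar>Y n \<omega> - Z n \<omega>\<bar> > d / 2} \<le> r / 3"
      unfolding eventually_sequentially by blast
    have "norm ((\<integral>\<omega>. g (Y n \<omega>) \<partial>M) - (\<integral>\<omega>. g (Z n \<omega>) \<partial>M) - 0) < r" if "n \<ge> n0" for n
    proof -
      let ?B = "{\<omega> \<in> space M. \<bar>Y n \<omega> - Z n \<omega>\<bar> > d / 2}"
      have B: "?B \<in> sets M" by measurable
      have iB: "integrable M (\<lambda>\<omega>. r / 3 + indicator ?B \<omega>)"
        using B by (intro Bochner_Integration.integrable_add M.integrable_const integrable_real_indicator) (auto simp: less_top[symmetric])
      have "\<bar>(\<integral>\<omega>. g (Y n \<omega>) \<partial>M) - (\<integral>\<omega>. g (Z n \<omega>) \<partial>M)\<bar> = \<bar>\<integral>\<omega>. g (Y n \<omega>) - g (Z n \<omega>) \<partial>M\<bar>"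
        using gi by (simp add: Bochner_Integration.integral_diff)
      also have "\<dots> \<le> (\<integral>\<omega>. \<bar>g (Y n \<omega>) - g (Z n \<omega>)\<bar> \<partial>M)" by (rule integral_abs_bound)
      also have "\<dots> \<le> (\<integral>\<omega>. r / 3 + indicator ?B \<omega> \<partial>M)"
      proof (intro integral_mono iB)
        show "integrable M (\<lambda>\<omega>. \<bar>g (Y n \<omega>) - g (Z n \<omega>)\<bar>)" using gi by auto
        fix \<omega> assume \<omega>: "\<omega> \<in> space M"
        show "\<bar>g (Y n \<omega>) - g (Z n \<omega>)\<bar> \<le> r / 3 + indicator ?B \<omega>"
        proof (cases "\<omega> \<in> ?B")
          case True
          then show ?thesis using g01[of "Y n \<omega>"] g01[of "Z n \<omega>"] r by (simp add: abs_le_iff)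
        next
          case False
          then have "dist (Y n \<omega>) (Z n \<omega>) < d" using \<omega> d(1) by (simp add: dist_real_def)
          then show ?thesis using d(2)[of "Y n \<omega>" "Z n \<omega>"] False by (simp add: dist_real_def)
        qed
      qed
      also have "\<dots> = r / 3 + measure M ?B"
        using B by (subst Bochner_Integration.integral_add) (auto simp: M.prob_space less_top[symmetric])
      also have "\<dots> < r" using n0[OF that] r by simp
      finally show ?thesis by simp
    qed
    then show "\<exists>n0. \<forall>n\<ge>n0. norm ((\<integral>\<omega>. g (Y n \<omega>) \<partial>M) - (\<integral>\<omega>. g (Z n \<omega>) \<partial>M) - 0) < r" by blast
  qed
  from tendsto_add[OF this cZ] have "(\<lambda>n. \<integral>\<omega>. g (Y n \<omega>) \<partial>M) \<longlonglongrightarrow> (\<integral>z. g z \<partial>L)" by simp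
  then show "(\<lambda>n. integral\<^sup>L (distr M borel (Y n)) (cts_step x y)) \<longlonglongrightarrow> integral\<^sup>L L (cts_step x y)"
    by (subst integral_distr) (auto simp: g_def[symmetric])
qed

text \<open>The ramp f below is 1 beyond norm B and 0 up to norm B - 1: a continuous majorant of the
  tail event whose mean under the limit law vanishes as B grows.\<close>

lemma conv_in_distr_tight:
  fixes X :: "nat \<Rightarrow> 'w \<Rightarrow> 'b::euclidean_space"
  assumes M: "prob_space M" and L: "prob_space L" "sets L = sets borel" and X: "conv_in_distr M X L" and e: "0 < e"
  obtains B where "0 < B" "eventually (\<lambda>n. measure M {\<omega> \<in> space M. norm (X n \<omega>) > B} \<le> e) sequentially"
proof -
  interpret M: prob_space M by fact
  interpret L: prob_space L by fact
  note [measurable_cong] = L(2)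
  have Xm[measurable]: "X n \<in> borel_measurable M" for n using X by (simp add: conv_in_distr_def)
  define f where "f B z = min 1 (max 0 (norm z - B + 1))" for B :: real and z :: 'b
  have f01: "0 \<le> f B z" "f B z \<le> 1" for B z by (auto simp: f_def)
  have fc: "continuous_on UNIV (f B)" for B unfolding f_def[abs_def] by (intro continuous_intros)
  have [measurable]: "f B \<in> borel_measurable borel" for B by (rule borel_measurable_continuous_onI[OF fc])
  have "(\<lambda>j. \<integral>z. f (real j) z \<partial>L) \<longlonglongrightarrow> (\<integral>z. 0 \<partial>L)"
  proof (rule integral_dominated_convergence[where w="\<lambda>_. 1"])
    show "AE z in L. (\<lambda>j. f (real j) z) \<longlonglongrightarrow> 0"
    proof (rule AE_I2)
      fix z :: 'b
      obtain j0 :: nat where j0: "norm z + 1 \<le> j0" using real_arch_simple by blast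
      have "eventually (\<lambda>j. f (real j) z = 0) sequentially"
        using eventually_ge_at_top[of j0]
      proof eventually_elim
        case (elim j)
        then have "real j0 \<le> real j" by simp
        then show ?case using j0 by (simp add: f_def)
      qed
      then show "(\<lambda>j. f (real j) z) \<longlonglongrightarrow> 0" by (rule tendsto_eventually)
    qed
  qed (use f01 in \<open>auto\<close>)
  then have "eventually (\<lambda>j. (\<integral>z. f (real j) z \<partial>L) < e) sequentially"
    using e by (intro order_tendstoD(2)) auto
  then have "eventually (\<lambda>j. 1 \<le> j \<and> (\<integral>z. f (real j) z \<partial>L) < e) sequentially"
    using eventually_ge_at_top[of "1::nat"] by eventually_elim simp
  then obtain j :: nat where j: "1 \<le> j" "(\<integral>z. f (real j) z \<partial>L) < e"
    by (auto dest!: eventually_happens'[OF sequentially_bot])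
  have "bounded (range (f (real j)))" using f01 by (intro boundedI[of _ 1]) (auto simp: abs_of_nonneg)
  with X fc have "(\<lambda>n. \<integral>\<omega>. f (real j) (X n \<omega>) \<partial>M) \<longlonglongrightarrow> (\<integral>z. f (real j) z \<partial>L)"
    unfolding conv_in_distr_def by blast
  from order_tendstoD(2)[OF this j(2)]
  have "eventually (\<lambda>n. measure M {\<omega> \<in> space M. norm (X n \<omega>) > real j} \<le> e) sequentially"
  proof eventually_elim
    case (elim n)
    have "measure M {\<omega> \<in> space M. norm (X n \<omega>) > real j} = (\<integral>\<omega>. indicator {\<omega> \<in> space M. norm (X n \<omega>) > real j} \<omega> \<partial>M)"
      by simp
    also have "\<dots> \<le> (\<integral>\<omega>. f (real j) (X n \<omega>) \<partial>M)"
    proof (rule integral_mono)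
      show "integrable M (indicator {\<omega> \<in> space M. norm (X n \<omega>) > real j} :: _ \<Rightarrow> real)"
        by (intro integrable_real_indicator) (auto simp: less_top[symmetric])
      show "integrable M (\<lambda>\<omega>. f (real j) (X n \<omega>))"
        using f01 by (intro M.integrable_const_bound[where B=1]) auto
      show "(indicator {\<omega> \<in> space M. norm (X n \<omega>) > real j} \<omega> :: real) \<le> f (real j) (X n \<omega>)" for \<omega>
        by (auto simp: f_def indicator_def)
    qed
    finally show ?case using elim by simp
  qed
  then show thesis using that[of "real j"] j by simp
qed

section \<open>Asymptotic normality of the posterior CVaR\<close>

lemma borel_measurable_borel_on:
  assumes "sets M = sets (borel_on S)" "g \<in> borel_measurable borel"
  shows "g \<in> borel_measurable M"
  unfolding measurable_cong_sets[OF assms(1) refl] by (rule measurable_restrict_space1[OF assms(2)])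

text \<open>Written as an integral of \<open>p 1 \<theta>\<close> against a fixed measure, the mean
  inherits measurability in \<theta> from the density; g is read on coordinate 0 of a sample of size
  1.\<close>

lemma (in dominated_model) measurable_integral_kernel:
  fixes g :: "'a \<Rightarrow> real"
  assumes g: "\<And>\<theta>. \<theta> \<in> space \<pi> \<Longrightarrow> integrable (P \<theta>) g"
    and p0: "\<And>\<theta> y. \<theta> \<in> space \<pi> \<Longrightarrow> y \<in> space (Pi\<^sub>M {..<1} (\<lambda>_. S)) \<Longrightarrow> 0 \<le> p 1 \<theta> y"
  shows "(\<lambda>\<theta>. \<integral>x. g x \<partial>P \<theta>) \<in> borel_measurable \<pi>"
proof -
  have one: "(1::nat) \<ge> 1" by simp
  interpret \<nu>1: sigma_finite_measure "\<nu> 1" by (rule \<nu>[OF one])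
  note s\<nu> = sets_\<nu>[OF one]
  have "g \<in> borel_measurable (P \<theta>c)" using g[OF \<theta>c] by auto
  then have "g \<in> borel_measurable S" unfolding measurable_cong_sets[OF sets_P[OF \<theta>c] refl] .
  then have "(\<lambda>y. g (y 0)) \<in> borel_measurable (Pi\<^sub>M {..<1::nat} (\<lambda>_. S))"
    by (intro measurable_compose[OF measurable_component_singleton]) auto
  then have g0: "(\<lambda>y. g (y 0)) \<in> borel_measurable (\<nu> 1)" unfolding measurable_cong_sets[OF s\<nu> refl] .
  have pm: "(\<lambda>(\<theta>, y). p 1 \<theta> y) \<in> borel_measurable (\<pi> \<Otimes>\<^sub>M \<nu> 1)"
    using p_measurable[OF one] unfolding measurable_cong_sets[OF sets_pair_measure_cong[OF refl s\<nu>] refl] .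
  have "(\<lambda>(\<theta>, y). p 1 \<theta> y * g (y 0)) \<in> borel_measurable (\<pi> \<Otimes>\<^sub>M \<nu> 1)"
    using pm unfolding split_beta'
    by (intro borel_measurable_times measurable_compose[OF measurable_snd g0])
  then have "(\<lambda>\<theta>. \<integral>y. p 1 \<theta> y * g (y 0) \<partial>\<nu> 1) \<in> borel_measurable \<pi>"
    by (rule \<nu>1.borel_measurable_lebesgue_integral)
  moreover have "(\<integral>y. p 1 \<theta> y * g (y 0) \<partial>\<nu> 1) = (\<integral>x. g x \<partial>P \<theta>)" if \<theta>: "\<theta> \<in> space \<pi>" for \<theta>
  proof -
    have "(\<lambda>y. p 1 \<theta> y) \<in> borel_measurable (\<nu> 1)"
      using measurable_compose[OF measurable_Pair1'[OF \<theta>] pm] by simp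
    then have "(\<integral>y. p 1 \<theta> y * g (y 0) \<partial>\<nu> 1) = (\<integral>y. g (y 0) \<partial>density (\<nu> 1) (\<lambda>y. ennreal (p 1 \<theta> y)))"
      using p0[OF \<theta>] sets_eq_imp_space_eq[OF s\<nu>] by (subst integral_density[OF g0]) auto
    then show ?thesis
      unfolding p_density[OF one \<theta>, symmetric] using integral_component(2)[OF \<theta> _ g[OF \<theta>], of 0 "1::nat"] by simp
  qed
  ultimately show ?thesis by (rule measurable_cong[THEN iffD1, rotated])
qed

lemma has_derivative_within_bound:
  fixes f :: "'a::real_normed_vector \<Rightarrow> real"
  assumes "(f has_derivative f') (at a within S)" "0 < e"
  obtains r where "0 < r" "\<And>y. y \<in> S \<Longrightarrow> norm (y - a) < r \<Longrightarrow> \<bar>f y - f a - f' (y - a)\<bar> \<le> e * norm (y - a)"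
  using assms unfolding has_derivative_within_alt by (metis real_norm_def)

text \<open>The constant 1 is an admissible test function, so mass 1 passes to the limit. Applied to
  the Bernstein-von Mises hypothesis, this normalises \<open>mv_normal\<close> without evaluating a
  Gaussian integral.\<close>

lemma prob_space_of_conv_in_distr:
  assumes "prob_space M" "conv_in_distr M X L"
  shows "prob_space L"
proof -
  interpret prob_space M by fact
  have "continuous_on UNIV (\<lambda>_. 1 :: real)" "bounded (range (\<lambda>_. 1 :: real))"
    by (auto intro!: boundedI[of _ 1])
  with assms(2) have "(\<lambda>n. \<integral>\<omega>. (\<lambda>_. 1 :: real) (X n \<omega>) \<partial>M) \<longlonglongrightarrow> (\<integral>z. (\<lambda>_. 1) z \<partial>L)"
    unfolding conv_in_distr_def by blast
  then have "(\<lambda>n::nat. 1 :: real) \<longlonglongrightarrow> measure L (space L)" by (simp add: prob_space)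
  then have "measure L (space L) = 1" by (simp add: LIMSEQ_const_iff)
  then have "emeasure L (space L) = 1"
    by (cases "emeasure L (space L)") (auto simp: measure_def)
  then show ?thesis by (rule prob_spaceI)
qed

lemma measure_diff_le_tv_dist:
  assumes "finite_measure M" "finite_measure N" "A \<in> sets M"
  shows "\<bar>measure M A - measure N A\<bar> \<le> tv_dist M N"
  using tv_dist_le_iff[OF assms(1,2), of "tv_dist M N"] assms(3) by blast

lemma measurable_mv_normal:
  fixes S :: "real^'l^'l" and m :: "'w \<Rightarrow> real^'l"
  assumes [measurable]: "m \<in> borel_measurable M" "A \<in> sets borel"
  shows "(\<lambda>\<xi>. measure (mv_normal (m \<xi>) S) A) \<in> borel_measurable M"
proof -
  have "emeasure (mv_normal \<mu> S) A = (\<integral>\<^sup>+z. ennreal (exp (- ((z - \<mu>) \<bullet> (matrix_inv S *v (z - \<mu>))) / 2) / sqrt ((2 * pi) ^ CARD('l) * det S)) * indicator A z \<partial>lborel)" for \<mu>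
    unfolding mv_normal_def by (rule emeasure_density) measurable
  moreover have "(\<lambda>\<xi>. \<integral>\<^sup>+z. ennreal (exp (- ((z - m \<xi>) \<bullet> (matrix_inv S *v (z - m \<xi>))) / 2) / sqrt ((2 * pi) ^ CARD('l) * det S)) * indicator A z \<partial>lborel) \<in> borel_measurable M"
    by measurable
  ultimately show ?thesis by (simp add: measure_def)
qed

text \<open>Sample sizes in the hypotheses on the posterior start at 1; at n = 0 the factor
  \<open>sqrt 0\<close> makes Y constant. \<open>CVaR_wellposed\<close> says that CVaR is a genuine
  number, as a Bochner integral may default to 0. It gives the variational formula for every n and,
  at n = 1, integrability of the positive part of the cost.\<close>

theorem theorem4p3:
  fixes \<Theta> :: "(real^'l) set" and \<Xi> :: "(real^'m) set" and \<X> :: "(real^'d) set"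
    and \<pi> :: "(real^'l) measure"
    and P :: "real^'l \<Rightarrow> (real^'m) measure"
    and \<nu> :: "nat \<Rightarrow> (nat \<Rightarrow> real^'m) measure"
    and p :: "nat \<Rightarrow> real^'l \<Rightarrow> (nat \<Rightarrow> real^'m) \<Rightarrow> real"
    and h :: "real^'d \<Rightarrow> real^'m \<Rightarrow> real"
    and x :: "real^'d" and \<theta>c grad :: "real^'l"
    and J :: "real^'l^'l"
    and \<alpha> :: real
  assumes prior: "prob_space \<pi>" "sets \<pi> = sets (borel_on \<Theta>)"
    and model: "\<And>\<theta>. \<theta> \<in> \<Theta> \<Longrightarrow> prob_space (P \<theta>)"
      "\<And>\<theta>. \<theta> \<in> \<Theta> \<Longrightarrow> sets (P \<theta>) = sets (borel_on \<Xi>)"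
    and kernel: "\<And>B. B \<in> sets (Pi\<^sub>M (UNIV :: nat set) (\<lambda>_. borel_on \<Xi>)) \<Longrightarrow>
      (\<lambda>\<theta>. measure (iid_seq P \<theta>) B) \<in> borel_measurable (borel_on \<Theta>)"
    and true_parameter: "\<theta>c \<in> \<Theta>"
    and decision: "closed \<X>" "x \<in> \<X>"
    and cost: "\<And>x' \<theta>. x' \<in> \<X> \<Longrightarrow> \<theta> \<in> \<Theta> \<Longrightarrow> integrable (P \<theta>) (h x')"
    and i: "compact \<Theta>"
    and ii: "\<And>n. n \<ge> 1 \<Longrightarrow> sigma_finite_measure (\<nu> n)"
      "\<And>n. n \<ge> 1 \<Longrightarrow> sets (\<nu> n) = sets (sample_space \<Xi> n)"
      "\<And>n. n \<ge> 1 \<Longrightarrow>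
        (\<lambda>(\<theta>, y). p n \<theta> y) \<in> borel_measurable (borel_on \<Theta> \<Otimes>\<^sub>M sample_space \<Xi> n)"
      "\<And>n \<theta> y. n \<ge> 1 \<Longrightarrow> \<theta> \<in> \<Theta> \<Longrightarrow> y \<in> space (sample_space \<Xi> n) \<Longrightarrow> 0 \<le> p n \<theta> y"
      "\<And>n \<theta>. n \<ge> 1 \<Longrightarrow> \<theta> \<in> \<Theta> \<Longrightarrow> iid P n \<theta> = density (\<nu> n) (\<lambda>y. ennreal (p n \<theta> y))"
    and iii: "\<And>V. borel_nhd \<Theta> \<theta>c V \<Longrightarrow> \<exists>\<phi>. uniformly_consistent_tests \<Xi> P \<Theta> \<theta>c V \<phi>"
    and iv: "\<And>\<epsilon> V. \<epsilon> > 0 \<Longrightarrow> borel_nhd \<Theta> \<theta>c V \<Longrightarrow>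
      \<exists>W \<in> sets (borel_on \<Theta>). W \<subseteq> V \<and> measure \<pi> W > 0 \<and>
        (\<forall>\<theta> \<in> W. KL_ext (P \<theta>c) (P \<theta>) < ereal \<epsilon>)"
    and v: "\<exists>\<gamma>>0. \<forall>\<epsilon>>0. \<exists>K>0. \<forall>n\<ge>1.
      measure (iid_seq P \<theta>c) {\<xi> \<in> space (iid_seq P \<theta>c).
        (\<integral>\<theta>. norm (sqrt (real n) *\<^sub>R (\<theta> - \<theta>c)) powr (1 + \<gamma>) \<partial>posterior \<pi> p n \<xi>) > K} < \<epsilon>"
    and vi_fisher: "is_fisher_information \<Theta> \<theta>c (iid P 1 \<theta>c) (p 1) J" "invertible J"
    and vi_bvm: "\<exists>\<Delta>. (\<forall>n. \<Delta> n \<in> borel_measurable (sample_space \<Xi> n)) \<and>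
      conv_in_distr (iid_seq P \<theta>c) (\<lambda>n \<xi>. \<Delta> n (restrict \<xi> {..<n})) (mv_normal 0 (matrix_inv J)) \<and>
      conv_in_prob_zero (iid_seq P \<theta>c) (\<lambda>n \<xi>. tv_dist
        (distr (posterior \<pi> p n \<xi>) borel (\<lambda>\<theta>. sqrt (real n) *\<^sub>R (\<theta> - \<theta>c)))
        (mv_normal (\<Delta> n (restrict \<xi> {..<n})) (matrix_inv J)))"
    and vi_mean: "conv_in_distr (iid_seq P \<theta>c)
      (\<lambda>n \<xi>. sqrt (real n) *\<^sub>R ((\<integral>\<theta>. \<theta> \<partial>posterior \<pi> p n \<xi>) - \<theta>c)) (mv_normal 0 (matrix_inv J))"
    and vii: "(expected_cost P h x has_derivative (\<lambda>v. grad \<bullet> v)) (at \<theta>c within \<Theta>)"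
    and viii: "AE \<xi> in iid_seq P \<theta>c. \<forall>n\<ge>1.
      has_positive_density (posterior \<pi> p n \<xi>) (\<lambda>\<theta>. sqrt (real n) *\<^sub>R (\<theta> - \<theta>c)) \<and>
      has_positive_density (posterior \<pi> p n \<xi>)
        (\<lambda>\<theta>. sqrt (real n) * (expected_cost P h x \<theta> - expected_cost P h x \<theta>c))"
    and \<alpha>: "0 < \<alpha>" "\<alpha> < 1"
    and CVaR_wellposed: "AE \<xi> in iid_seq P \<theta>c. \<forall>n\<ge>1.
      CVaR_finite (posterior \<pi> p n \<xi>) (expected_cost P h x) \<alpha>"
  shows "let Y = (\<lambda>n \<xi>. sqrt (real n) *
               (CVaR (posterior \<pi> p n \<xi>) (expected_cost P h x) \<alpha> - expected_cost P h x \<theta>c));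
             \<sigma> = sqrt (grad \<bullet> (matrix_inv J *v grad))
         in (\<forall>n. Y n \<in> borel_measurable (iid_seq P \<theta>c)) \<and>
            weak_conv_m (\<lambda>n. distr (iid_seq P \<theta>c) borel (Y n))
              (normal_law (\<sigma> / (1 - \<alpha>) * std_normal_density (inv std_normal_cdf \<alpha>)) (\<sigma>\<^sup>2))"
proof -
  let ?H = "expected_cost P h x" and ?M = "iid_seq P \<theta>c" and ?N = "std_normal_distribution"
  let ?post = "posterior \<pi> p"
  have space_\<pi>: "space \<pi> = \<Theta>"
    using sets_eq_imp_space_eq[OF prior(2)] by (simp add: space_restrict_space)
  note sets_prior = prior(2)
  interpret dominated_model \<pi> "borel_on \<Xi>" P \<nu> p \<theta>c
  proof (rule dominated_model.intro)
    show "(\<lambda>(\<theta>, y). p n \<theta> y) \<in> borel_measurable (\<pi> \<Otimes>\<^sub>M sample_space \<Xi> n)" if "n \<ge> 1" for n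
      using ii(3)[OF that] unfolding measurable_cong_sets[OF sets_pair_measure_cong[OF sets_prior refl] refl] .
  qed (use prior model ii true_parameter space_\<pi> in \<open>simp_all\<close>)
  interpret M: prob_space ?M by (rule prob_data)
  interpret N: real_distribution ?N by (rule real_distribution_std_normal)
  note bm = borel_measurable_borel_on[OF sets_prior]

  have H[measurable]: "?H \<in> borel_measurable \<pi>"
    unfolding expected_cost_def[abs_def]
    by (rule measurable_integral_kernel) (use cost decision ii(4)[of 1] space_\<pi> in auto)

  define Sg where "Sg = matrix_inv J"
  define s where "s = sqrt (grad \<bullet> (Sg *v grad))"
  define \<kappa> where "\<kappa> = s / (1 - \<alpha>) * std_normal_density (inv std_normal_cdf \<alpha>)"
  have J_Sg: "J *v (Sg *v w) = w" for w
    using matrix_inv_cancel(1)[OF vi_fisher(2)] by (simp add: Sg_def matrix_vector_mul_assoc)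
  have inv_Sg: "matrix_inv Sg = J"
    unfolding Sg_def by (rule matrix_inv_matrix_inv[OF vi_fisher(2)])
  \<comment> \<open>Since a is J applied to \<open>Sg *v a\<close>, the form of \<open>Sg\<close> at
    a is the form of J at \<open>Sg *v a\<close>.\<close>
  have pos: "0 < a \<bullet> (Sg *v a)" if "a \<noteq> 0" for a
  proof -
    have "Sg *v a \<noteq> 0" using J_Sg[of a] that by auto
    from fisher_information_symmetric_pos_def(2)[OF vi_fisher this] show ?thesis
      by (simp add: J_Sg inner_commute)
  qed
  have s0: "0 \<le> s" using pos[of grad] by (cases "grad = 0") (auto simp: s_def)

  obtain \<Delta> where \<Delta>_conv: "conv_in_distr ?M (\<lambda>n \<xi>. \<Delta> n (restrict \<xi> {..<n})) (mv_normal 0 Sg)"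
    and \<Delta>_tv: "conv_in_prob_zero ?M (\<lambda>n \<xi>. tv_dist
        (distr (?post n \<xi>) borel (\<lambda>\<theta>. sqrt (real n) *\<^sub>R (\<theta> - \<theta>c))) (mv_normal (\<Delta> n (restrict \<xi> {..<n})) Sg))"
    using vi_bvm unfolding Sg_def by blast
  define D where "D n \<xi> = \<Delta> n (restrict \<xi> {..<n})" for n and \<xi> :: "nat \<Rightarrow> real^'m"
  have Dm[measurable]: "D n \<in> borel_measurable ?M" for n
    using \<Delta>_conv by (simp add: conv_in_distr_def D_def[abs_def])
  have mv0: "prob_space (mv_normal 0 Sg)"
    by (rule prob_space_of_conv_in_distr[OF prob_data \<Delta>_conv])
  have mv_sets[simp, measurable_cong]: "sets (mv_normal \<mu> Sg) = sets borel" for \<mu> :: "real^'l" by (simp add: mv_normal_def)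
  have mv: "prob_space (mv_normal \<mu> Sg)" for \<mu>
    by (subst mv_normal_shift, rule prob_space.prob_space_distr[OF mv0]) simp
  have law: "distr (mv_normal \<mu> Sg) borel (\<lambda>z. grad \<bullet> z) = distr ?N borel (\<lambda>u. grad \<bullet> \<mu> + s * u)" for \<mu>
    unfolding s_def
    by (rule distr_mv_normal_inner[OF mv0])
      (use J_Sg fisher_information_symmetric_pos_def(1)[OF vi_fisher] pos in \<open>auto simp: inv_Sg\<close>)

  define z where "z n \<theta> = sqrt (real n) *\<^sub>R (\<theta> - \<theta>c)" for n and \<theta> :: "real^'l"
  have zm[measurable]: "z n \<in> borel_measurable \<pi>" for n
    unfolding z_def[abs_def] by (rule bm) measurable
  define V where "V n \<xi> = sqrt (real n) * (CVaR (?post n \<xi>) ?H \<alpha> - ?H \<theta>c)" for n \<xi>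
  have Vm: "V n \<in> borel_measurable ?M" for n
  proof (cases "n \<ge> 1")
    case True
    have "(\<lambda>\<xi>. CVaR (?post n \<xi>) ?H \<alpha>) \<in> borel_measurable ?M"
    proof (rule measurable_CVaR[OF _ _ _ _ \<alpha>])
      show "(\<lambda>\<xi>. measure (?post n \<xi>) {\<theta> \<in> space (?post n \<xi>). ?H \<theta> \<le> t}) \<in> borel_measurable ?M" for t
        unfolding space_posterior by (rule measurable_measure_posterior[OF True]) measurable
      show "(\<lambda>\<xi>. measure (?post n \<xi>) (space (?post n \<xi>))) \<in> borel_measurable ?M"
        unfolding space_posterior by (rule measurable_measure_posterior[OF True]) measurable
    qed (use posterior_prob_or_null(1)[OF True] in \<open>auto simp: H\<close>)
    then show ?thesis unfolding V_def[abs_def] by measurable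
  next
    case False
    then have "n = 0" by simp
    then show ?thesis by (simp add: V_def[abs_def])
  qed
  define T where "T n \<xi> = tv_dist (distr (?post n \<xi>) borel (z n)) (mv_normal (D n \<xi>) Sg)" for n \<xi>
  have fin_distr: "finite_measure (distr (?post n \<xi>) borel (z n))" if "n \<ge> 1" "\<xi> \<in> space ?M" for n \<xi>
    by (rule finite_measure.finite_measure_distr[OF posterior_prob_or_null(3)[OF that]]) measurable
  have Tm: "T n \<in> borel_measurable ?M" if n: "n \<ge> 1" for n
    unfolding T_def[abs_def]
  proof (rule measurable_tv_dist)
    show "(\<lambda>\<xi>. measure (distr (?post n \<xi>) borel (z n)) U) \<in> borel_measurable ?M" if "open U" for U
    proof -
      have "z n -` U \<inter> space \<pi> \<in> sets \<pi>" using that by (intro measurable_sets[OF zm]) auto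
      from measurable_measure_posterior[OF n this] show ?thesis
        using that by (simp add: measure_distr)
    qed
    show "(\<lambda>\<xi>. measure (mv_normal (D n \<xi>) Sg) U) \<in> borel_measurable ?M" if "open U" for U
      using that by (intro measurable_mv_normal Dm) auto
  qed (use fin_distr[OF n] prob_space.finite_measure[OF mv] in auto)

  \<comment> \<open>The data enter only through the centre \<open>D n\<close>; \<kappa> is the
    amount by which the CVaR of a normal law with standard deviation s exceeds its mean.\<close>
  define Z where "Z n \<xi> = grad \<bullet> D n \<xi> + \<kappa>" for n \<xi>
  have Zm: "Z n \<in> borel_measurable ?M" for n unfolding Z_def[abs_def] by measurable
  have L_eq: "normal_law \<kappa> (s\<^sup>2) = distr ?N borel (\<lambda>u. \<kappa> + s * u)" by (rule normal_law_eq_distr[OF s0])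
  have conv: "(\<lambda>n. \<integral>\<xi>. f (Z n \<xi>) \<partial>?M) \<longlonglongrightarrow> (\<integral>u. f u \<partial>normal_law \<kappa> (s\<^sup>2))"
    if f: "continuous_on UNIV f" "bounded (range f)" for f :: "real \<Rightarrow> real"
  proof -
    have [measurable]: "f \<in> borel_measurable borel" by (rule borel_measurable_continuous_onI[OF f(1)])
    have "continuous_on UNIV (\<lambda>v. f (grad \<bullet> v + \<kappa>))"
      by (rule continuous_on_compose2[OF f(1)]) (auto intro!: continuous_intros)
    moreover have "bounded (range (\<lambda>v. f (grad \<bullet> v + \<kappa>)))"
      by (rule bounded_subset[OF f(2)]) auto
    ultimately have "(\<lambda>n. \<integral>\<xi>. f (Z n \<xi>) \<partial>?M) \<longlonglongrightarrow> (\<integral>v. f (grad \<bullet> v + \<kappa>) \<partial>mv_normal 0 Sg)"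
      using \<Delta>_conv unfolding conv_in_distr_def Z_def D_def by blast
    also have "(\<integral>v. f (grad \<bullet> v + \<kappa>) \<partial>mv_normal 0 Sg) = (\<integral>w. f (w + \<kappa>) \<partial>distr (mv_normal 0 Sg) borel (\<lambda>v. grad \<bullet> v))"
      by (subst integral_distr) auto
    also have "\<dots> = (\<integral>u. f u \<partial>normal_law \<kappa> (s\<^sup>2))"
      unfolding law L_eq by (subst (1 2) integral_distr) (auto simp: add.commute)
    finally show ?thesis .
  qed

  have close: "eventually (\<lambda>n. measure ?M {\<xi> \<in> space ?M. \<bar>V n \<xi> - Z n \<xi>\<bar> > \<delta>} \<le> e) sequentially"
    if \<delta>: "0 < \<delta>" and e: "0 < e" for \<delta> e
  proof -
    obtain \<gamma> where \<gamma>: "0 < \<gamma>" and v': "\<forall>\<epsilon>>0. \<exists>K>0. \<forall>n\<ge>1. measure ?M {\<xi> \<in> space ?M.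
        (\<integral>\<theta>. norm (z n \<theta>) powr (1 + \<gamma>) \<partial>?post n \<xi>) > K} < \<epsilon>"
      using v unfolding z_def by blast
    have e4: "0 < e / 4" using e by simp
    obtain K where K: "0 < K" and Kb: "\<And>n. n \<ge> 1 \<Longrightarrow> measure ?M {\<xi> \<in> space ?M.
        (\<integral>\<theta>. norm (z n \<theta>) powr (1 + \<gamma>) \<partial>?post n \<xi>) > K} < e / 4"
      using v' e4 by blast
    obtain B where B: "0 < B" and Bb: "eventually (\<lambda>n. measure ?M {\<xi> \<in> space ?M. norm (D n \<xi>) > B} \<le> e / 4) sequentially"
      using conv_in_distr_tight[OF prob_data mv0 mv_sets \<Delta>_conv e4] unfolding D_def by blast
    have gB: "0 \<le> norm grad * B" using B by simp
    \<comment> \<open>The tolerances are fixed before the neighbourhood of \<open>\<theta>c\<close>,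
      whose radius depends on \<eta>, and before n.\<close>
    obtain \<tau>0 \<eta> where \<tau>0: "0 < \<tau>0" and \<eta>: "0 < \<eta>" and core:
      "\<And>(Q::(real^'l) measure) X W \<zeta> F m V. prob_space Q \<Longrightarrow> X \<in> borel_measurable Q \<Longrightarrow> W \<in> borel_measurable Q \<Longrightarrow>
        \<zeta> \<in> borel_measurable Q \<Longrightarrow> F \<in> sets Q \<Longrightarrow> \<bar>m\<bar> \<le> norm grad * B \<Longrightarrow>
        (\<And>D. D \<in> sets borel \<Longrightarrow> \<bar>measure (distr Q borel W) D - measure (distr ?N borel (\<lambda>u. m + s * u)) D\<bar> \<le> \<tau>0) \<Longrightarrow>
        (\<And>\<omega>. \<omega> \<in> space Q \<Longrightarrow> 0 \<le> \<zeta> \<omega>) \<Longrightarrow>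
        (\<And>\<omega>. \<omega> \<in> space Q \<Longrightarrow> \<omega> \<notin> F \<Longrightarrow> \<bar>X \<omega> - W \<omega>\<bar> \<le> \<eta> * \<zeta> \<omega>) \<Longrightarrow>
        (\<And>\<omega>. \<omega> \<in> space Q \<Longrightarrow> \<bar>W \<omega>\<bar> \<le> norm grad * \<zeta> \<omega>) \<Longrightarrow>
        integrable Q (\<lambda>\<omega>. \<zeta> \<omega> powr (1 + \<gamma>)) \<Longrightarrow> (\<integral>\<omega>. \<zeta> \<omega> powr (1 + \<gamma>) \<partial>Q) \<le> K \<Longrightarrow>
        measure Q F \<le> \<tau>0 \<Longrightarrow> (\<integral>\<omega>. indicator F \<omega> * max 0 (X \<omega>) \<partial>Q) \<le> \<tau>0 \<Longrightarrow>
        superquantile Q X \<alpha> V \<Longrightarrow> \<bar>V - (m + \<kappa>)\<bar> \<le> \<delta>"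
    proof (rule superquantile_close_normal[OF \<alpha> less_imp_le[OF K] gB norm_ge_zero[of grad] \<gamma> s0 \<delta>,
          where 'a="real^'l", folded \<kappa>_def], goal_cases)
      case (1 \<tau> \<eta>)
      show ?case by (rule 1(1)[OF 1(2,3)]) (fact 1(4))
    qed
    obtain r where r: "0 < r" and rb: "\<And>\<theta>. \<theta> \<in> \<Theta> \<Longrightarrow> norm (\<theta> - \<theta>c) < r \<Longrightarrow>
        \<bar>?H \<theta> - ?H \<theta>c - grad \<bullet> (\<theta> - \<theta>c)\<bar> \<le> \<eta> * norm (\<theta> - \<theta>c)"
      using has_derivative_within_bound[OF vii \<eta>] by blast
    define U where "U = \<Theta> \<inter> ball \<theta>c r"
    define F where "F = \<Theta> - U"
    have U_nhd: "borel_nhd \<Theta> \<theta>c U"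
      unfolding borel_nhd_def U_def using r
      by (auto simp: sets_restrict_space intro!: exI[of _ "ball \<theta>c r"])
    then have U_sets: "U \<in> sets \<pi>" unfolding sets_prior borel_nhd_def by blast
    then have F_sets[measurable]: "F \<in> sets \<pi>" unfolding F_def space_\<pi>[symmetric] by auto
    have far: "r \<le> norm (\<theta> - \<theta>c)" if "\<theta> \<in> F" for \<theta>
      using that by (auto simp: F_def U_def dist_norm norm_minus_commute)
    have near: "norm (\<theta> - \<theta>c) < r" if "\<theta> \<in> \<Theta>" "\<theta> \<notin> F" for \<theta>
      using that by (auto simp: F_def U_def dist_norm norm_minus_commute)
    obtain \<phi> where \<phi>: "uniformly_consistent_tests \<Xi> P \<Theta> \<theta>c U \<phi>" using iii[OF U_nhd] by blast
    \<comment> \<open>Unscaled: the factor sqrt n is carried by the threshold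
      \<open>\<tau>0 / sqrt n\<close> of the tail event.\<close>
    define f where "f \<theta> = ennreal (max 0 (?H \<theta> - ?H \<theta>c))" for \<theta>
    have fm[measurable]: "f \<in> borel_measurable \<pi>" unfolding f_def[abs_def] by measurable
    have KL: "\<exists>W\<in>sets \<pi>. 0 < measure \<pi> W \<and> (\<forall>\<theta>\<in>W. KL_ext (P \<theta>c) (P \<theta>) < ereal \<epsilon>)" if "0 < \<epsilon>" for \<epsilon>
      using iv[OF that U_nhd] unfolding sets_prior by blast
    have tail: "eventually (\<lambda>n. measure ?M {\<xi> \<in> space ?M. ennreal (\<tau>0 / sqrt n) <
        (\<integral>\<^sup>+\<theta>. indicator F \<theta> * f \<theta> \<partial>?post n \<xi>)} \<le> e / 4) sequentially"
    proof (rule posterior_tail_prob[OF F_sets fm _ KL _ _ _ _ \<tau>0 e4, where \<phi>=\<phi>])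
      show "AE \<xi> in ?M. prob_space (?post 1 \<xi>) \<longrightarrow> (\<integral>\<^sup>+\<theta>. f \<theta> \<partial>?post 1 \<xi>) < \<infinity>"
        using CVaR_wellposed
      proof eventually_elim
        case (elim \<xi>)
        show ?case
        proof
          assume "prob_space (?post 1 \<xi>)"
          then interpret p1: prob_space "?post 1 \<xi>" .
          \<comment> \<open>Finiteness of CVaR after one observation is what tames a possibly
            unbounded cost.\<close>
          have "integrable (?post 1 \<xi>) (\<lambda>\<theta>. max 0 (?H \<theta> - ?H \<theta>c))"
            using elim by (intro p1.CVaR_eq_VaR_plus(1)[OF _ \<alpha>]) auto
          then have "(\<integral>\<^sup>+\<theta>. ennreal (norm (max 0 (?H \<theta> - ?H \<theta>c))) \<partial>?post 1 \<xi>) < \<infinity>"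
            by (simp only: integrable_iff_bounded)
          then show "(\<integral>\<^sup>+\<theta>. f \<theta> \<partial>?post 1 \<xi>) < \<infinity>" by (simp add: f_def)
        qed
      qed
    qed (use \<phi> in \<open>auto simp: uniformly_consistent_tests_def F_def\<close>)
    define R where "R n \<xi> = (\<integral>\<theta>. norm (z n \<theta>) powr (1 + \<gamma>) \<partial>?post n \<xi>)" for n \<xi>
    have Rm: "R n \<in> borel_measurable ?M" if n: "n \<ge> 1" for n
    proof -
      have "(\<lambda>\<xi>. enn2real (\<integral>\<^sup>+\<theta>. ennreal (norm (z n \<theta>) powr (1 + \<gamma>)) \<partial>?post n \<xi>)) \<in> borel_measurable ?M"
        using measurable_nn_integral_posterior[OF n, of "\<lambda>\<theta>. ennreal (norm (z n \<theta>) powr (1 + \<gamma>))"] by measurable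
      then show ?thesis
        unfolding R_def[abs_def] by (subst integral_eq_nn_integral) auto
    qed
    \<comment> \<open>A value below 1 excludes the null posterior, which differs from a probability
      measure by 1 on the whole space.\<close>
    define \<tau> where "\<tau> = min \<tau>0 (1 / 2)"
    have \<tau>: "0 < \<tau>" "\<tau> \<le> \<tau>0" "\<tau> < 1" using \<tau>0 by (auto simp: \<tau>_def)
    have "(\<lambda>n. measure ?M {\<xi> \<in> space ?M. \<bar>T n \<xi>\<bar> > \<tau>}) \<longlonglongrightarrow> 0"
      using \<Delta>_tv \<tau>(1) unfolding conv_in_prob_zero_def T_def z_def[abs_def] D_def by blast
    from order_tendstoD(2)[OF this e4]
    have Tb: "eventually (\<lambda>n. measure ?M {\<xi> \<in> space ?M. \<bar>T n \<xi>\<bar> > \<tau>} < e / 4) sequentially" .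
    \<comment> \<open>Markov's inequality for the posterior mass of F, where the scaled parameter
      has norm at least sqrt n times r.\<close>
    have "(\<lambda>n. K / (sqrt (real n) * r) powr (1 + \<gamma>)) \<longlonglongrightarrow> 0" using r \<gamma> by real_asymp
    from order_tendstoD(2)[OF this \<tau>0]
    have Fb: "eventually (\<lambda>n. K / (sqrt (real n) * r) powr (1 + \<gamma>) < \<tau>0) sequentially" .
    \<comment> \<open>Compactness makes the moments in (v) genuinely integrable. Without this the
      bound on a Bochner integral, with its default value 0, would carry no information.\<close>
    obtain b where b: "\<And>\<theta>. \<theta> \<in> \<Theta> \<Longrightarrow> norm (\<theta> - \<theta>c) \<le> b"
    proof -
      obtain c where "\<forall>\<theta>\<in>\<Theta>. dist \<theta>c \<theta> \<le> c"
        using compact_imp_bounded[OF i] bounded_any_center[of \<Theta> \<theta>c] by blast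
      then show thesis using that[of c] by (simp add: dist_norm norm_minus_commute)
    qed

    \<comment> \<open>The deterministic part: one data sequence outside all exceptional
      events.\<close>
    have det: "\<bar>V n \<xi> - Z n \<xi>\<bar> \<le> \<delta>"
      if n: "n \<ge> 1" and \<xi>: "\<xi> \<in> space ?M" and F_small: "K / (sqrt (real n) * r) powr (1 + \<gamma>) < \<tau>0"
        and fin: "CVaR_finite (?post n \<xi>) ?H \<alpha>" and T: "\<bar>T n \<xi>\<bar> \<le> \<tau>" and DB: "norm (D n \<xi>) \<le> B"
        and RK: "R n \<xi> \<le> K" and tl: "(\<integral>\<^sup>+\<theta>. indicator F \<theta> * f \<theta> \<partial>?post n \<xi>) \<le> ennreal (\<tau>0 / sqrt n)" for n \<xi>
    proof -
      let ?Q = "?post n \<xi>"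
      have sn: "0 < sqrt (real n)" using n by simp
      have tvA: "\<bar>measure (distr ?Q borel (z n)) A - measure (mv_normal (D n \<xi>) Sg) A\<bar> \<le> \<tau>" if "A \<in> sets borel" for A
        using measure_diff_le_tv_dist[OF fin_distr[OF n \<xi>] prob_space.finite_measure[OF mv], of A "D n \<xi>"] that T
        by (simp add: T_def)
      have Q: "prob_space ?Q"
      proof (rule ccontr)
        assume "\<not> prob_space ?Q"
        then have "emeasure ?Q (space \<pi>) = 0" using posterior_prob_or_null(1)[OF n \<xi>] by blast
        then have "measure (distr ?Q borel (z n)) UNIV = 0"
          by (subst measure_distr) (simp_all add: measure_def)
        moreover have "measure (mv_normal (D n \<xi>) Sg) UNIV = 1"
          using prob_space.prob_space[OF mv, of "D n \<xi>"] sets_eq_imp_space_eq[OF mv_sets, of "D n \<xi>"] by simp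
        ultimately show False using tvA[of UNIV] \<tau>(3) by simp
      qed
      interpret Q: prob_space ?Q by (rule Q)
      define X where "X \<theta> = sqrt (real n) * (?H \<theta> - ?H \<theta>c)" for \<theta>
      define W where "W \<theta> = grad \<bullet> z n \<theta>" for \<theta>
      have Xm[measurable]: "X \<in> borel_measurable \<pi>" and Wm[measurable]: "W \<in> borel_measurable \<pi>"
        unfolding X_def[abs_def] W_def[abs_def] by measurable
      have powr_int: "integrable ?Q (\<lambda>\<theta>. norm (z n \<theta>) powr (1 + \<gamma>))"
      proof (rule Q.integrable_const_bound[where B="(sqrt (real n) * b) powr (1 + \<gamma>)"])
        show "AE \<theta> in ?Q. norm (norm (z n \<theta>) powr (1 + \<gamma>)) \<le> (sqrt (real n) * b) powr (1 + \<gamma>)"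
          using b \<gamma> by (intro AE_I2) (auto simp: space_\<pi> z_def intro!: powr_mono2 mult_left_mono)
      qed measurable
      let ?c = "(sqrt (real n) * r) powr (1 + \<gamma>)"
      have c: "0 < ?c" using sn r by simp
      have "measure ?Q F = (\<integral>\<theta>. indicator F \<theta> \<partial>?Q)" by simp
      also have "\<dots> \<le> (\<integral>\<theta>. norm (z n \<theta>) powr (1 + \<gamma>) / ?c \<partial>?Q)"
      proof (rule integral_mono)
        show "integrable ?Q (indicator F :: _ \<Rightarrow> real)" by (rule Q.integrable_const_bound[where B=1]) auto
        show "(indicator F \<theta> :: real) \<le> norm (z n \<theta>) powr (1 + \<gamma>) / ?c" for \<theta>
        proof (cases "\<theta> \<in> F")
          case True
          have "?c \<le> norm (z n \<theta>) powr (1 + \<gamma>)"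
            using far[OF True] r \<gamma> by (intro powr_mono2) (auto simp: z_def mult_left_mono)
          then show ?thesis using True c by simp
        qed simp
      qed (use powr_int in simp)
      also have "\<dots> \<le> K / ?c" using RK c by (simp add: R_def divide_right_mono)
      finally have QF: "measure ?Q F \<le> \<tau>0" using F_small by simp
      have eq: "ennreal (indicator F \<theta> * max 0 (X \<theta>)) = ennreal (sqrt (real n)) * (indicator F \<theta> * f \<theta>)" for \<theta>
      proof -
        have "max 0 (X \<theta>) = sqrt (real n) * max 0 (?H \<theta> - ?H \<theta>c)"
          using sn by (simp add: X_def max_mult_distrib_left)
        then show ?thesis by (cases "\<theta> \<in> F") (simp_all add: f_def ennreal_mult)
      qed
      have "(\<integral>\<^sup>+\<theta>. ennreal (indicator F \<theta> * max 0 (X \<theta>)) \<partial>?Q) = ennreal (sqrt (real n)) * (\<integral>\<^sup>+\<theta>. indicator F \<theta> * f \<theta> \<partial>?Q)"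
        unfolding eq by (rule nn_integral_cmult) measurable
      also have "\<dots> \<le> ennreal (sqrt (real n)) * ennreal (\<tau>0 / sqrt n)" by (rule mult_left_mono[OF tl]) simp
      also have "\<dots> = ennreal \<tau>0" using sn \<tau>0 by (simp add: ennreal_mult[symmetric])
      finally have le: "(\<integral>\<^sup>+\<theta>. ennreal (indicator F \<theta> * max 0 (X \<theta>)) \<partial>?Q) \<le> ennreal \<tau>0" .
      have "(\<integral>\<theta>. indicator F \<theta> * max 0 (X \<theta>) \<partial>?Q) = enn2real (\<integral>\<^sup>+\<theta>. ennreal (indicator F \<theta> * max 0 (X \<theta>)) \<partial>?Q)"
        by (rule integral_eq_nn_integral) auto
      also have "\<dots> \<le> \<tau>0" using enn2real_mono[OF le] \<tau>0 by simp
      finally have XF: "(\<integral>\<theta>. indicator F \<theta> * max 0 (X \<theta>) \<partial>?Q) \<le> \<tau>0" .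
      have "\<bar>V n \<xi> - (grad \<bullet> D n \<xi> + \<kappa>)\<bar> \<le> \<delta>"
      proof (rule core[of ?Q X W "\<lambda>\<theta>. norm (z n \<theta>)" F])
        show "prob_space ?Q" by (rule Q)
        show "X \<in> borel_measurable ?Q" "W \<in> borel_measurable ?Q" "(\<lambda>\<theta>. norm (z n \<theta>)) \<in> borel_measurable ?Q"
          by measurable
        show "F \<in> sets ?Q" by simp
        have "\<bar>grad \<bullet> D n \<xi>\<bar> \<le> norm grad * norm (D n \<xi>)" by (rule Cauchy_Schwarz_ineq2)
        also have "\<dots> \<le> norm grad * B" by (rule mult_left_mono[OF DB]) simp
        finally show "\<bar>grad \<bullet> D n \<xi>\<bar> \<le> norm grad * B" .
        \<comment> \<open>Both laws are images under the inner product with \<open>grad\<close>, so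
          taking the preimage of E reduces the claim to the total variation distance on the
          parameter space.\<close>
        show "\<bar>measure (distr ?Q borel W) E - measure (distr ?N borel (\<lambda>u. grad \<bullet> D n \<xi> + s * u)) E\<bar> \<le> \<tau>0"
          if E: "E \<in> sets borel" for E
        proof -
          let ?A = "(\<lambda>v. grad \<bullet> v) -` E :: (real^'l) set"
          have A: "?A \<in> sets borel" using measurable_sets[of "\<lambda>v. grad \<bullet> v" borel borel E] E by simp
          have "distr ?Q borel W = distr (distr ?Q borel (z n)) borel (\<lambda>v. grad \<bullet> v)"
            unfolding W_def[abs_def] by (subst distr_distr) (auto simp: o_def)
          then have "measure (distr ?Q borel W) E = measure (distr ?Q borel (z n)) ?A"
            using E by (simp add: measure_distr)
          moreover have "measure (distr ?N borel (\<lambda>u. grad \<bullet> D n \<xi> + s * u)) E = measure (mv_normal (D n \<xi>) Sg) ?A"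
            unfolding law[symmetric] using E sets_eq_imp_space_eq[OF mv_sets, of "D n \<xi>"] by (subst measure_distr) auto
          ultimately show ?thesis using tvA[OF A] \<tau>(2) by simp
        qed
        show "\<bar>X \<theta> - W \<theta>\<bar> \<le> \<eta> * norm (z n \<theta>)" if "\<theta> \<in> space ?Q" "\<theta> \<notin> F" for \<theta>
        proof -
          have \<theta>: "\<theta> \<in> \<Theta>" using that(1) by (simp add: space_\<pi>)
          have "X \<theta> - W \<theta> = sqrt (real n) * (?H \<theta> - ?H \<theta>c - grad \<bullet> (\<theta> - \<theta>c))"
            by (simp add: X_def W_def z_def algebra_simps)
          then have "\<bar>X \<theta> - W \<theta>\<bar> = sqrt (real n) * \<bar>?H \<theta> - ?H \<theta>c - grad \<bullet> (\<theta> - \<theta>c)\<bar>"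
            by (simp add: abs_mult)
          also have "\<dots> \<le> sqrt (real n) * (\<eta> * norm (\<theta> - \<theta>c))"
            by (intro mult_left_mono rb \<theta> near that) simp
          finally show ?thesis by (simp add: z_def mult_ac)
        qed
        show "\<bar>W \<theta>\<bar> \<le> norm grad * norm (z n \<theta>)" for \<theta>
          unfolding W_def by (rule Cauchy_Schwarz_ineq2)
        show "integrable ?Q (\<lambda>\<theta>. norm (z n \<theta>) powr (1 + \<gamma>))" by (rule powr_int)
        show "(\<integral>\<theta>. norm (z n \<theta>) powr (1 + \<gamma>) \<partial>?Q) \<le> K" using RK by (simp add: R_def)
        show "measure ?Q F \<le> \<tau>0" by (rule QF)
        show "(\<integral>\<theta>. indicator F \<theta> * max 0 (X \<theta>) \<partial>?Q) \<le> \<tau>0" by (rule XF)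
        show "superquantile ?Q X \<alpha> (V n \<xi>)"
          unfolding X_def[abs_def] V_def
          by (rule superquantile_scale[OF Q.superquantile_CVaR[OF _ \<alpha> fin] sn \<alpha>(2)]) simp
      qed simp
      then show ?thesis by (simp add: Z_def)
    qed

    show ?thesis
      using Tb Bb tail Fb eventually_ge_at_top[of "1::nat"]
    proof eventually_elim
      case (elim n)
      note n = elim(5)
      note [measurable] = Rm[OF n] Tm[OF n] Vm Zm
      \<comment> \<open>Four exceptional events of probability at most e / 4 each; finiteness of
        CVaR fails only on a null set.\<close>
      let ?E1 = "{\<xi> \<in> space ?M. \<bar>T n \<xi>\<bar> > \<tau>}" and ?E2 = "{\<xi> \<in> space ?M. norm (D n \<xi>) > B}"
        and ?E3 = "{\<xi> \<in> space ?M. R n \<xi> > K}"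
        and ?E4 = "{\<xi> \<in> space ?M. ennreal (\<tau>0 / sqrt n) < (\<integral>\<^sup>+\<theta>. indicator F \<theta> * f \<theta> \<partial>?post n \<xi>)}"
      have [measurable]: "(\<lambda>\<xi>. \<integral>\<^sup>+\<theta>. indicator F \<theta> * f \<theta> \<partial>?post n \<xi>) \<in> borel_measurable ?M"
        by (rule measurable_nn_integral_posterior[OF n]) measurable
      have E: "?E1 \<in> sets ?M" "?E2 \<in> sets ?M" "?E3 \<in> sets ?M" "?E4 \<in> sets ?M" by measurable
      have "measure ?M {\<xi> \<in> space ?M. \<bar>V n \<xi> - Z n \<xi>\<bar> > \<delta>} \<le> measure ?M (?E1 \<union> ?E2 \<union> ?E3 \<union> ?E4)"
      proof (rule M.finite_measure_mono_AE)
        show "AE \<xi> in ?M. \<xi> \<in> {\<xi> \<in> space ?M. \<bar>V n \<xi> - Z n \<xi>\<bar> > \<delta>} \<longrightarrow> \<xi> \<in> ?E1 \<union> ?E2 \<union> ?E3 \<union> ?E4"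
        proof (rule eventually_mono[OF CVaR_wellposed], intro impI, rule ccontr)
          fix \<xi> assume "\<forall>n\<ge>1. CVaR_finite (?post n \<xi>) ?H \<alpha>" "\<xi> \<in> {\<xi> \<in> space ?M. \<bar>V n \<xi> - Z n \<xi>\<bar> > \<delta>}"
            "\<xi> \<notin> ?E1 \<union> ?E2 \<union> ?E3 \<union> ?E4"
          then show False using det[OF n, of \<xi>] elim(4) n by (auto simp: not_less)
        qed
      qed (intro sets.Un E)
      also have "\<dots> \<le> measure ?M ?E1 + measure ?M ?E2 + measure ?M ?E3 + measure ?M ?E4"
        by (intro order_trans[OF measure_Un_le] add_mono order.refl sets.Un E)
      also have "\<dots> \<le> e / 4 + e / 4 + e / 4 + e / 4"
        using elim Kb[OF n] by (intro add_mono) (auto simp: R_def)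
      finally show ?case by simp
    qed
  qed

  have "weak_conv_m (\<lambda>n. distr ?M borel (V n)) (normal_law \<kappa> (s\<^sup>2))"
  proof (rule weak_conv_of_close[OF prob_data Vm Zm _ close conv])
    show "real_distribution (normal_law \<kappa> (s\<^sup>2))"
      unfolding L_eq by (rule N.real_distribution_distr) simp
  qed
  then show ?thesis
    using Vm unfolding Let_def V_def[abs_def] \<kappa>_def s_def Sg_def by blast
qed

end
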